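(* Let $\gamma\in(\frac16,\frac14]$. Suppose that $X\sim P_{\vartheta_0}$ satisfies the Linnik condition of order $\gamma$, and that the sequences $\alpha(n)\to0$, $\beta(n)\to0$ satisfy the Osipov-type condition of order $\gamma$. Then $$P_{\vartheta_0}^{\times n}\left(\sqrt n\,\frac{\bar X_n-B'(\vartheta_0)}{\sqrt{B''(\vartheta_0)}}>z_{1-\alpha(n)}+\frac{B'''(\vartheta_0)}{6\sqrt n\,(B''(\vartheta_0))^{3/2}}\,z_{1-\alpha(n)}^2\right)\sim\alpha(n),\quad n\to\infty.$$
   Context: Let $\nu$ be a $\sigma$-finite measure on $\mathbb{R}$ and, for real $\vartheta$ with $\int e^{\vartheta x}\nu(dx)<\infty$, let $P_\vartheta$ be the probability distribution with Radon-Nikodym density $\frac{dP_\vartheta}{d\nu}(x)=e^{\vartheta x-B(\vartheta)}$, where $B(\vartheta)=\ln\int e^{\vartheta x}\nu(dx)$. The expectation function $\vartheta\mapsto B'(\vartheta)=E_\vartheta X$ is assumed to be strictly monotone. The parameter $\vartheta_0$ is such that $B$ is three times differentiable at $\vartheta_0$ and $B''(\vartheta_0)>0$. $P_{\vartheta_0}^{\times n}$ is the $n$-fold product measure, i.e. the joint law of i.i.d. $X_1,\dots,X_n\sim P_{\vartheta_0}$, and $\bar X_n=\frac1n\sum_{i=1}^nX_i$. $z_q$ denotes the quantile of order $q$ of the standard Gaussian distribution. $f(n)\sim g(n)$ means $f(n)/g(n)\to1$. $\alpha(n),\beta(n)\in(0,1)$. Linnik condition of order $\gamma>0$ (for $X\sim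 P_{\vartheta_0}$, with mean $B'(\vartheta_0)$): $E_{\vartheta_0}\exp\{|X-B'(\vartheta_0)|^{4\gamma/(2\gamma+1)}\}<\infty$. Osipov-type condition of order $\gamma$: $n^{\gamma}\exp\{n^{2\gamma}/2\}\cdot\min\{\alpha(n),\beta(n)\}\to\infty$ and $\max\{z_{1-\alpha(n)},z_{1-\beta(n)}\}=o(n^\gamma)$ as $n\to\infty$. *)

theory Defs
  imports "HOL-Probability.Probability" "HOL-Library.Landau_Symbols"
begin

definition nat_params :: "real measure \<Rightarrow> real set" where
  "nat_params \<nu> = {\<theta>. (\<integral>\<^sup>+ x. ennreal (exp (\<theta> * x)) \<partial>\<nu>) < \<infinity>}"

definition log_partition :: "real measure \<Rightarrow> real \<Rightarrow> real" where
  "log_partition \<nu> \<theta> = ln (\<integral>x. exp (\<theta> * x) \<partial>\<nu>)"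

definition exp_family :: "real measure \<Rightarrow> real \<Rightarrow> real measure" where
  "exp_family \<nu> \<theta> = density \<nu> (\<lambda>x. ennreal (exp (\<theta> * x - log_partition \<nu> \<theta>)))"

text \<open>
  Derivatives are taken relative to the set \<open>S\<close> on which the function lives. At interior points of
  \<open>S\<close> these are the ordinary derivatives; if \<open>S\<close> is an interval and \<open>x\<close> an end point of it, they are
  one-sided. The value is meaningful only where the derivative exists and \<open>x\<close> is a limit point of
  \<open>S\<close>, which is what \<open>times_differentiable_within\<close> provides.
\<close>

primrec nth_deriv_within :: "real set \<Rightarrow> nat \<Rightarrow> (real \<Rightarrow> real) \<Rightarrow> real \<Rightarrow> real" where
  "nth_deriv_within S 0 f = f"
| "nth_deriv_within S (Suc k) f =
     (\<lambda>x. vector_derivative (nth_deriv_within S k f) (at x within S))"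

text \<open>
  To be \<open>k\<close> times differentiable at \<open>x\<close>, the derivatives of order less than \<open>k\<close> must exist near \<open>x\<close>
  (in \<open>S\<close>), and the one of order \<open>k\<close> only at \<open>x\<close> itself.
\<close>

definition times_differentiable_within :: "nat \<Rightarrow> (real \<Rightarrow> real) \<Rightarrow> real \<Rightarrow> real set \<Rightarrow> bool" where
  "times_differentiable_within k f x S \<longleftrightarrow>
     x \<in> S \<and> x islimpt S \<and>
     (\<forall>j<k. nth_deriv_within S j f differentiable (at x within S)) \<and>
     (\<forall>j. Suc j < k \<longrightarrow>
        (\<forall>\<^sub>F y in at x within S. nth_deriv_within S j f differentiable (at y within S)))"

abbreviation log_partition_deriv :: "real measure \<Rightarrow> nat \<Rightarrow> real \<Rightarrow> real" where
  "log_partition_deriv \<nu> k \<equiv> nth_deriv_within (nat_params \<nu>) k (log_partition \<nu>)"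

definition quantile :: "real measure \<Rightarrow> real \<Rightarrow> real" where
  "quantile M q = Inf {x. q \<le> cdf M x}"

abbreviation z_quantile :: "real \<Rightarrow> real" where
  "z_quantile \<equiv> quantile std_normal_distribution"

definition linnik_condition :: "real \<Rightarrow> real measure \<Rightarrow> real \<Rightarrow> bool" where
  "linnik_condition \<gamma> M m \<longleftrightarrow>
     (\<integral>\<^sup>+ x. ennreal (exp (\<bar>x - m\<bar> powr (4 * \<gamma> / (2 * \<gamma> + 1)))) \<partial>M) < \<infinity>"

definition osipov_condition :: "real \<Rightarrow> (nat \<Rightarrow> real) \<Rightarrow> (nat \<Rightarrow> real) \<Rightarrow> bool" where
  "osipov_condition \<gamma> \<alpha> \<beta> \<longleftrightarrow>
     filterlim (\<lambda>n. real n powr \<gamma> * exp (real n powr (2 * \<gamma>) / 2) * min (\<alpha> n) (\<beta> n))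
       at_top sequentially \<and>
     (\<lambda>n. max (z_quantile (1 - \<alpha> n)) (z_quantile (1 - \<beta> n))) \<in> o(\<lambda>n. real n powr \<gamma>)"

end

theory Submission
  imports Defs "HOL-Real_Asymp.Real_Asymp"
begin

text \<open>
  Let \<open>Y = (X - B') / sqrt B''\<close>, \<open>p = 4 \<gamma> / (2 \<gamma> + 1)\<close>, and \<open>t = z + O(z\<^sup>2 / sqrt n)\<close> the corrected quantile,
  so that \<open>t = o(n powr \<gamma>)\<close>. Restrict to the event that all \<open>\<bar>Y i\<bar> \<le> L = n powr (1/2 + \<gamma>)\<close>. Since
  \<open>L powr p = n powr (2 \<gamma>)\<close> dominates \<open>t\<^sup>2\<close>, the moment condition makes the error negligible, and
  with \<open>h = t / sqrt n\<close> it also gives \<open>h \<bar>y\<bar> = o(\<bar>y\<bar> powr p)\<close> for \<open>\<bar>y\<bar> \<le> L\<close>, so that the law of \<open>Y\<close>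
  restricted to this range can be tilted by \<open>exp (h y)\<close> with all moments under control. The mass of the tilted
  measure is \<open>Z = 1 + h\<^sup>2/2 + \<kappa> h\<^sup>3/6 + O(h\<^sup>4)\<close>, and \<open>n h\<^sup>4 = t\<^sup>4/n\<close> tends to 0 as \<open>\<gamma> \<le> 1/4\<close>.
  The tail probability equals \<open>Z\<^sup>n exp (- t\<^sup>2) E exp (- t W) 1(W > 0)\<close>, where \<open>W\<close> is the centred sum
  under the tilted law. As \<open>t\<^sup>2 = o(sqrt n)\<close>, a local version of the central limit theorem at scale \<open>1/t\<close>
  shows that the last factor is asymptotic to \<open>1 / (t sqrt (2 \<pi>))\<close>. Altogether the tail is asymptotic to
  \<open>exp (- t\<^sup>2/2 + \<kappa> t\<^sup>3 / (6 sqrt n)) / (t sqrt (2 \<pi>))\<close>, and the quadratic correction in \<open>t\<close> cancels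
  the cubic term.
\<close>

subsection \<open>A local limit theorem at scale \<open>1/t\<close>\<close>

text \<open>Two obstacles shape the argument. First, X may be a lattice variable, so characteristic
  functions need not decay away from 0 and no density is available. Second,
  \<open>\<theta>\<^sub>0\<close> may be an end point of the parameter set, so exponential moments
  of X on one side may be infinite; this is why only the truncated law is tilted. The first obstacle
  is met by the choice of scale. A Taylor expansion controls the characteristic function of the
  normalised sum for |y| up to a small multiple of sqrt n. Testing with a Gaussian window of width
  1/t multiplies it by exp (-(y/t)^2/2), which is at most exp (-|y|/2) once |y| \<ge> t^2. As t^2 =
  o(sqrt n), the two ranges overlap and the uncontrolled frequencies are never seen. The tilt
  parameter is h itself rather than the exact saddle point: the tilted mean is h + O(h^2), and the
  resulting shift of the normalised sum is of order sqrt n * h^2 = t^2 / sqrt n, which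
  vanishes.\<close>

lemma exp_neg_square_le: "exp (- y\<^sup>2 / 8) \<le> 8 / (1 + y\<^sup>2)" for y :: real
proof -
  have "(1 + y\<^sup>2) / 8 \<le> 1 + y\<^sup>2 / 8" by simp
  also have "\<dots> \<le> exp (y\<^sup>2 / 8)" by (rule exp_ge_add_one_self)
  finally have "inverse (exp (y\<^sup>2 / 8)) \<le> inverse ((1 + y\<^sup>2) / 8)"
    by (intro le_imp_inverse_le) (auto simp: add_pos_nonneg)
  thus ?thesis by (simp add: exp_minus)
qed

lemma exp_neg_abs_le: "exp (- \<bar>y\<bar> / 4) \<le> 32 / (1 + y\<^sup>2)" for y :: real
proof -
  have "(1 + y\<^sup>2) / 32 \<le> 1 + \<bar>y\<bar> / 4 + (\<bar>y\<bar> / 4)\<^sup>2 / 2" by (simp add: power_divide)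
  also have "\<dots> \<le> exp (\<bar>y\<bar> / 4)" by (rule exp_lower_Taylor_quadratic) simp
  finally have "inverse (exp (\<bar>y\<bar> / 4)) \<le> inverse ((1 + y\<^sup>2) / 32)"
    by (intro le_imp_inverse_le) (auto simp: add_pos_nonneg)
  thus ?thesis by (simp add: exp_minus)
qed

lemma integrable_lborel_inverse_square: "integrable lborel (\<lambda>y::real. C / (1 + y\<^sup>2))"
  using integrable_mult_right[OF integrable_inverse_1_plus_square[unfolded set_integrable_def], of C]
  by (simp add: einterval_def divide_inverse)

lemma exp_neg_square_eq_std_normal_integral:
  "complex_of_real (exp (- u\<^sup>2 / 2)) = (CLBINT r. std_normal_density r * iexp (u * r))"
proof -
  have "complex_of_real (exp (- u\<^sup>2 / 2)) = (CLINT r|std_normal_distribution. iexp (u * r))"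
    using fun_cong[OF char_std_normal_distribution, of u] by (simp add: char_def)
  also have "\<dots> = (CLBINT r. std_normal_density r *\<^sub>R iexp (u * r))"
    by (subst integral_density) (auto simp: normal_density_nonneg)
  finally show ?thesis by (simp add: scaleR_conv_of_real)
qed

text \<open>Parseval's identity for a Gaussian window: the window is a superposition of characters
  with Gaussian weights, so Fubini trades the law for its characteristic function. The substitution
  y = s t + t r produces the factor t on the left.\<close>

lemma (in real_distribution) gaussian_smoothing_char:
  assumes t: "t > 0"
  shows "t * (CLINT w|M. iexp (s * (t * w)) * exp (- (t * w - k)\<^sup>2 / 2))
       = (CLBINT y. std_normal_density (y / t - s) * iexp (- (k * (y / t - s))) * char M y)"
proof -
  let ?f = "\<lambda>y w. complex_of_real (std_normal_density (y / t - s)) * iexp (- (k * (y / t - s))) * iexp (y * w)"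
  have 1: "t * (iexp (s * (t * w)) * exp (- (t * w - k)\<^sup>2 / 2)) = (CLBINT y. ?f y w)" for w
  proof -
    have "(CLBINT y. ?f y w) = t * (CLBINT r. ?f (s * t + t * r) w)"
      using t by (subst lborel_integral_real_affine[of t _ "s * t"]) (auto simp: scaleR_conv_of_real)
    also have "(CLBINT r. ?f (s * t + t * r) w)
        = (CLBINT r. iexp (s * (t * w)) * (std_normal_density r * iexp ((t * w - k) * r)))"
      using t by (intro Bochner_Integration.integral_cong refl)
        (simp add: field_simps exp_add[symmetric] exp_diff exp_minus)
    also have "\<dots> = iexp (s * (t * w)) * exp (- (t * w - k)\<^sup>2 / 2)"
      by (simp only: exp_neg_square_eq_std_normal_integral integral_mult_right_zero)
    finally show ?thesis by simp
  qed
  interpret P: pair_sigma_finite lborel M by standard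
  have int0: "integrable lborel (\<lambda>y. std_normal_density (y / t - s))"
  proof -
    have "integrable lborel (\<lambda>y. std_normal_density (- s + (1 / t) * y))"
      using t lborel_integrable_real_affine[of std_normal_density "1 / t" "- s"] by simp
    thus ?thesis by (simp add: field_simps)
  qed
  have int: "integrable (lborel \<Otimes>\<^sub>M M) (case_prod ?f)"
  proof (rule P.Fubini_integrable)
    show "case_prod ?f \<in> borel_measurable (lborel \<Otimes>\<^sub>M M)" by measurable
    have "norm (?f y w) = std_normal_density (y / t - s)" for y w
      by (simp add: norm_mult normal_density_nonneg)
    thus "integrable lborel (\<lambda>x. LINT y|M. norm (case (x, y) of (y, w) \<Rightarrow> ?f y w))"
      using int0 prob_space by (simp)
    show "AE x in lborel. integrable M (\<lambda>y. case (x, y) of (y, w) \<Rightarrow> ?f y w)"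
      by (auto intro!: AE_I2 integrable_mult_right integrable_iexp)
  qed
  have "t * (CLINT w|M. iexp (s * (t * w)) * exp (- (t * w - k)\<^sup>2 / 2)) = (CLINT w|M. (CLBINT y. ?f y w))"
    by (subst integral_mult_right_zero[symmetric], subst 1) simp
  also have "\<dots> = (CLBINT y. (CLINT w|M. ?f y w))"
    using P.Fubini_integral[OF int] by simp
  also have "\<dots> = (CLBINT y. std_normal_density (y / t - s) * iexp (- (k * (y / t - s))) * char M y)"
    by (simp only: char_def integral_mult_right_zero)
  finally show ?thesis .
qed

lemma std_normal_density_le_1: "std_normal_density x \<le> 1"
proof -
  have "std_normal_density x \<le> 1 / sqrt (2 * pi) * 1"
    unfolding std_normal_density_def by (intro mult_left_mono) auto
  also have "\<dots> \<le> 1" using pi_ge_two by (simp add: real_le_rsqrt)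
  finally show ?thesis .
qed

text \<open>Up to t^2 the characteristic function itself decays. Beyond that (y/t)^2 \<ge> |y|, so
  the Gaussian kernel decays exponentially in |y| and the trivial bound 1 on the characteristic
  function suffices. The majorant is integrable and free of t.\<close>

lemma (in real_distribution) smoothed_char_bound:
  assumes t: "t > 0" and b: "\<And>y. \<bar>y\<bar> \<le> t\<^sup>2 \<Longrightarrow> norm (char M y) \<le> exp (- y\<^sup>2 / 8)"
  shows "std_normal_density (y / t - s) * norm (char M y) \<le> (8 + 32 * exp (s\<^sup>2 / 2)) / (1 + y\<^sup>2)"
proof (cases "\<bar>y\<bar> \<le> t\<^sup>2")
  case True
  have "std_normal_density (y / t - s) * norm (char M y) \<le> 1 * exp (- y\<^sup>2 / 8)"
    using std_normal_density_le_1 b[OF True] by (intro mult_mono) (auto simp: normal_density_nonneg)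
  also have "\<dots> \<le> 8 / (1 + y\<^sup>2)" using exp_neg_square_le[of y] by simp
  also have "\<dots> \<le> (8 + 32 * exp (s\<^sup>2 / 2)) / (1 + y\<^sup>2)"
    by (intro divide_right_mono) auto
  finally show ?thesis .
next
  case False
  let ?a = "y / t"
  have "\<bar>y\<bar> * t\<^sup>2 \<le> \<bar>y\<bar> * \<bar>y\<bar>" using False by (intro mult_left_mono) auto
  hence a: "\<bar>y\<bar> \<le> ?a\<^sup>2" using t by (simp add: power_divide field_simps power2_eq_square)
  \<comment> \<open>The difference of (a - s)^2 and a^2/2 - s^2 is 2 (a/2 - s)^2: giving up half of
    a^2 removes the shift s.\<close>
  have "0 \<le> (?a / 2 - s)\<^sup>2 * 2" by simp
  hence "?a\<^sup>2 / 2 - s\<^sup>2 \<le> (?a - s)\<^sup>2" by (simp add: power2_diff power_divide)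
  hence 1: "- (?a - s)\<^sup>2 / 2 \<le> - \<bar>y\<bar> / 4 + s\<^sup>2 / 2" using a by linarith
  have "std_normal_density (?a - s) \<le> 1 * exp (- (?a - s)\<^sup>2 / 2)"
    unfolding std_normal_density_def using pi_ge_two by (intro mult_right_mono) (auto simp: real_le_rsqrt)
  also have "\<dots> \<le> exp (- \<bar>y\<bar> / 4) * exp (s\<^sup>2 / 2)"
    using 1 by (simp add: exp_add[symmetric])
  finally have "std_normal_density (?a - s) * norm (char M y) \<le> (exp (- \<bar>y\<bar> / 4) * exp (s\<^sup>2 / 2)) * 1"
    using cmod_char_le_1 by (intro mult_mono) auto
  also have "\<dots> \<le> (32 / (1 + y\<^sup>2)) * exp (s\<^sup>2 / 2)"
    using mult_right_mono[OF exp_neg_abs_le[of y], of "exp (s\<^sup>2 / 2)"] by simp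
  also have "\<dots> \<le> (8 + 32 * exp (s\<^sup>2 / 2)) / (1 + y\<^sup>2)"
    by (simp add: field_simps add_pos_nonneg)
  finally show ?thesis .
qed

lemma integral_exp_neg_half_square: "(LBINT y. exp (- y\<^sup>2 / 2)) = sqrt (2 * pi)"
proof -
  have e: "exp (- y\<^sup>2 / 2) = sqrt (2 * pi) * std_normal_density y" for y :: real
    by (simp add: std_normal_density_def)
  show "(LBINT y. exp (- y\<^sup>2 / 2)) = sqrt (2 * pi)"
    unfolding e by simp
qed

text \<open>The laws of \<open>t n * w\<close> weighted by \<open>t n * exp (- (t n * w)\<^sup>2 / 2)\<close> converge to the standard normal one:
  locally, the law of \<open>t n * w\<close> looks like Lebesgue measure with density \<open>1 / (t n * sqrt (2 \<pi>))\<close>.\<close>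

lemma smoothed_char_tendsto:
  assumes D: "\<And>n. real_distribution (D n)" and tpos: "\<And>n. t n > 0"
    and t: "filterlim t at_top sequentially"
    and c: "\<And>y. (\<lambda>n. char (D n) y) \<longlonglongrightarrow> complex_of_real (exp (- y\<^sup>2 / 2))"
    and b: "\<And>n y. \<bar>y\<bar> \<le> (t n)\<^sup>2 \<Longrightarrow> norm (char (D n) y) \<le> exp (- y\<^sup>2 / 8)"
  shows "(\<lambda>n. t n * (CLINT w|D n. iexp (s * (t n * w)) * exp (- (t n * w)\<^sup>2 / 2))) \<longlonglongrightarrow> complex_of_real (exp (- s\<^sup>2 / 2))"
proof -
  have m[measurable]: "char (D n) \<in> borel_measurable borel" for n
    by (rule real_distribution.char_measurable[OF D])
  \<comment> \<open>As t grows the kernel freezes at its value in s, and only the Gaussian limit of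
    the characteristic functions remains under the integral.\<close>
  have "(\<lambda>n. CLBINT y. std_normal_density (y / t n - s) * char (D n) y)
        \<longlonglongrightarrow> (CLBINT y. std_normal_density s * exp (- y\<^sup>2 / 2))"
  proof (rule integral_dominated_convergence[where w="\<lambda>y. (8 + 32 * exp (s\<^sup>2 / 2)) / (1 + y\<^sup>2)"])
    show "AE y in lborel. (\<lambda>n. std_normal_density (y / t n - s) * char (D n) y)
         \<longlonglongrightarrow> of_real (std_normal_density s * exp (- y\<^sup>2 / 2))"
    proof (rule AE_I2)
      fix y
      have "(\<lambda>n. y / t n) \<longlonglongrightarrow> 0"
        by (rule real_tendsto_divide_at_top[OF tendsto_const t])
      hence "(\<lambda>n. std_normal_density (y / t n - s)) \<longlonglongrightarrow> std_normal_density (0 - s)"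
        unfolding std_normal_density_def by (intro tendsto_intros) auto
      hence "(\<lambda>n. std_normal_density (y / t n - s)) \<longlonglongrightarrow> std_normal_density s"
        by (simp add: std_normal_density_def)
      from tendsto_mult[OF tendsto_of_real[OF this] c[of y]]
      show "(\<lambda>n. std_normal_density (y / t n - s) * char (D n) y)
         \<longlonglongrightarrow> of_real (std_normal_density s * exp (- y\<^sup>2 / 2))" by simp
    qed
    show "AE y in lborel. norm (std_normal_density (y / t n - s) * char (D n) y) \<le> (8 + 32 * exp (s\<^sup>2 / 2)) / (1 + y\<^sup>2)" for n
      using real_distribution.smoothed_char_bound[OF D tpos b, of n]
      by (auto simp: norm_mult normal_density_nonneg)
  qed (auto intro!: integrable_lborel_inverse_square)
  moreover have "(CLBINT y. std_normal_density s * exp (- y\<^sup>2 / 2)) = complex_of_real (LBINT y. std_normal_density s * exp (- y\<^sup>2 / 2))"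
    by (rule integral_complex_of_real)
  moreover have "(LBINT y. std_normal_density s * exp (- y\<^sup>2 / 2)) = exp (- s\<^sup>2 / 2)"
    using integral_exp_neg_half_square by (simp add: std_normal_density_def)
  ultimately have "(\<lambda>n. CLBINT y. std_normal_density (y / t n - s) * char (D n) y)
      \<longlonglongrightarrow> complex_of_real (exp (- s\<^sup>2 / 2))"
    by metis
  thus ?thesis
    using real_distribution.gaussian_smoothing_char[OF D tpos, where s=s and k=0] by simp
qed

text \<open>The centre k enters the Fourier side only as a phase of modulus one, so the bound is
  uniform in k. The constant 40 is 8 + 32 exp 0, the majorant at s = 0.\<close>

lemma (in real_distribution) gaussian_window_bound:
  assumes t: "t > 0" and b: "\<And>y. \<bar>y\<bar> \<le> t\<^sup>2 \<Longrightarrow> norm (char M y) \<le> exp (- y\<^sup>2 / 8)"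
  shows "t * (LINT w|M. exp (- (t * w - k)\<^sup>2 / 2)) \<le> (LBINT y. 40 / (1 + y\<^sup>2))"
proof -
  let ?g = "\<lambda>y. std_normal_density (y / t) * iexp (- (k * (y / t))) * char M y"
  have le: "norm (?g y) \<le> 40 / (1 + y\<^sup>2)" for y
  proof -
    have "norm (?g y) = std_normal_density (y / t - 0) * norm (char M y)"
      by (simp only: norm_mult norm_of_real norm_exp_i_times) (simp add: normal_density_nonneg)
    also have "\<dots> \<le> 40 / (1 + y\<^sup>2)" using smoothed_char_bound[OF t b, of y 0] by simp
    finally show ?thesis .
  qed
  have int: "integrable lborel ?g"
  proof (rule Bochner_Integration.integrable_bound)
    show "AE y in lborel. norm (?g y) \<le> norm (40 / (1 + y\<^sup>2))"
      by (rule AE_I2) (rule order_trans[OF le], simp)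
    show "?g \<in> borel_measurable lborel" by measurable
  qed (rule integrable_lborel_inverse_square)
  have "complex_of_real (t * (LINT w|M. exp (- (t * w - k)\<^sup>2 / 2)))
      = t * (CLINT w|M. exp (- (t * w - k)\<^sup>2 / 2))"
    by (simp only: of_real_mult integral_complex_of_real)
  also have "\<dots> = (CLBINT y. ?g y)"
    using gaussian_smoothing_char[OF t, of 0 k] by simp
  finally have eq: "complex_of_real (t * (LINT w|M. exp (- (t * w - k)\<^sup>2 / 2))) = (CLBINT y. ?g y)" .
  have "t * (LINT w|M. exp (- (t * w - k)\<^sup>2 / 2)) \<le> norm (CLBINT y. ?g y)"
    unfolding eq[symmetric] norm_of_real by (rule abs_ge_self)
  also have "\<dots> \<le> (LBINT y. norm (?g y))" by (rule integral_norm_bound)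
  also have "\<dots> \<le> (LBINT y. 40 / (1 + y\<^sup>2))"
    by (rule integral_mono[OF integrable_norm[OF int] integrable_lborel_inverse_square le])
  finally show ?thesis .
qed

text \<open>Here \<open>{K<..}\<close> is cut into unit intervals, on each of which a Gaussian window bounds the mass.\<close>

lemma (in real_distribution) exp_window_bound:
  assumes t: "t > 0" and b: "\<And>y. \<bar>y\<bar> \<le> t\<^sup>2 \<Longrightarrow> norm (char M y) \<le> exp (- y\<^sup>2 / 8)"
  shows "t * (LINT w|M. exp (- (t * w)) * indicator {K<..} (t * w))
     \<le> 2 * (exp (1 / 2) * (LBINT y. 40 / (1 + y\<^sup>2))) * exp (- K)"
proof -
  define g where "g K = t * (LINT w|M. exp (- (t * w)) * indicator {K<..} (t * w))" for K :: real
  define C where "C = exp (1 / 2) * (LBINT y. 40 / (1 + y\<^sup>2 :: real))"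
  have C0: "C \<ge> 0" unfolding C_def by (intro mult_nonneg_nonneg Bochner_Integration.integral_nonneg) auto
  have int: "integrable M (\<lambda>w. exp (- (t * w)) * indicator {K<..} (t * w))" for K
    by (rule integrable_const_bound[where B="exp (- K)"]) (auto split: split_indicator)
  have int2: "integrable M (\<lambda>w. exp (- (t * w - K)\<^sup>2 / 2))" for K
    by (rule integrable_const_bound[where B=1]) auto
  \<comment> \<open>Crude and growing with t; it only starts the induction below, and its
    contribution disappears as the number m of unit steps tends to infinity.\<close>
  have g0: "g K \<le> t * exp (- K)" for K
  proof -
    have "(LINT w|M. exp (- (t * w)) * indicator {K<..} (t * w)) \<le> (LINT w|M. exp (- K))"
      by (rule integral_mono[OF int]) (auto split: split_indicator)
    thus ?thesis unfolding g_def using t prob_space by simp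
  qed
  \<comment> \<open>On a unit interval exp (-v) is dominated by its left end value times a Gaussian
    window, at the price of exp (1/2) because (v - K)^2 \<le> 1.\<close>
  have step: "g K \<le> C * exp (- K) + g (K + 1)" for K
  proof -
    have *: "exp (- v) * indicator {K<..} v
        \<le> exp (1 / 2) * exp (- K) * exp (- (v - K)\<^sup>2 / 2) + exp (- v) * indicator {K+1<..} v" for v :: real
    proof (cases "K < v \<and> v \<le> K + 1")
      case True
      have "(v - K)\<^sup>2 \<le> 1" using True by (simp add: abs_square_le_1)
      hence "- v \<le> 1 / 2 + - K + - (v - K)\<^sup>2 / 2" using True by linarith
      hence "exp (- v) \<le> exp (1 / 2) * exp (- K) * exp (- (v - K)\<^sup>2 / 2)"
        unfolding exp_add[symmetric] by (subst exp_le_cancel_iff)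
      thus ?thesis using True by (simp add: indicator_def)
    qed (auto simp: indicator_def)
    have "(LINT w|M. exp (- (t * w)) * indicator {K<..} (t * w))
       \<le> (LINT w|M. exp (1 / 2) * exp (- K) * exp (- (t * w - K)\<^sup>2 / 2) + exp (- (t * w)) * indicator {K+1<..} (t * w))"
      by (intro integral_mono int Bochner_Integration.integrable_add integrable_mult_right int2 *)
    also have "\<dots> = exp (1 / 2) * exp (- K) * (LINT w|M. exp (- (t * w - K)\<^sup>2 / 2))
       + (LINT w|M. exp (- (t * w)) * indicator {K+1<..} (t * w))"
      by (simp only: Bochner_Integration.integral_add[OF integrable_mult_right[OF int2] int] integral_mult_right_zero)
    finally have "g K \<le> t * (exp (1 / 2) * exp (- K) * (LINT w|M. exp (- (t * w - K)\<^sup>2 / 2))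
       + (LINT w|M. exp (- (t * w)) * indicator {K+1<..} (t * w)))"
      unfolding g_def using t by (intro mult_left_mono) auto
    also have "\<dots> = exp (1 / 2) * exp (- K) * (t * (LINT w|M. exp (- (t * w - K)\<^sup>2 / 2))) + g (K + 1)"
      by (simp add: g_def algebra_simps)
    also have "\<dots> \<le> exp (1 / 2) * exp (- K) * (LBINT y. 40 / (1 + y\<^sup>2)) + g (K + 1)"
      by (intro add_right_mono mult_left_mono gaussian_window_bound[OF t b]) auto
    finally show ?thesis by (simp add: C_def mult_ac)
  qed
  \<comment> \<open>Geometric summation of the steps: the constant 2 C reproduces itself because 2
    exp (-1) \<le> 1.\<close>
  have "g K \<le> 2 * C * exp (- K) + t * exp (- (K + real m))" for K m
  proof (induction m arbitrary: K)
    case 0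
    show ?case using g0[of K] C0 by (simp add: add_increasing)
  next
    case (Suc m)
    have "2 \<le> exp (1::real)" using exp_ge_add_one_self[of "1::real"] by simp
    hence e: "2 * exp (- (K + 1)) \<le> exp (- K)"
      using mult_right_mono[of 2 "exp (1::real)" "exp (- (K + 1))"] by (simp add: exp_add[symmetric])
    have "g K \<le> C * exp (- K) + (C * (2 * exp (- (K + 1))) + t * exp (- (K + 1 + real m)))"
      using step[of K] Suc[of "K + 1"] by (simp add: algebra_simps)
    also have "\<dots> \<le> C * exp (- K) + (C * exp (- K) + t * exp (- (K + 1 + real m)))"
      by (intro add_mono mult_left_mono e C0 order_refl)
    finally show ?case by (simp add: algebra_simps)
  qed
  note iter = this
  have "g K \<le> 2 * C * exp (- K)" for K
  proof (rule LIMSEQ_le_const)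
    have "(\<lambda>m. exp (- (K + real m))) \<longlonglongrightarrow> 0"
      by (intro filterlim_compose[OF exp_at_bot] filterlim_uminus_at_bot_at_top[THEN filterlim_compose]
         filterlim_tendsto_add_at_top[OF tendsto_const filterlim_real_sequentially])
    from tendsto_add[OF tendsto_const tendsto_mult[OF tendsto_const this], of "2 * C * exp (- K)" t]
    show "(\<lambda>m. 2 * C * exp (- K) + t * exp (- (K + real m))) \<longlonglongrightarrow> 2 * C * exp (- K)" by simp
  qed (use iter in auto)
  thus ?thesis unfolding g_def C_def by simp
qed

text \<open>The factor exp (v^2/2) undoes the Gaussian density, so that exp (-v) is integrated
  against a multiple of Lebesgue measure.\<close>

lemma std_normal_integral_exp_truncated:
  assumes "K > 0"
  shows "(LINT v|std_normal_distribution. (if 0 < v \<and> v \<le> K then exp (v\<^sup>2 / 2 - v) else 0))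
     = (1 - exp (- K)) / sqrt (2 * pi)"
proof -
  have "(LINT v|std_normal_distribution. (if 0 < v \<and> v \<le> K then exp (v\<^sup>2 / 2 - v) else 0))
     = (LBINT v. std_normal_density v * (if 0 < v \<and> v \<le> K then exp (v\<^sup>2 / 2 - v) else 0))"
    by (subst integral_density) (auto simp: normal_density_nonneg)
  also have "\<dots> = (LBINT v. (exp (- v) / sqrt (2 * pi)) * indicator {0..K} v)"
    by (intro integral_cong_AE, measurable) 
      (use AE_lborel_singleton[of "0::real"] in \<open>auto elim!: eventually_mono simp: std_normal_density_def indicator_def exp_add[symmetric] exp_diff exp_minus divide_simps\<close>)
  also have "\<dots> = (- exp (- K) / sqrt (2 * pi)) - (- exp (- 0) / sqrt (2 * pi))"
    by (rule integral_FTC_Icc_real) (use assms in \<open>auto intro!: derivative_eq_intros continuous_intros simp: field_simps\<close>)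
  finally show ?thesis by (simp add: diff_divide_distrib)
qed

text \<open>Dividing the Gaussian-weighted law by its mass gives probability measures to which
  Levy's continuity theorem applies. Expressing exp (-v) through them multiplies the test function
  by exp (v^2/2); the cutoff at K keeps it bounded, and its possible jumps at 0 and K carry no mass
  in the limit.\<close>

lemma one_sided_laplace_truncated_tendsto:
  assumes D: "\<And>n. real_distribution (D n)" and tpos: "\<And>n. t n > 0"
    and t: "filterlim t at_top sequentially"
    and c: "\<And>y. (\<lambda>n. char (D n) y) \<longlonglongrightarrow> complex_of_real (exp (- y\<^sup>2 / 2))"
    and b: "\<And>n y. \<bar>y\<bar> \<le> (t n)\<^sup>2 \<Longrightarrow> norm (char (D n) y) \<le> exp (- y\<^sup>2 / 8)"
    and K: "K > 0"
  shows "(\<lambda>n. t n * (LINT w|D n. exp (- (t n * w)) * indicator {0<..K} (t n * w)))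
     \<longlonglongrightarrow> (1 - exp (- K)) / sqrt (2 * pi)"
proof -
  interpret D: real_distribution "D n" for n by fact
  \<comment> \<open>The mass of the weighted law: the case s = 0 of the Fourier computation, hence
    tending to 1.\<close>
  define m where "m n = t n * (LINT w|D n. exp (- (t n * w)\<^sup>2 / 2))" for n
  define \<rho> where "\<rho> n = distr (density (D n) (\<lambda>w. ennreal (t n * exp (- (t n * w)\<^sup>2 / 2) / m n))) borel (\<lambda>w. t n * w)" for n
  have intg: "integrable (D n) (\<lambda>w. exp (- (t n * w)\<^sup>2 / 2))" for n
    by (rule D.integrable_const_bound[where B=1]) auto
  have mpos: "m n > 0" for n
  proof -
    have "0 < (LINT w|D n. exp (- (t n * w)\<^sup>2 / 2))"
      by (rule D.integral_less_AE_space[of _ "\<lambda>_. 0", simplified]) (use intg D.emeasure_space_1 in auto)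
    thus ?thesis unfolding m_def using tpos by simp
  qed
  have "prob_space (density (D n) (\<lambda>w. ennreal (t n * exp (- (t n * w)\<^sup>2 / 2) / m n)))" for n
  proof (rule prob_spaceI)
    have "(\<integral>\<^sup>+w. ennreal (t n * exp (- (t n * w)\<^sup>2 / 2) / m n) \<partial>D n)
        = ennreal (LINT w|D n. t n * exp (- (t n * w)\<^sup>2 / 2) / m n)"
      using intg mpos[of n] tpos[of n] by (intro nn_integral_eq_integral) auto
    also have "(LINT w|D n. t n * exp (- (t n * w)\<^sup>2 / 2) / m n) = 1"
      using mpos[of n]
      by (simp only: integral_divide_zero integral_mult_right_zero m_def[symmetric]) simp
    finally show "emeasure (density (D n) (\<lambda>w. ennreal (t n * exp (- (t n * w)\<^sup>2 / 2) / m n)))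
        (space (density (D n) (\<lambda>w. ennreal (t n * exp (- (t n * w)\<^sup>2 / 2) / m n)))) = 1"
      by (subst emeasure_density) (auto simp: )
  qed
  hence \<rho>: "real_distribution (\<rho> n)" for n
    unfolding \<rho>_def by (intro prob_space.real_distribution_distr) auto
  have LR: "(LINT v|\<rho> n. f v) = (1 / m n) * (t n * (LINT w|D n. exp (- (t n * w)\<^sup>2 / 2) * f (t n * w)))"
    if [measurable]: "f \<in> borel_measurable borel" for f :: "real \<Rightarrow> real" and n
    unfolding \<rho>_def using mpos[of n] tpos[of n]
    by (subst integral_distr, simp, simp, subst integral_density) (auto simp: less_imp_le mult.assoc simp flip: integral_mult_right_zero)
  have LC: "(CLINT v|\<rho> n. f v) = (1 / m n) * (t n * (CLINT w|D n. exp (- (t n * w)\<^sup>2 / 2) * f (t n * w)))"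
    if [measurable]: "f \<in> borel_measurable borel" for f :: "real \<Rightarrow> complex" and n
    unfolding \<rho>_def using mpos[of n] tpos[of n]
    by (subst integral_distr, simp, simp, subst integral_density)
       (auto simp: less_imp_le scaleR_conv_of_real simp flip: integral_mult_right_zero intro!: Bochner_Integration.integral_cong)
  note sm = smoothed_char_tendsto[OF D tpos t c b]
  have m1: "m \<longlonglongrightarrow> 1"
  proof -
    have "(\<lambda>n. complex_of_real (m n)) \<longlonglongrightarrow> complex_of_real 1"
      using sm[of 0] unfolding m_def of_real_mult integral_complex_of_real[symmetric] by simp
    thus ?thesis by (simp only: tendsto_of_real_iff)
  qed
  have "weak_conv_m \<rho> std_normal_distribution"
  proof (rule levy_continuity[OF \<rho> real_dist_normal_dist])
    fix s
    have "(\<lambda>n. complex_of_real (1 / m n) * (t n * (CLINT w|D n. iexp (s * (t n * w)) * exp (- (t n * w)\<^sup>2 / 2))))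
       \<longlonglongrightarrow> complex_of_real (1 / 1) * complex_of_real (exp (- s\<^sup>2 / 2))"
      by (intro tendsto_mult[OF tendsto_of_real sm] tendsto_divide tendsto_const m1) auto
    thus "(\<lambda>n. char (\<rho> n) s) \<longlonglongrightarrow> char std_normal_distribution s"
      unfolding char_std_normal_distribution char_def by (subst LC) (auto simp: mult_ac)
  qed
  define f where "f v = (if 0 < v \<and> v \<le> K then exp (v\<^sup>2 / 2 - v) else 0)" for v :: real
  have fm[measurable]: "f \<in> borel_measurable borel" unfolding f_def by measurable
  interpret S: real_distribution std_normal_distribution by (rule real_dist_normal_dist)
  have "(\<lambda>n. LINT v|\<rho> n. f v) \<longlonglongrightarrow> (LINT v|std_normal_distribution. f v)"
  proof (rule weak_conv_imp_bdd_ae_continuous_conv)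
    have "isCont f x" if "x \<noteq> 0" "x \<noteq> K" for x
    proof -
      consider "x < 0" | "0 < x" "x < K" | "x > K" using \<open>x \<noteq> 0\<close> \<open>x \<noteq> K\<close> by linarith
      thus ?thesis
      proof cases
        case 1
        hence "\<forall>\<^sub>F y in nhds x. f y = 0"
          using eventually_nhds_in_open[of "{..<0}" x] by (auto elim!: eventually_mono simp: f_def)
        thus ?thesis by (subst isCont_cong) auto
      next
        case 2
        hence "\<forall>\<^sub>F y in nhds x. f y = exp (y\<^sup>2 / 2 - y)"
          using eventually_nhds_in_open[of "{0<..<K}" x] by (auto elim!: eventually_mono simp: f_def)
        thus ?thesis by (subst isCont_cong) auto
      next
        case 3
        hence "\<forall>\<^sub>F y in nhds x. f y = 0"
          using eventually_nhds_in_open[of "{K<..}" x] by (auto elim!: eventually_mono simp: f_def)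
        thus ?thesis by (subst isCont_cong) auto
      qed
    qed
    hence "{x. \<not> isCont f x} \<subseteq> {0, K}" by auto
    moreover have "emeasure std_normal_distribution {0, K} = 0"
      by (subst emeasure_density)
         (auto intro!: nn_integral_null_set finite_imp_null_set_lborel simp flip: null_setsD1)
    ultimately show "emeasure std_normal_distribution {x. \<not> isCont f x} = 0"
      by (metis emeasure_mono le_zero_eq S.events_eq_borel borel_closed closed_insert closed_empty)
    show "norm (f x) \<le> exp (K\<^sup>2 / 2)" for x
    proof (cases "0 < x \<and> x \<le> K")
      case True
      hence "x\<^sup>2 \<le> K\<^sup>2" by (intro power_mono) auto
      hence le: "x\<^sup>2 / 2 - x \<le> K\<^sup>2 / 2" using True by linarith
      have "norm (f x) = exp (x\<^sup>2 / 2 - x)" using True by (simp add: f_def)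
      also have "\<dots> \<le> exp (K\<^sup>2 / 2)" using le by (subst exp_le_cancel_iff)
      finally show ?thesis .
    qed (auto simp: f_def)
  qed (use \<rho> S.real_distribution_axioms \<open>weak_conv_m \<rho> _\<close> fm in auto)
  hence "(\<lambda>n. LINT v|\<rho> n. f v) \<longlonglongrightarrow> (1 - exp (- K)) / sqrt (2 * pi)"
    using std_normal_integral_exp_truncated[OF K] by (simp add: f_def)
  from tendsto_mult[OF m1 this]
  have "(\<lambda>n. m n * (LINT v|\<rho> n. f v)) \<longlonglongrightarrow> (1 - exp (- K)) / sqrt (2 * pi)" by simp
  moreover have "m n * (LINT v|\<rho> n. f v) = t n * (LINT w|D n. exp (- (t n * w)) * indicator {0<..K} (t n * w))" for n
  proof -
    have "m n * (LINT v|\<rho> n. f v) = t n * (LINT w|D n. exp (- (t n * w)\<^sup>2 / 2) * f (t n * w))"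
      using mpos[of n] by (subst LR) auto
    also have "(\<lambda>w. exp (- (t n * w)\<^sup>2 / 2) * f (t n * w)) = (\<lambda>w. exp (- (t n * w)) * indicator {0<..K} (t n * w))"
      by (rule ext) (auto simp: f_def indicator_def exp_add[symmetric])
    finally show ?thesis .
  qed
  ultimately show ?thesis by simp
qed

text \<open>The unit-interval bound makes the part beyond K at most a constant times exp (-K),
  uniformly in n. So n may tend to infinity before K does.\<close>

lemma one_sided_laplace_tendsto:
  assumes D: "\<And>n. real_distribution (D n)" and tpos: "\<And>n. t n > 0"
    and t: "filterlim t at_top sequentially"
    and c: "\<And>y. (\<lambda>n. char (D n) y) \<longlonglongrightarrow> complex_of_real (exp (- y\<^sup>2 / 2))"
    and b: "\<And>n y. \<bar>y\<bar> \<le> (t n)\<^sup>2 \<Longrightarrow> norm (char (D n) y) \<le> exp (- y\<^sup>2 / 8)"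
  shows "(\<lambda>n. t n * (LINT w|D n. exp (- (t n * w)) * indicator {0<..} w)) \<longlonglongrightarrow> 1 / sqrt (2 * pi)"
proof (rule LIMSEQ_I)
  interpret D: real_distribution "D n" for n by fact
  define a where "a n = t n * (LINT w|D n. exp (- (t n * w)) * indicator {0<..} w)" for n
  \<comment> \<open>The summand 1 makes C exceed 1 / sqrt (2 * pi), so that one constant bounds both
    the part beyond K and the deficit exp (-K) / sqrt (2 * pi) of the truncated limit.\<close>
  define C where "C = 2 * (exp (1 / 2) * (LBINT y. 40 / (1 + y\<^sup>2 :: real))) + 1"
  have C0: "C > 0" unfolding C_def
    by (intro add_nonneg_pos mult_nonneg_nonneg Bochner_Integration.integral_nonneg) auto
  fix r :: real assume r: "r > 0"
  have "((\<lambda>K. C * exp (- K)) \<longlongrightarrow> C * 0) at_top"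
    by (intro tendsto_mult tendsto_const filterlim_compose[OF exp_at_bot] filterlim_uminus_at_bot_at_top)
  hence "\<forall>\<^sub>F K in at_top. C * exp (- K) < r / 2"
    using r by (intro order_tendstoD) auto
  then obtain K where K: "K > 0" "C * exp (- K) < r / 2"
    using eventually_conj[OF eventually_gt_at_top[of 0]] by (metis (no_types, lifting) eventually_happens trivial_limit_at_top_linorder)
  define bn where "bn n = t n * (LINT w|D n. exp (- (t n * w)) * indicator {0<..K} (t n * w))" for n
  define g where "g n = t n * (LINT w|D n. exp (- (t n * w)) * indicator {K<..} (t n * w))" for n
  have split: "a n = bn n + g n" for n
  proof -
    have pos: "x > 0" if "K < t n * x" for x
      using that K(1) tpos[of n] by (metis less_trans zero_less_mult_pos)
    have "(LINT w|D n. exp (- (t n * w)) * indicator {0<..} w) =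
        (LINT w|D n. exp (- (t n * w)) * indicator {0<..K} (t n * w) + exp (- (t n * w)) * indicator {K<..} (t n * w))"
      by (intro Bochner_Integration.integral_cong refl)
         (use tpos[of n] K pos in \<open>auto simp: indicator_def zero_less_mult_iff\<close>)
    also have "\<dots> = (LINT w|D n. exp (- (t n * w)) * indicator {0<..K} (t n * w))
       + (LINT w|D n. exp (- (t n * w)) * indicator {K<..} (t n * w))"
      by (intro Bochner_Integration.integral_add D.integrable_const_bound[where B=1])
         (use K in \<open>auto split: split_indicator\<close>)
    finally show ?thesis unfolding a_def bn_def g_def by (simp add: distrib_left)
  qed
  have g: "0 \<le> g n" "g n \<le> C * exp (- K)" for n
  proof -
    show "0 \<le> g n" unfolding g_def using tpos[of n]
      by (intro mult_nonneg_nonneg Bochner_Integration.integral_nonneg) auto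
    have "g n \<le> 2 * (exp (1 / 2) * (LBINT y. 40 / (1 + y\<^sup>2 :: real))) * exp (- K)"
      unfolding g_def by (rule D.exp_window_bound[OF tpos b])
    also have "\<dots> \<le> C * exp (- K)" unfolding C_def by (intro mult_right_mono) auto
    finally show "g n \<le> C * exp (- K)" .
  qed
  have "bn \<longlonglongrightarrow> (1 - exp (- K)) / sqrt (2 * pi)"
    unfolding bn_def by (rule one_sided_laplace_truncated_tendsto[OF D tpos t c b K(1)])
  from LIMSEQ_D[OF this, of "r / 2 - C * exp (- K)"] K(2)
  obtain N where N: "\<And>n. n \<ge> N \<Longrightarrow> \<bar>bn n - (1 - exp (- K)) / sqrt (2 * pi)\<bar> < r / 2 - C * exp (- K)"
    by auto
  have e: "0 \<le> exp (- K) / sqrt (2 * pi)" "exp (- K) / sqrt (2 * pi) \<le> C * exp (- K)"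
  proof -
    have "1 / sqrt (2 * pi) \<le> 1" using pi_ge_two by (simp add: real_le_rsqrt)
    also have "1 \<le> C" unfolding C_def
      by (intro add_increasing mult_nonneg_nonneg Bochner_Integration.integral_nonneg) auto
    finally have "1 / sqrt (2 * pi) * exp (- K) \<le> C * exp (- K)" by (intro mult_right_mono) auto
    thus "exp (- K) / sqrt (2 * pi) \<le> C * exp (- K)" by simp
  qed simp
  show "\<exists>no. \<forall>n\<ge>no. norm (t n * (LINT w|D n. exp (- (t n * w)) * indicator {0<..} w) - 1 / sqrt (2 * pi)) < r"
  proof (intro exI[of _ N] allI impI)
    fix n assume "n \<ge> N"
    hence "\<bar>bn n - (1 / sqrt (2 * pi) - exp (- K) / sqrt (2 * pi))\<bar> < r / 2 - C * exp (- K)"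
      using N by (simp add: diff_divide_distrib)
    hence "\<bar>a n - 1 / sqrt (2 * pi)\<bar> < r" using g[of n] e K(2) split[of n] by linarith
    thus "norm (t n * (LINT w|D n. exp (- (t n * w)) * indicator {0<..} w) - 1 / sqrt (2 * pi)) < r"
      by (simp add: a_def)
  qed
qed

subsection \<open>Triangular arrays\<close>

text \<open>Neither mean zero nor unit variance is imposed, because the tilted laws are standardised
  only in the limit.\<close>

lemma (in real_distribution) char_second_order:
  assumes i: "integrable M (\<lambda>x. x)" "integrable M (\<lambda>x. x\<^sup>2)" "integrable M (\<lambda>x. \<bar>x\<bar> ^ 3)"
  shows "norm (char M u - complex_of_real (1 - u\<^sup>2 * expectation (\<lambda>x. x\<^sup>2) / 2) - \<i> * (u * expectation (\<lambda>x. x)))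
     \<le> \<bar>u\<bar> ^ 3 / 6 * expectation (\<lambda>x. \<bar>x\<bar> ^ 3)"
proof -
  have "norm (char M u - (\<Sum>k \<le> 2. ((\<i> * u)^k / fact k) * expectation (\<lambda>x. x^k))) \<le>
    (\<bar>u\<bar>^2 / fact (Suc 2)) * expectation (\<lambda>x. min (2 * \<bar>x\<bar>^2 * Suc 2) (\<bar>u\<bar> * \<bar>x\<bar>^Suc 2))"
  proof (rule char_approx2)
    fix k :: nat assume "k \<le> 2"
    then consider "k = 0" | "k = 1" | "k = 2" by linarith
    thus "integrable M (\<lambda>x. x ^ k)" using i by cases auto
  qed
  also have "\<dots> \<le> (\<bar>u\<bar>^2 / fact (Suc 2)) * expectation (\<lambda>x. \<bar>u\<bar> * \<bar>x\<bar>^3)"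
  proof (intro mult_left_mono integral_mono)
    show "integrable M (\<lambda>x. min (2 * \<bar>x\<bar>^2 * Suc 2) (\<bar>u\<bar> * \<bar>x\<bar>^Suc 2))"
      by (rule Bochner_Integration.integrable_bound[OF integrable_mult_right[OF i(3), of "\<bar>u\<bar>"]])
         (auto simp: eval_nat_numeral)
  qed (use i in \<open>auto simp: eval_nat_numeral\<close>)
  also have "\<dots> = \<bar>u\<bar> ^ 3 / 6 * expectation (\<lambda>x. \<bar>x\<bar> ^ 3)"
    by (simp add: eval_nat_numeral)
  also have "(\<Sum>k \<le> 2. ((\<i> * u)^k / fact k) * expectation (\<lambda>x. x^k))
     = complex_of_real (1 - u\<^sup>2 * expectation (\<lambda>x. x\<^sup>2) / 2) + \<i> * (u * expectation (\<lambda>x. x))"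
  proof -
    have sum3: "(\<Sum>k \<le> 2. f k) = f 0 + f 1 + f 2" for f :: "nat \<Rightarrow> complex"
      by (simp add: eval_nat_numeral)
    have "(\<i> * complex_of_real u)\<^sup>2 = - complex_of_real (u\<^sup>2)" by (simp add: power_mult_distrib)
    thus ?thesis unfolding sum3 using prob_space by simp
  qed
  finally show ?thesis by (simp add: algebra_simps)
qed

text \<open>A central limit theorem for rows that are only approximately standardised. In the unit
  disc n-th powers differ by at most n times the difference of the bases, so the mean is magnified
  by sqrt n, the defect of the second moment by 1, and the third moments contribute C / sqrt
  n.\<close>

lemma char_power_tendsto:
  assumes R: "\<And>n. real_distribution (R n)"
    and i: "\<And>n. integrable (R n) (\<lambda>x. x)" "\<And>n. integrable (R n) (\<lambda>x. x\<^sup>2)" "\<And>n. integrable (R n) (\<lambda>x. \<bar>x\<bar> ^ 3)"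
    and C: "\<And>n. (LINT x|R n. \<bar>x\<bar> ^ 3) \<le> C"
    and a: "(\<lambda>n. sqrt (real n) * (LINT x|R n. x)) \<longlonglongrightarrow> 0"
    and b: "(\<lambda>n. LINT x|R n. x\<^sup>2) \<longlonglongrightarrow> 1"
  shows "(\<lambda>n. char (R n) (s / sqrt (real n)) ^ n) \<longlonglongrightarrow> complex_of_real (exp (- s\<^sup>2 / 2))"
proof -
  define w where "w n = complex_of_real (1 + (- s\<^sup>2 / 2) / real n)" for n :: nat
  define A where "A n = (LINT x|R n. x)" for n
  define B where "B n = (LINT x|R n. x\<^sup>2)" for n
  have "\<forall>\<^sub>F n in sequentially. norm (char (R n) (s / sqrt (real n)) ^ n - w n ^ n)
     \<le> \<bar>s\<bar> * \<bar>sqrt (real n) * A n\<bar> + s\<^sup>2 / 2 * \<bar>1 - B n\<bar> + \<bar>s\<bar> ^ 3 * (1 / sqrt (real n)) / 6 * C"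
    \<comment> \<open>The bound s^2 \<le> n puts the comparison point 1 - s^2 / (2 n) into the unit
      disc, as \<open>norm_power_diff\<close> requires.\<close>
    using eventually_ge_at_top[of "nat \<lceil>s\<^sup>2\<rceil> + 1"]
  proof eventually_elim
    case (elim n)
    interpret real_distribution "R n" by (rule R)
    have n: "real n > 0" "s\<^sup>2 \<le> real n" using elim by linarith+
    define u where "u = s / sqrt (real n)"
    have u2: "u\<^sup>2 = s\<^sup>2 / real n" using n by (simp add: u_def power_divide)
    have u3: "real n * \<bar>u\<bar> ^ 3 = \<bar>s\<bar> ^ 3 * (1 / sqrt (real n))"
    proof -
      have "real n * \<bar>u\<bar> ^ 3 = \<bar>s\<bar> ^ 3 * (real n / sqrt (real n) ^ 3)"
        using n by (simp add: u_def power_divide)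
      also have "sqrt (real n) ^ 3 = real n * sqrt (real n)"
        using n by (simp add: power3_eq_cube)
      finally show ?thesis using n by simp
    qed
    have nu: "real n * \<bar>u\<bar> = \<bar>s\<bar> * sqrt (real n)"
      using n by (simp add: u_def abs_mult real_div_sqrt field_simps)
    have w1: "norm (w n) \<le> 1" unfolding w_def norm_of_real using n
      by (intro abs_leI) (auto simp: field_simps)
    have "norm (char (R n) u ^ n - w n ^ n) \<le> real n * norm (char (R n) u - w n)"
      by (intro norm_power_diff cmod_char_le_1 w1)
    also have "norm (char (R n) u - w n) \<le> \<bar>u\<bar> ^ 3 / 6 * C + \<bar>u\<bar> * \<bar>A n\<bar> + u\<^sup>2 / 2 * \<bar>1 - B n\<bar>"
    proof -
      have "char (R n) u - w n = (char (R n) u - complex_of_real (1 - u\<^sup>2 * B n / 2) - \<i> * (u * A n))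
          + \<i> * (u * A n) + complex_of_real (u\<^sup>2 / 2 * (1 - B n))"
      proof -
        have "w n = complex_of_real (1 - u\<^sup>2 / 2)" unfolding w_def u2 by simp
        thus ?thesis by (simp add: algebra_simps diff_divide_distrib)
      qed
      also have "norm \<dots> \<le> norm (char (R n) u - complex_of_real (1 - u\<^sup>2 * B n / 2) - \<i> * (u * A n))
          + norm (\<i> * (u * A n)) + norm (complex_of_real (u\<^sup>2 / 2 * (1 - B n)))"
        by (intro order_trans[OF norm_triangle_ineq] add_mono order_refl norm_triangle_ineq)
      also have "norm (\<i> * (u * A n)) = \<bar>u\<bar> * \<bar>A n\<bar>" by (simp add: norm_mult)
      also have "norm (complex_of_real (u\<^sup>2 / 2 * (1 - B n))) = u\<^sup>2 / 2 * \<bar>1 - B n\<bar>"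
        unfolding norm_of_real abs_mult by simp
      also have "norm (char (R n) u - complex_of_real (1 - u\<^sup>2 * B n / 2) - \<i> * (u * A n)) \<le> \<bar>u\<bar> ^ 3 / 6 * C"
        using char_second_order[OF i, of u] mult_left_mono[OF C[of n], of "\<bar>u\<bar> ^ 3 / 6"]
        unfolding A_def B_def by simp
      finally show ?thesis by simp
    qed
    also have "real n * (\<bar>u\<bar> ^ 3 / 6 * C + \<bar>u\<bar> * \<bar>A n\<bar> + u\<^sup>2 / 2 * \<bar>1 - B n\<bar>)
        = (real n * \<bar>u\<bar> ^ 3) / 6 * C + (real n * \<bar>u\<bar>) * \<bar>A n\<bar> + (real n * u\<^sup>2) / 2 * \<bar>1 - B n\<bar>"
      by (simp add: algebra_simps)
    also have "\<dots> = \<bar>s\<bar> * \<bar>sqrt (real n) * A n\<bar> + s\<^sup>2 / 2 * \<bar>1 - B n\<bar> + \<bar>s\<bar> ^ 3 * (1 / sqrt (real n)) / 6 * C"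
      unfolding u3 nu using n by (simp add: u2 abs_mult)
    finally show ?case using n by (simp add: u_def mult_left_mono)
  qed
  note ev = this
  have lim: "(\<lambda>n. \<bar>s\<bar> * \<bar>sqrt (real n) * A n\<bar> + s\<^sup>2 / 2 * \<bar>1 - B n\<bar> + \<bar>s\<bar> ^ 3 * (1 / sqrt (real n)) / 6 * C)
     \<longlonglongrightarrow> \<bar>s\<bar> * \<bar>0\<bar> + s\<^sup>2 / 2 * \<bar>1 - 1\<bar> + \<bar>s\<bar> ^ 3 * 0 / 6 * C"
  proof (intro tendsto_add tendsto_mult tendsto_divide tendsto_const tendsto_rabs tendsto_diff)
    show "(\<lambda>n. sqrt (real n) * A n) \<longlonglongrightarrow> 0" using a by (simp only: A_def)
    show "B \<longlonglongrightarrow> 1" using b unfolding B_def .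
    show "(\<lambda>n. 1 / sqrt (real n)) \<longlonglongrightarrow> 0"
      by (rule real_tendsto_divide_at_top[OF tendsto_const filterlim_compose[OF sqrt_at_top filterlim_real_sequentially]])
  qed simp_all
  have 1: "(\<lambda>n. char (R n) (s / sqrt (real n)) ^ n - w n ^ n) \<longlonglongrightarrow> 0"
    by (rule Lim_null_comparison[OF ev tendsto_eq_rhs[OF lim]]) simp
  have "(\<lambda>n. complex_of_real ((1 + (- s\<^sup>2 / 2) / real n) ^ n)) \<longlonglongrightarrow> complex_of_real (exp (- s\<^sup>2 / 2))"
    by (intro tendsto_of_real tendsto_exp_limit_sequentially)
  hence "(\<lambda>n. w n ^ n) \<longlonglongrightarrow> complex_of_real (exp (- s\<^sup>2 / 2))" by (simp add: w_def)
  from tendsto_add[OF 1 this] show ?thesis by simp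
qed

text \<open>With mean A and second moment B, the quadratic polynomial has squared modulus at most 1
  - u^2/2 and so modulus at most 1 - u^2/4: B \<ge> 3/4 outweighs A^2 and u^2 B^2/4, each at most
  1/16. The cubic remainder returns at most u^2/8 because C |u| \<le> 3/4, which leaves 1 -
  u^2/8.\<close>

lemma (in real_distribution) char_bound_near_zero:
  assumes i: "integrable M (\<lambda>x. x)" "integrable M (\<lambda>x. x\<^sup>2)" "integrable M (\<lambda>x. \<bar>x\<bar> ^ 3)"
    and C: "expectation (\<lambda>x. \<bar>x\<bar> ^ 3) \<le> C"
    and a: "(expectation (\<lambda>x. x))\<^sup>2 \<le> 1 / 16"
    and b: "\<bar>expectation (\<lambda>x. x\<^sup>2) - 1\<bar> \<le> 1 / 4"
    and u: "\<bar>u\<bar> \<le> 1 / 4" "C * \<bar>u\<bar> \<le> 3 / 4"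
  shows "norm (char M u) \<le> exp (- u\<^sup>2 / 8)"
proof -
  define A where "A = expectation (\<lambda>x. x)"
  define B where "B = expectation (\<lambda>x. x\<^sup>2)"
  have u2: "u\<^sup>2 \<le> 1 / 16" using power_mono[OF u(1), of 2] by (simp add: power_divide)
  have B: "3 / 4 \<le> B" "B \<le> 5 / 4" using b unfolding B_def by linarith+
  have sq: "(1 - u\<^sup>2 * B / 2)\<^sup>2 + (u * A)\<^sup>2 \<le> (1 - u\<^sup>2 / 4)\<^sup>2"
  proof -
    have "B\<^sup>2 \<le> (5 / 4)\<^sup>2" using B by (intro power_mono) auto
    hence "u\<^sup>2 * B\<^sup>2 / 4 \<le> (1 / 16) * (5 / 4)\<^sup>2 / 4"
      using u2 by (intro divide_right_mono mult_mono) auto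
    also have "\<dots> \<le> 1 / 16" by (simp add: power2_eq_square)
    finally have "- B + u\<^sup>2 * B\<^sup>2 / 4 + A\<^sup>2 \<le> - (1 / 2)"
      using B a[folded A_def] by linarith
    hence "u\<^sup>2 * (- B + u\<^sup>2 * B\<^sup>2 / 4 + A\<^sup>2) \<le> u\<^sup>2 * - (1 / 2)" by (intro mult_left_mono) auto
    moreover have "(1 - u\<^sup>2 * B / 2)\<^sup>2 + (u * A)\<^sup>2 = 1 + u\<^sup>2 * (- B + u\<^sup>2 * B\<^sup>2 / 4 + A\<^sup>2)"
      by (simp add: power2_eq_square algebra_simps)
    moreover have "(1 - u\<^sup>2 / 4)\<^sup>2 = 1 + u\<^sup>2 * - (1 / 2) + (u\<^sup>2 / 4)\<^sup>2"
      by (simp add: power2_eq_square algebra_simps)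
    ultimately show ?thesis by (smt (verit) zero_le_power2)
  qed
  let ?z = "complex_of_real (1 - u\<^sup>2 * B / 2) + \<i> * (u * A)"
  have "norm ?z = sqrt ((1 - u\<^sup>2 * B / 2)\<^sup>2 + (u * A)\<^sup>2)"
    by (simp add: cmod_def)
  also have "\<dots> \<le> 1 - u\<^sup>2 / 4" using sq u2 by (intro real_le_lsqrt) auto
  finally have 1: "norm ?z \<le> 1 - u\<^sup>2 / 4" .
  have 2: "norm (char M u - ?z) \<le> \<bar>u\<bar> ^ 3 / 6 * C"
    using char_second_order[OF i, of u] mult_left_mono[OF C, of "\<bar>u\<bar> ^ 3 / 6"]
    unfolding A_def B_def by (simp add: algebra_simps)
  have "\<bar>u\<bar> ^ 3 / 6 * C = u\<^sup>2 / 6 * (C * \<bar>u\<bar>)"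
    by (simp add: power3_eq_cube power2_eq_square)
  also have "\<dots> \<le> u\<^sup>2 / 6 * (3 / 4)" by (intro mult_left_mono u(2)) auto
  finally have 3: "\<bar>u\<bar> ^ 3 / 6 * C \<le> u\<^sup>2 / 8" by simp
  have "norm (char M u) \<le> norm (char M u - ?z) + norm ?z"
    using norm_triangle_ineq[of "char M u - ?z" ?z] by simp
  also have "\<dots> \<le> 1 + (- u\<^sup>2 / 8)" using 1 2 3 by linarith
  also have "\<dots> \<le> exp (- u\<^sup>2 / 8)" by (rule exp_ge_add_one_self)
  finally show ?thesis .
qed

text \<open>Here t^2 = o(sqrt n) is spent: for |y| \<le> t^2 the argument y / sqrt n eventually lies
  within the fixed radius where the bound near zero holds, and the n-th power of that bound is free
  of n.\<close>

lemma triangular_array_one_sided_laplace_tendsto: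
  assumes R: "\<And>n. real_distribution (R n)"
    and i: "\<And>n. integrable (R n) (\<lambda>x. x)" "\<And>n. integrable (R n) (\<lambda>x. x\<^sup>2)" "\<And>n. integrable (R n) (\<lambda>x. \<bar>x\<bar> ^ 3)"
    and C: "\<And>n. (LINT x|R n. \<bar>x\<bar> ^ 3) \<le> C"
    and a: "(\<lambda>n. sqrt (real n) * (LINT x|R n. x)) \<longlonglongrightarrow> 0"
    and b: "(\<lambda>n. LINT x|R n. x\<^sup>2) \<longlonglongrightarrow> 1"
    and D: "\<And>n. real_distribution (D n)"
    and DR: "\<And>n y. n > 0 \<Longrightarrow> char (D n) y = char (R n) (y / sqrt (real n)) ^ n"
    and t: "filterlim t at_top sequentially"
    and t2: "(\<lambda>n. (t n)\<^sup>2 / sqrt (real n)) \<longlonglongrightarrow> 0"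
  shows "(\<lambda>n. t n * (LINT w|D n. exp (- (t n * w)) * indicator {0<..} w)) \<longlonglongrightarrow> 1 / sqrt (2 * pi)"
proof -
  have C0: "C \<ge> 0"
    by (rule order_trans[OF _ C]) (intro Bochner_Integration.integral_nonneg, auto)
  define u0 where "u0 = min (1 / 4) (3 / 4 / (C + 1))"
  have u0: "u0 > 0" "\<And>u. \<bar>u\<bar> \<le> u0 \<Longrightarrow> \<bar>u\<bar> \<le> 1 / 4" "\<And>u. \<bar>u\<bar> \<le> u0 \<Longrightarrow> C * \<bar>u\<bar> \<le> 3 / 4"
  proof -
    show "u0 > 0" unfolding u0_def using C0 by auto
    fix u assume u: "\<bar>u\<bar> \<le> u0"
    thus "\<bar>u\<bar> \<le> 1 / 4" unfolding u0_def by auto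
    have "(C + 1) * \<bar>u\<bar> \<le> 3 / 4" using u C0 unfolding u0_def by (simp add: field_simps)
    thus "C * \<bar>u\<bar> \<le> 3 / 4" by (simp add: algebra_simps) 
  qed
  have a0: "(\<lambda>n. LINT x|R n. x) \<longlonglongrightarrow> 0"
  proof -
    have "(\<lambda>n. (sqrt (real n) * (LINT x|R n. x)) / sqrt (real n)) \<longlonglongrightarrow> 0"
      by (rule real_tendsto_divide_at_top[OF a filterlim_compose[OF sqrt_at_top filterlim_real_sequentially]])
    moreover have "\<forall>\<^sub>F n in sequentially. (sqrt (real n) * (LINT x|R n. x)) / sqrt (real n) = (LINT x|R n. x)"
      using eventually_gt_at_top[of 0] by eventually_elim simp
    ultimately show ?thesis by (rule Lim_transform_eventually)
  qed
  have l: "(\<lambda>n. (LINT x|R n. x)\<^sup>2) \<longlonglongrightarrow> 0\<^sup>2" "(\<lambda>n. \<bar>(LINT x|R n. x\<^sup>2) - 1\<bar>) \<longlonglongrightarrow> \<bar>1 - 1\<bar>"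
    by (intro tendsto_intros a0 b)+
  have e1: "\<forall>\<^sub>F n in sequentially. (LINT x|R n. x)\<^sup>2 < 1 / 16"
    by (rule order_tendstoD(2)[OF l(1)]) simp
  have e2: "\<forall>\<^sub>F n in sequentially. \<bar>(LINT x|R n. x\<^sup>2) - 1\<bar> < 1 / 4"
    by (rule order_tendstoD(2)[OF l(2)]) simp
  have e3: "\<forall>\<^sub>F n in sequentially. (t n)\<^sup>2 / sqrt (real n) < u0"
    by (rule order_tendstoD(2)[OF t2 u0(1)])
  have "\<forall>\<^sub>F n in sequentially. t n > 0 \<and> n > 0 \<and> (\<forall>y. \<bar>y\<bar> \<le> (t n)\<^sup>2 \<longrightarrow> norm (char (D n) y) \<le> exp (- y\<^sup>2 / 8))"
    using e1 e2 e3 filterlim_at_top_dense[THEN iffD1, OF t, rule_format, of 0] eventually_gt_at_top[of 0]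
  proof eventually_elim
    case (elim n)
    interpret real_distribution "R n" by (rule R)
    have "norm (char (D n) y) \<le> exp (- y\<^sup>2 / 8)" if "\<bar>y\<bar> \<le> (t n)\<^sup>2" for y
    proof -
      have "\<bar>y / sqrt (real n)\<bar> \<le> u0"
        using divide_right_mono[OF that, of "sqrt (real n)"] elim by simp
      from u0(2,3)[OF this] have "norm (char (R n) (y / sqrt (real n))) \<le> exp (- (y / sqrt (real n))\<^sup>2 / 8)"
        using elim by (intro char_bound_near_zero[OF i C]) auto
      hence "norm (char (D n) y) \<le> exp (- (y / sqrt (real n))\<^sup>2 / 8) ^ n"
        using elim DR by (simp add: norm_power power_mono)
      also have "\<dots> = exp (- y\<^sup>2 / 8)" using elim
        by (simp add: exp_of_nat_mult[symmetric] power_divide)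
      finally show ?thesis .
    qed
    thus ?case using elim by auto
  qed
  then obtain N where N: "\<forall>n\<ge>N. t n > 0 \<and> n > 0 \<and> (\<forall>y. \<bar>y\<bar> \<le> (t n)\<^sup>2 \<longrightarrow> norm (char (D n) y) \<le> exp (- y\<^sup>2 / 8))"
    unfolding eventually_sequentially ..
  have "(\<lambda>n. char (D n) y) \<longlonglongrightarrow> complex_of_real (exp (- y\<^sup>2 / 2))" for y
    by (rule Lim_transform_eventually[OF char_power_tendsto[OF R i C a b, of y]])
       (use eventually_gt_at_top[of 0] in eventually_elim, simp add: DR)
  \<comment> \<open>The limit lemma asks for its bounds at every index, while they hold from N on;
    all sequences are therefore shifted by N.\<close>
  note c = LIMSEQ_ignore_initial_segment[OF this, where k=N]
  have tN: "filterlim (\<lambda>n. t (n + N)) at_top sequentially"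
    using filterlim_compose[OF t filterlim_add_const_nat_at_top[of N]] .
  have "(\<lambda>n. t (n + N) * (LINT w|D (n + N). exp (- (t (n + N) * w)) * indicator {0<..} w)) \<longlonglongrightarrow> 1 / sqrt (2 * pi)"
  proof (rule one_sided_laplace_tendsto[where D="\<lambda>n. D (n + N)" and t="\<lambda>n. t (n + N)", OF D _ tN c])
    show "t (n + N) > 0" for n using N by simp
    show "norm (char (D (n + N)) y) \<le> exp (- y\<^sup>2 / 8)" if "\<bar>y\<bar> \<le> (t (n + N))\<^sup>2" for n y
      using N that by simp
  qed
  thus ?thesis
    by (rule LIMSEQ_offset[where f="\<lambda>n. t n * (LINT w|D n. exp (- (t n * w)) * indicator {0<..} w)"])
qed

subsection \<open>Exponential tilting of a truncated law\<close>

text \<open>A product measure is determined by its values on boxes, and there the indicator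
  factorises along with the density.\<close>

lemma PiM_density:
  fixes f :: "'a \<Rightarrow> ennreal"
  assumes M: "sigma_finite_measure M" "sigma_finite_measure (density M f)"
    and f[measurable]: "f \<in> borel_measurable M" and I: "finite I"
  shows "PiM I (\<lambda>_. density M f) = density (PiM I (\<lambda>_. M)) (\<lambda>x. \<Prod>i\<in>I. f (x i))"
proof -
  interpret M: product_sigma_finite "\<lambda>_. M" using M(1) by (simp add: product_sigma_finite_def)
  interpret N: product_sigma_finite "\<lambda>_. density M f" using M(2) by (simp add: product_sigma_finite_def)
  show ?thesis
  proof (rule N.PiM_eqI[symmetric, OF I])
    show "sets (density (PiM I (\<lambda>_. M)) (\<lambda>x. \<Prod>i\<in>I. f (x i))) = sets (PiM I (\<lambda>_. density M f))"
      by (simp cong: sets_PiM_cong)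
    fix A assume A: "\<And>i. i \<in> I \<Longrightarrow> A i \<in> sets (density M f)"
    have [measurable]: "Pi\<^sub>E I A \<in> sets (PiM I (\<lambda>_. M))"
      using A I by (intro sets_PiM_I_finite) auto
    have "emeasure (density (PiM I (\<lambda>_. M)) (\<lambda>x. \<Prod>i\<in>I. f (x i))) (Pi\<^sub>E I A)
        = (\<integral>\<^sup>+ x. (\<Prod>i\<in>I. f (x i)) * indicator (Pi\<^sub>E I A) x \<partial>PiM I (\<lambda>_. M))"
      by (subst emeasure_density) auto
    also have "\<dots> = (\<integral>\<^sup>+ x. (\<Prod>i\<in>I. f (x i) * indicator (A i) (x i)) \<partial>PiM I (\<lambda>_. M))"
    proof (rule nn_integral_cong)
      fix x assume "x \<in> space (PiM I (\<lambda>_. M))"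
      hence "indicator (Pi\<^sub>E I A) x = (\<Prod>i\<in>I. indicator (A i) (x i) :: ennreal)"
        using I by (auto simp: indicator_def space_PiM PiE_iff prod_zero_iff)
      thus "(\<Prod>i\<in>I. f (x i)) * indicator (Pi\<^sub>E I A) x = (\<Prod>i\<in>I. f (x i) * indicator (A i) (x i))"
        by (simp add: prod.distrib)
    qed
    also have "\<dots> = (\<Prod>i\<in>I. \<integral>\<^sup>+ x. f x * indicator (A i) x \<partial>M)"
      by (rule M.product_nn_integral_prod[OF I]) (use A in auto)
    also have "\<dots> = (\<Prod>i\<in>I. emeasure (density M f) (A i))"
      by (rule prod.cong) (use A in \<open>auto simp: emeasure_density\<close>)
    finally show "emeasure (density (PiM I (\<lambda>_. M)) (\<lambda>x. \<Prod>i\<in>I. f (x i))) (Pi\<^sub>E I A)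
       = (\<Prod>i\<in>I. emeasure (density M f) (A i))" .
  qed
qed

text \<open>The cutoff keeps the weight bounded, so the tilted mass is finite even for laws without
  any exponential moments.\<close>

definition tilt_weight :: "real \<Rightarrow> real \<Rightarrow> real \<Rightarrow> real" where
  "tilt_weight h L y = (if \<bar>y\<bar> \<le> L then exp (h * y) else 0)"

lemma tilt_weight_measurable[measurable]: "tilt_weight h L \<in> borel_measurable borel"
  unfolding tilt_weight_def by measurable

lemma tilt_weight_nonneg[simp]: "tilt_weight h L y \<ge> 0"
  by (simp add: tilt_weight_def)

lemma (in prob_space) integrable_tilt_weight:
  assumes [measurable]: "Y \<in> borel_measurable M"
  shows "integrable M (\<lambda>x. tilt_weight h L (Y x))"
proof (rule integrable_const_bound[where B="exp (\<bar>h\<bar> * \<bar>L\<bar>)"])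
  have "h * y \<le> \<bar>h\<bar> * \<bar>L\<bar>" if "\<bar>y\<bar> \<le> L" for y
  proof -
    have "h * y \<le> \<bar>h\<bar> * \<bar>y\<bar>" by (metis abs_ge_self abs_mult)
    also have "\<dots> \<le> \<bar>h\<bar> * \<bar>L\<bar>" using that by (intro mult_left_mono) auto
    finally show ?thesis .
  qed
  thus "AE x in M. norm (tilt_weight h L (Y x)) \<le> exp (\<bar>h\<bar> * \<bar>L\<bar>)"
    by (auto simp: tilt_weight_def)
qed simp

definition tilted :: "'a measure \<Rightarrow> ('a \<Rightarrow> real) \<Rightarrow> real \<Rightarrow> real \<Rightarrow> 'a measure" where
  "tilted M Y h L = density M (\<lambda>x. ennreal (tilt_weight h L (Y x) / (LINT x|M. tilt_weight h L (Y x))))"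

lemma sets_tilted[simp, measurable_cong]: "sets (tilted M Y h L) = sets M"
  by (simp add: tilted_def)

lemma (in prob_space) prob_space_tilted:
  assumes [measurable]: "Y \<in> borel_measurable M" and Z: "(LINT x|M. tilt_weight h L (Y x)) > 0"
  shows "prob_space (tilted M Y h L)"
proof (rule prob_spaceI)
  have "emeasure (tilted M Y h L) (space (tilted M Y h L))
     = (\<integral>\<^sup>+x. ennreal (tilt_weight h L (Y x) / (LINT x|M. tilt_weight h L (Y x))) \<partial>M)"
    unfolding tilted_def by (subst emeasure_density) (auto cong: nn_integral_cong)
  also have "\<dots> = ennreal (LINT x|M. tilt_weight h L (Y x) / (LINT x|M. tilt_weight h L (Y x)))"
    using Z by (intro nn_integral_eq_integral integrable_divide_zero integrable_tilt_weight) auto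
  also have "\<dots> = 1" using Z by simp
  finally show "emeasure (tilted M Y h L) (space (tilted M Y h L)) = 1" .
qed

lemma integral_tilted:
  fixes f :: "'a \<Rightarrow> real"
  assumes [measurable]: "Y \<in> borel_measurable M" "f \<in> borel_measurable M" and Z: "(LINT x|M. tilt_weight h L (Y x)) > 0"
  shows "(LINT x|tilted M Y h L. f x) = (LINT x|M. tilt_weight h L (Y x) * f x) / (LINT x|M. tilt_weight h L (Y x))"
  unfolding tilted_def using Z
  by (subst integral_density) (auto simp: less_imp_le)

lemma integrable_tilted_iff:
  fixes f :: "'a \<Rightarrow> real"
  assumes [measurable]: "Y \<in> borel_measurable M" "f \<in> borel_measurable M" and Z: "(LINT x|M. tilt_weight h L (Y x)) > 0"
  shows "integrable (tilted M Y h L) f \<longleftrightarrow> integrable M (\<lambda>x. tilt_weight h L (Y x) * f x)"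
proof -
  let ?Z = "LINT x|M. tilt_weight h L (Y x)"
  have "integrable (tilted M Y h L) f \<longleftrightarrow> integrable M (\<lambda>x. (1 / ?Z) * (tilt_weight h L (Y x) * f x))"
    unfolding tilted_def using Z by (subst integrable_density) (auto simp: less_imp_le)
  also have "\<dots> \<longleftrightarrow> 1 / ?Z = 0 \<or> integrable M (\<lambda>x. tilt_weight h L (Y x) * f x)"
    by (rule integrable_mult_left_iff)
  finally show ?thesis using Z by simp
qed

text \<open>Centring is at h and not at the exact tilted mean: with t = h sqrt n, the sum exceeds t
  sqrt n exactly when this variable is positive.\<close>

definition tilted_law :: "'a measure \<Rightarrow> ('a \<Rightarrow> real) \<Rightarrow> real \<Rightarrow> real \<Rightarrow> nat \<Rightarrow> real measure" where
  "tilted_law M Y h L n = distr (PiM {..<n} (\<lambda>_. tilted M Y h L)) borel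
      (\<lambda>x. (\<Sum>i<n. Y (x i) - h) / sqrt (real n))"

lemma (in prob_space)
  assumes Y[measurable]: "Y \<in> borel_measurable M" and Z: "(LINT x|M. tilt_weight h L (Y x)) > 0"
  shows real_distribution_tilted_law: "real_distribution (tilted_law M Y h L n)"
    and char_tilted_law: "char (tilted_law M Y h L n) y
      = char (distr (tilted M Y h L) borel (\<lambda>x. Y x - h)) (y / sqrt (real n)) ^ n"
proof -
  interpret N: prob_space "tilted M Y h L" by (rule prob_space_tilted[OF Y Z])
  interpret P: product_prob_space "\<lambda>_. tilted M Y h L" "{..<n}" by standard
  have Y'[measurable]: "Y \<in> borel_measurable (tilted M Y h L)" by simp
  have s[measurable]: "(\<lambda>x. (\<Sum>i<n. Y (x i) - h) / sqrt (real n)) \<in> borel_measurable (PiM {..<n} (\<lambda>_. tilted M Y h L))"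
    by measurable
  show "real_distribution (tilted_law M Y h L n)"
    unfolding tilted_law_def by (rule P.real_distribution_distr[OF s])
  have e: "iexp (y * ((\<Sum>i<n. Y (x i) - h) / sqrt (real n)))
     = (\<Prod>i<n. iexp (y / sqrt (real n) * (Y (x i) - h)))" for x
    by (simp add: exp_sum[symmetric] sum_distrib_left[symmetric] sum_divide_distrib[symmetric] mult_ac)
  have "char (tilted_law M Y h L n) y
     = (CLINT x|PiM {..<n} (\<lambda>_. tilted M Y h L). (\<Prod>i<n. iexp (y / sqrt (real n) * (Y (x i) - h))))"
    unfolding tilted_law_def char_def by (subst integral_distr[OF s]) (auto simp only: e borel_measurable_continuous_onI intro!: borel_measurable_continuous_onI continuous_intros)
  also have "\<dots> = (\<Prod>i<n. CLINT x|tilted M Y h L. iexp (y / sqrt (real n) * (Y x - h)))"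
  proof (rule P.product_integral_prod[OF finite_lessThan])
    fix i
    show "integrable (tilted M Y h L) (\<lambda>x. iexp (y / sqrt (real n) * (Y x - h)))"
    proof (rule N.integrable_const_bound[where B=1])
      show "AE x in tilted M Y h L. norm (iexp (y / sqrt (real n) * (Y x - h))) \<le> 1"
        by (simp only: norm_exp_i_times) simp
    qed measurable
  qed
  also have "\<dots> = char (distr (tilted M Y h L) borel (\<lambda>x. Y x - h)) (y / sqrt (real n)) ^ n"
    unfolding char_def by (subst integral_distr) auto
  finally show "char (tilted_law M Y h L n) y
      = char (distr (tilted M Y h L) borel (\<lambda>x. Y x - h)) (y / sqrt (real n)) ^ n" .
qed

text \<open>Where all |Y| \<le> L, the product of the weights is exp (h * sum) = exp (t W + t^2) for
  the centred sum W; elsewhere it is 0. Removing it from the tilted product density leaves exp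
  (-t^2) exp (-t W), and normalisation contributes the n-th power of the mass.\<close>

lemma (in prob_space) tilting_identity:
  assumes Y[measurable]: "Y \<in> borel_measurable M" and Z: "(LINT x|M. tilt_weight h L (Y x)) > 0"
    and n: "n > 0" and t: "t = h * sqrt (real n)"
  shows "measure (PiM {..<n} (\<lambda>_. M))
       {x \<in> space (PiM {..<n} (\<lambda>_. M)). (\<Sum>i<n. Y (x i)) > t * sqrt (real n) \<and> (\<forall>i<n. \<bar>Y (x i)\<bar> \<le> L)}
     = (LINT x|M. tilt_weight h L (Y x)) ^ n * exp (- t\<^sup>2)
       * (LINT w|tilted_law M Y h L n. exp (- (t * w)) * indicator {0<..} w)"
proof -
  define Z where "Z = (LINT x|M. tilt_weight h L (Y x))"
  have Z0: "Z > 0" using Z by (simp add: Z_def)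
  interpret N: prob_space "tilted M Y h L" by (rule prob_space_tilted[OF Y Z])
  let ?P = "PiM {..<n} (\<lambda>_. M)"
  let ?W = "\<lambda>x. (\<Sum>i<n. Y (x i) - h) / sqrt (real n)"
  interpret P: product_prob_space "\<lambda>_. M" "{..<n}" by standard
  have PiMt: "PiM {..<n} (\<lambda>_. tilted M Y h L) = density ?P (\<lambda>x. \<Prod>i<n. ennreal (tilt_weight h L (Y (x i)) / Z))"
    unfolding tilted_def Z_def[symmetric]
    by (rule PiM_density) (use N.sigma_finite_measure_axioms in \<open>auto simp: tilted_def Z_def intro: sigma_finite_measure_axioms\<close>)
  have pe: "(\<Prod>i<n. ennreal (tilt_weight h L (Y (x i)) / Z)) = ennreal ((\<Prod>i<n. tilt_weight h L (Y (x i))) / Z ^ n)" for x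
    using Z0 by (subst prod_ennreal) (auto simp: less_imp_le prod_dividef)
  have s[measurable]: "?W \<in> borel_measurable ?P" by measurable
  have "(LINT w|tilted_law M Y h L n. exp (- (t * w)) * indicator {0<..} w)
     = (LINT x|PiM {..<n} (\<lambda>_. tilted M Y h L). exp (- (t * ?W x)) * indicator {0<..} (?W x))"
    unfolding tilted_law_def by (subst integral_distr) auto
  also have "\<dots> = (LINT x|?P. ((\<Prod>i<n. tilt_weight h L (Y (x i))) / Z ^ n) * (exp (- (t * ?W x)) * indicator {0<..} (?W x)))"
    unfolding PiMt pe using Z0 by (subst integral_density) (auto intro!: AE_I2 divide_nonneg_pos prod_nonneg)
  also have "\<dots> = (LINT x|?P. exp (t\<^sup>2) / Z ^ n * indicator {x \<in> space ?P. (\<Sum>i<n. Y (x i)) > t * sqrt (real n) \<and> (\<forall>i<n. \<bar>Y (x i)\<bar> \<le> L)} x)"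
  proof (rule Bochner_Integration.integral_cong[OF refl])
    fix x assume x: "x \<in> space ?P"
    have sq: "sqrt (real n) * sqrt (real n) = real n" by simp
    have W: "?W x = ((\<Sum>i<n. Y (x i)) - t * sqrt (real n)) / sqrt (real n)"
      by (simp add: sum_subtractf t)
    have W0: "0 < ?W x \<longleftrightarrow> (\<Sum>i<n. Y (x i)) > t * sqrt (real n)"
      unfolding W using n by (simp add: zero_less_divide_iff)
    have tW: "h * (\<Sum>i<n. Y (x i)) = t * ?W x + t\<^sup>2"
      unfolding W using n by (simp add: t field_simps power2_eq_square)
    show "((\<Prod>i<n. tilt_weight h L (Y (x i))) / Z ^ n) * (exp (- (t * ?W x)) * indicator {0<..} (?W x))
       = exp (t\<^sup>2) / Z ^ n * indicator {x \<in> space ?P. (\<Sum>i<n. Y (x i)) > t * sqrt (real n) \<and> (\<forall>i<n. \<bar>Y (x i)\<bar> \<le> L)} x"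
    proof (cases "\<forall>i<n. \<bar>Y (x i)\<bar> \<le> L")
      case True
      hence "(\<Prod>i<n. tilt_weight h L (Y (x i))) = exp (h * (\<Sum>i<n. Y (x i)))"
        by (simp add: tilt_weight_def sum_distrib_left exp_sum)
      thus ?thesis using True x W0 unfolding tW by (simp add: indicator_def exp_add exp_minus)
    next
      case False
      hence "(\<Prod>i<n. tilt_weight h L (Y (x i))) = 0"
        by (auto simp: tilt_weight_def)
      thus ?thesis using False by (auto simp: indicator_def)
    qed
  qed
  also have "\<dots> = exp (t\<^sup>2) / Z ^ n * measure ?P
       {x \<in> space ?P. (\<Sum>i<n. Y (x i)) > t * sqrt (real n) \<and> (\<forall>i<n. \<bar>Y (x i)\<bar> \<le> L)}"
    by (simp add: Int_absorb2)
  finally show ?thesis using Z0 by (simp add: Z_def[symmetric] exp_minus)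
qed

section \<open>Taylor expansion of the tilted moments\<close>

lemma power_over_fact_le_exp: "x \<ge> 0 \<Longrightarrow> x ^ m / fact m \<le> exp x" for x :: real
proof -
  assume x: "x \<ge> 0"
  obtain s where s: "exp x = (\<Sum>j<Suc m. (x ^ j) / fact j) + (exp s / fact (Suc m)) * x ^ Suc m"
    using Maclaurin_exp_le[of x "Suc m"] by blast
  have "x ^ m / fact m \<le> (\<Sum>j<Suc m. (x ^ j) / fact j)"
    using x by (intro member_le_sum) auto
  also have "\<dots> \<le> exp x" unfolding s using x by simp
  finally show ?thesis .
qed

lemma power_le_exp_powr:
  fixes c p :: real
  assumes c: "c > 0" and p: "p > 0"
  obtains C where "\<And>y. \<bar>y\<bar> ^ k \<le> C * exp (c * \<bar>y\<bar> powr p)"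
proof
  \<comment> \<open>Chosen so that k \<le> p m: for |y| > 1 the k-th power is then below the m-th
    power of |y| powr p, which a single term of the exponential series dominates.\<close>
  define m where "m = nat \<lceil>real k / p\<rceil>"
  have m: "real k \<le> p * real m"
  proof -
    have "real k / p \<le> real m" unfolding m_def by linarith
    thus ?thesis using p by (simp add: field_simps)
  qed
  fix y :: real
  let ?v = "\<bar>y\<bar> powr p"
  have e1: "1 \<le> exp (c * ?v)" using c by simp
  have "?v ^ m = (c * ?v) ^ m / c ^ m" using c by (simp add: power_mult_distrib)
  also have "\<dots> = fact m / c ^ m * ((c * ?v) ^ m / fact m)" by simp
  also have "\<dots> \<le> fact m / c ^ m * exp (c * ?v)"
    using c by (intro mult_left_mono power_over_fact_le_exp) auto
  finally have v: "?v ^ m \<le> fact m / c ^ m * exp (c * ?v)" .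
  have "\<bar>y\<bar> ^ k \<le> 1 + ?v ^ m"
  proof (cases "\<bar>y\<bar> \<le> 1")
    case True
    thus ?thesis using power_le_one[of "\<bar>y\<bar>" k] by (simp add: add_increasing2)
  next
    case False
    hence "\<bar>y\<bar> ^ k = \<bar>y\<bar> powr real k" by (simp add: powr_realpow)
    also have "\<dots> \<le> \<bar>y\<bar> powr (p * real m)" using m False by (intro powr_mono) auto
    also have "\<dots> = ?v ^ m" using False by (simp add: powr_powr[symmetric] powr_realpow)
    finally show ?thesis by simp
  qed
  also have "\<dots> \<le> (1 + fact m / c ^ m) * exp (c * ?v)"
    using add_mono[OF e1 v] by (simp only: distrib_right mult_1_left)
  finally show "\<bar>y\<bar> ^ k \<le> (1 + fact m / c ^ m) * exp (c * \<bar>y\<bar> powr p)" .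
qed

text \<open>Half of the exponent absorbs the power. The other half is kept, since it has to dominate
  exp (h |y|) on the truncated range.\<close>

lemma integrable_power_times_exp_powr:
  fixes c p :: real and Y :: "'a \<Rightarrow> real"
  assumes c: "c > 0" and p: "p > 0" and Y[measurable]: "Y \<in> borel_measurable M"
    and i: "integrable M (\<lambda>x. exp (c * \<bar>Y x\<bar> powr p))"
  shows "integrable M (\<lambda>x. \<bar>Y x\<bar> ^ k * exp (c / 2 * \<bar>Y x\<bar> powr p))"
proof -
  obtain C where C: "\<And>y. \<bar>y\<bar> ^ k \<le> C * exp (c / 2 * \<bar>y\<bar> powr p)"
    by (rule power_le_exp_powr[of "c / 2" p k]) (use c p in auto)
  show ?thesis
  proof (rule Bochner_Integration.integrable_bound[OF integrable_mult_right[OF i, of C]])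
    have "norm (\<bar>Y x\<bar> ^ k * exp (c / 2 * \<bar>Y x\<bar> powr p)) \<le> norm (C * exp (c * \<bar>Y x\<bar> powr p))" for x
    proof -
      have "\<bar>Y x\<bar> ^ k * exp (c / 2 * \<bar>Y x\<bar> powr p)
          \<le> (C * exp (c / 2 * \<bar>Y x\<bar> powr p)) * exp (c / 2 * \<bar>Y x\<bar> powr p)"
        by (rule mult_right_mono[OF C]) simp
      also have "\<dots> = C * exp (c * \<bar>Y x\<bar> powr p)" by (simp add: mult.assoc exp_add[symmetric])
      also have "\<dots> \<le> \<bar>C * exp (c * \<bar>Y x\<bar> powr p)\<bar>" by (rule abs_ge_self)
      finally show ?thesis by simp
    qed
    thus "AE x in M. norm (\<bar>Y x\<bar> ^ k * exp (c / 2 * \<bar>Y x\<bar> powr p)) \<le> norm (C * exp (c * \<bar>Y x\<bar> powr p))"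
      by simp
  qed measurable
qed

text \<open>Beyond \<open>L\<close> the weight vanishes, but there \<open>\<bar>h y\<bar> \<ge> 1\<close> makes the Taylor polynomial itself
  smaller than the remainder term, so that one bound covers both ranges.\<close>

lemma tilt_weight_taylor:
  assumes s: "\<bar>y\<bar> \<le> L \<longrightarrow> h * \<bar>y\<bar> \<le> a * \<bar>y\<bar> powr p" and l: "\<bar>y\<bar> > L \<longrightarrow> 1 \<le> h * \<bar>y\<bar>"
    and h: "h \<ge> 0" and a: "a \<ge> 0"
  shows "\<bar>tilt_weight h L y - (\<Sum>j<k. (h * y) ^ j / fact j)\<bar> \<le> 3 * (h * \<bar>y\<bar>) ^ k * exp (a * \<bar>y\<bar> powr p)"
proof (cases "\<bar>y\<bar> \<le> L")
  case True
  obtain z where z: "\<bar>z\<bar> \<le> \<bar>h * y\<bar>" "exp (h * y) = (\<Sum>j<k. (h * y) ^ j / fact j) + (exp z / fact k) * (h * y) ^ k"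
    using Maclaurin_exp_le[of "h * y" k] by blast
  have "\<bar>tilt_weight h L y - (\<Sum>j<k. (h * y) ^ j / fact j)\<bar> = exp z / fact k * (h * \<bar>y\<bar>) ^ k"
    using True h z(2) by (simp add: tilt_weight_def abs_mult power_abs)
  also have "\<dots> \<le> exp (a * \<bar>y\<bar> powr p) * (h * \<bar>y\<bar>) ^ k"
  proof (intro mult_right_mono)
    have "exp z / fact k \<le> exp z / 1" by (intro divide_left_mono) auto
    also have "\<dots> \<le> exp (a * \<bar>y\<bar> powr p)"
      using z(1) s True h by (simp add: abs_mult)
    finally show "exp z / fact k \<le> exp (a * \<bar>y\<bar> powr p)" .
  qed (use h in auto)
  also have "\<dots> \<le> 3 * (h * \<bar>y\<bar>) ^ k * exp (a * \<bar>y\<bar> powr p)"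
    using h by simp
  finally show ?thesis .
next
  case False
  have "\<bar>\<Sum>j<k. (h * y) ^ j / fact j\<bar> \<le> (\<Sum>j<k. (h * \<bar>y\<bar>) ^ j / fact j)"
    using h by (intro order_trans[OF sum_abs] sum_mono) (simp add: abs_mult power_abs)
  also have "\<dots> \<le> (\<Sum>j<k. (h * \<bar>y\<bar>) ^ k * (1 ^ j / fact j))"
    using l False by (intro sum_mono) (auto intro!: divide_right_mono power_increasing)
  also have "\<dots> = (h * \<bar>y\<bar>) ^ k * (\<Sum>j<k. 1 ^ j / fact j)" by (simp add: sum_distrib_left)
  \<comment> \<open>The partial sums of 1 / j! stay below e, which is at most 3; this is the origin
    of the factor 3.\<close>
  also have "\<dots> \<le> (h * \<bar>y\<bar>) ^ k * 3"
  proof (intro mult_left_mono)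
    obtain z :: real where "exp 1 = (\<Sum>j<k. 1 ^ j / fact j) + (exp z / fact k) * 1 ^ k"
      using Maclaurin_exp_le[of 1 k] by blast
    moreover have "exp z / fact k * 1 ^ k \<ge> 0" by simp
    ultimately show "(\<Sum>j<k. 1 ^ j / fact j) \<le> (3::real)" using exp_le by linarith
  qed (use h in auto)
  also have "\<dots> \<le> (h * \<bar>y\<bar>) ^ k * (3 * exp (a * \<bar>y\<bar> powr p))"
    using h a by (intro mult_left_mono) auto
  finally show ?thesis using False by (simp add: tilt_weight_def mult_ac)
qed

text \<open>The length k of the expansion and the moment order m both stay free: the mass is needed
  with error h^4, the first moment with error h^2 and the second with error h.\<close>

lemma tilted_moment_expansion:
  fixes Y :: "'a \<Rightarrow> real"
  assumes s: "\<And>y. \<bar>y\<bar> \<le> L \<longrightarrow> h * \<bar>y\<bar> \<le> a * \<bar>y\<bar> powr p" and l: "\<And>y. \<bar>y\<bar> > L \<longrightarrow> 1 \<le> h * \<bar>y\<bar>"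
    and h: "h \<ge> 0" and a: "a \<ge> 0" and Y[measurable]: "Y \<in> borel_measurable M"
    and i: "\<And>k. integrable M (\<lambda>x. \<bar>Y x\<bar> ^ k * exp (a * \<bar>Y x\<bar> powr p))"
  shows "integrable M (\<lambda>x. tilt_weight h L (Y x) * \<bar>Y x\<bar> ^ m)"
    and "integrable M (\<lambda>x. tilt_weight h L (Y x) * Y x ^ m)"
    and "\<bar>(LINT x|M. tilt_weight h L (Y x) * Y x ^ m) - (\<Sum>j<k. h ^ j / fact j * (LINT x|M. Y x ^ (j + m)))\<bar>
      \<le> 3 * h ^ k * (LINT x|M. \<bar>Y x\<bar> ^ (k + m) * exp (a * \<bar>Y x\<bar> powr p))"
    and "(LINT x|M. tilt_weight h L (Y x) * \<bar>Y x\<bar> ^ m) \<le> 3 * (LINT x|M. \<bar>Y x\<bar> ^ m * exp (a * \<bar>Y x\<bar> powr p))"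
proof -
  \<comment> \<open>For k = 0 the Taylor sum is empty and the estimate becomes a plain upper bound
    for the weight.\<close>
  have b: "tilt_weight h L y * \<bar>y\<bar> ^ m \<le> 3 * (\<bar>y\<bar> ^ m * exp (a * \<bar>y\<bar> powr p))" for y
    using mult_right_mono[OF tilt_weight_taylor[OF s l h a, where y=y and k=0], of "\<bar>y\<bar> ^ m"] by (simp add: mult_ac)
  show i1: "integrable M (\<lambda>x. tilt_weight h L (Y x) * \<bar>Y x\<bar> ^ m)"
    by (rule Bochner_Integration.integrable_bound[OF integrable_mult_right[OF i[of m], of 3]])
       (use b in \<open>auto simp: abs_mult\<close>)
  show i2: "integrable M (\<lambda>x. tilt_weight h L (Y x) * Y x ^ m)"
    by (rule Bochner_Integration.integrable_bound[OF i1]) (auto simp: abs_mult power_abs)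
  show "(LINT x|M. tilt_weight h L (Y x) * \<bar>Y x\<bar> ^ m) \<le> 3 * (LINT x|M. \<bar>Y x\<bar> ^ m * exp (a * \<bar>Y x\<bar> powr p))"
    unfolding integral_mult_right_zero[symmetric]
    by (rule integral_mono[OF i1 integrable_mult_right[OF i] b])
  have iY: "integrable M (\<lambda>x. Y x ^ j)" for j
    by (rule Bochner_Integration.integrable_bound[OF i[of j]])
       (use a in \<open>auto simp: power_abs mult_le_cancel_left1\<close>)
  have iS: "integrable M (\<lambda>x. \<Sum>j<k. h ^ j / fact j * Y x ^ (j + m))"
    by (intro Bochner_Integration.integrable_sum integrable_mult_right iY)
  have "\<bar>(LINT x|M. tilt_weight h L (Y x) * Y x ^ m) - (\<Sum>j<k. h ^ j / fact j * (LINT x|M. Y x ^ (j + m)))\<bar>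
     = \<bar>LINT x|M. tilt_weight h L (Y x) * Y x ^ m - (\<Sum>j<k. h ^ j / fact j * Y x ^ (j + m))\<bar>"
    by (simp only: Bochner_Integration.integral_diff[OF i2 iS] Bochner_Integration.integral_sum[OF integrable_mult_right[OF iY]]
        integral_mult_right_zero)
  also have "\<dots> \<le> (LINT x|M. \<bar>tilt_weight h L (Y x) * Y x ^ m - (\<Sum>j<k. h ^ j / fact j * Y x ^ (j + m))\<bar>)"
    by (rule integral_abs_bound)
  also have "\<dots> \<le> (LINT x|M. 3 * h ^ k * (\<bar>Y x\<bar> ^ (k + m) * exp (a * \<bar>Y x\<bar> powr p)))"
  proof (rule integral_mono)
    fix x
    have "\<bar>tilt_weight h L (Y x) * Y x ^ m - (\<Sum>j<k. h ^ j / fact j * Y x ^ (j + m))\<bar>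
       = \<bar>tilt_weight h L (Y x) - (\<Sum>j<k. (h * Y x) ^ j / fact j)\<bar> * \<bar>Y x\<bar> ^ m"
    proof -
      have "tilt_weight h L (Y x) * Y x ^ m - (\<Sum>j<k. h ^ j / fact j * Y x ^ (j + m))
         = (tilt_weight h L (Y x) - (\<Sum>j<k. (h * Y x) ^ j / fact j)) * Y x ^ m"
        unfolding left_diff_distrib sum_distrib_right by (simp add: power_add power_mult_distrib mult.assoc)
      thus ?thesis by (simp only: abs_mult power_abs)
    qed
    also have "\<dots> \<le> 3 * (h * \<bar>Y x\<bar>) ^ k * exp (a * \<bar>Y x\<bar> powr p) * \<bar>Y x\<bar> ^ m"
      by (intro mult_right_mono tilt_weight_taylor s l h a) auto
    also have "\<dots> = 3 * h ^ k * (\<bar>Y x\<bar> ^ (k + m) * exp (a * \<bar>Y x\<bar> powr p))"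
      by (simp add: power_add power_mult_distrib)
    finally show "\<bar>tilt_weight h L (Y x) * Y x ^ m - (\<Sum>j<k. h ^ j / fact j * Y x ^ (j + m))\<bar>
      \<le> 3 * h ^ k * (\<bar>Y x\<bar> ^ (k + m) * exp (a * \<bar>Y x\<bar> powr p))" .
  qed (intro integrable_abs Bochner_Integration.integrable_diff i2 iS integrable_mult_right i)+
  finally show "\<bar>(LINT x|M. tilt_weight h L (Y x) * Y x ^ m) - (\<Sum>j<k. h ^ j / fact j * (LINT x|M. Y x ^ (j + m)))\<bar>
      \<le> 3 * h ^ k * (LINT x|M. \<bar>Y x\<bar> ^ (k + m) * exp (a * \<bar>Y x\<bar> powr p))" by simp
qed

text \<open>The orders are those wanted later: the errors h^4 of the mass, h^2 of the mean and h of
  the second moment are multiplied by n, sqrt n and 1, and all three products vanish in the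
  limit.\<close>

lemma (in prob_space) tilted_estimates:
  fixes Y :: "'a \<Rightarrow> real"
  assumes s: "\<And>y. \<bar>y\<bar> \<le> L \<longrightarrow> h * \<bar>y\<bar> \<le> a * \<bar>y\<bar> powr p" and l: "\<And>y. \<bar>y\<bar> > L \<longrightarrow> 1 \<le> h * \<bar>y\<bar>"
    and h: "h \<ge> 0" "h \<le> 1" and a: "a \<ge> 0" and Y[measurable]: "Y \<in> borel_measurable M"
    and i: "\<And>k. integrable M (\<lambda>x. \<bar>Y x\<bar> ^ k * exp (a * \<bar>Y x\<bar> powr p))"
    and m1: "(LINT x|M. Y x) = 0" and m2: "(LINT x|M. (Y x)\<^sup>2) = 1"
  defines "G \<equiv> \<lambda>k. LINT x|M. \<bar>Y x\<bar> ^ k * exp (a * \<bar>Y x\<bar> powr p)"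
    and "Z \<equiv> LINT x|M. tilt_weight h L (Y x)"
    and "R \<equiv> distr (tilted M Y h L) borel (\<lambda>x. Y x - h)"
  assumes small: "3 * h\<^sup>2 * G 2 \<le> 1 / 2"
  shows "\<bar>Z - (1 + h\<^sup>2 / 2 + h ^ 3 / 6 * (LINT x|M. Y x ^ 3))\<bar> \<le> 3 * h ^ 4 * G 4"
    and "Z \<ge> 1 / 2"
    and "real_distribution R"
    and "integrable R (\<lambda>x. x)" "integrable R (\<lambda>x. x\<^sup>2)" "integrable R (\<lambda>x. \<bar>x\<bar> ^ 3)"
    and "\<bar>LINT x|R. x\<bar> \<le> 6 * h\<^sup>2 * (G 2 + G 3)"
    and "\<bar>(LINT x|R. x\<^sup>2) - 1\<bar> \<le> 2 * h * (9 * G 3 + 3 * G 2 + 4)"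
    and "(LINT x|R. \<bar>x\<bar> ^ 3) \<le> 24 * (G 3 + G 0)"
proof -
  have Gd: "(LINT x|M. \<bar>Y x\<bar> ^ k * exp (a * \<bar>Y x\<bar> powr p)) = G k" for k by (simp add: G_def)
  note E = tilted_moment_expansion[OF s l h(1) a Y i, unfolded Gd]
  let ?E = "\<lambda>m. LINT x|M. tilt_weight h L (Y x) * Y x ^ m"
  have G0: "G k \<ge> 0" for k unfolding G_def by (intro Bochner_Integration.integral_nonneg) auto
  have E0: "?E 0 = Z" by (simp add: Z_def)
  show "\<bar>Z - (1 + h\<^sup>2 / 2 + h ^ 3 / 6 * (LINT x|M. Y x ^ 3))\<bar> \<le> 3 * h ^ 4 * G 4"
    using E(3)[where m=0 and k=4] m1 m2 prob_space unfolding E0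
    by (simp add: eval_nat_numeral algebra_simps)
  have Z1: "\<bar>Z - 1\<bar> \<le> 3 * h\<^sup>2 * G 2"
    using E(3)[where m=0 and k=2] m1 m2 prob_space unfolding E0 by (simp add: eval_nat_numeral)
  thus Zh: "Z \<ge> 1 / 2" using small by linarith
  have Z32: "Z \<le> 3 / 2" using Z1 small by linarith
  have Zpos: "(LINT x|M. tilt_weight h L (Y x)) > 0" using Zh by (simp add: Z_def)
  interpret N: prob_space "tilted M Y h L" by (rule prob_space_tilted[OF Y Zpos])
  show "real_distribution R" unfolding R_def by (intro N.real_distribution_distr) simp
  have E1: "\<bar>?E 1 - h\<bar> \<le> 3 * h\<^sup>2 * G 3"
    using E(3)[where m=1 and k=2] m1 m2 by (simp add: eval_nat_numeral)
  have E2: "\<bar>?E 2 - 1\<bar> \<le> 3 * h * G 3"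
    using E(3)[where m=2 and k=1] m2 by (simp add: eval_nat_numeral)
  have iR: "integrable R f \<longleftrightarrow> integrable M (\<lambda>x. tilt_weight h L (Y x) * f (Y x - h))"
    and LR: "(LINT x|R. f x) = (LINT x|M. tilt_weight h L (Y x) * f (Y x - h)) / Z"
    if [measurable]: "f \<in> borel_measurable borel" for f :: "real \<Rightarrow> real"
    unfolding R_def Z_def
    by (subst integrable_distr_eq, simp, simp, rule integrable_tilted_iff[OF Y _ Zpos], simp)
       (subst integral_distr, simp, simp, rule integral_tilted[OF Y _ Zpos], simp)
  have iE: "integrable M (\<lambda>x. tilt_weight h L (Y x) * Y x)" "integrable M (\<lambda>x. tilt_weight h L (Y x))"
     "integrable M (\<lambda>x. tilt_weight h L (Y x) * (Y x)\<^sup>2)"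
    using E(2)[where m=1] E(2)[where m=0] E(2)[where m=2] by simp_all
  have f1: "(\<lambda>x. tilt_weight h L (Y x) * (Y x - h)) = (\<lambda>x. tilt_weight h L (Y x) * Y x - h * tilt_weight h L (Y x))"
    by (auto simp: algebra_simps)
  have f2: "(\<lambda>x. tilt_weight h L (Y x) * (Y x - h)\<^sup>2)
      = (\<lambda>x. tilt_weight h L (Y x) * (Y x)\<^sup>2 - 2 * h * (tilt_weight h L (Y x) * Y x) + h\<^sup>2 * tilt_weight h L (Y x))"
    by (auto simp: algebra_simps power2_eq_square)
  show "integrable R (\<lambda>x. x)"
    by (subst iR, simp, subst f1) (intro Bochner_Integration.integrable_diff integrable_mult_right iE)
  show "integrable R (\<lambda>x. x\<^sup>2)"
    by (subst iR, simp, subst f2)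
       (intro Bochner_Integration.integrable_diff Bochner_Integration.integrable_add integrable_mult_right iE)
  have L1: "(LINT x|R. x) = (?E 1 - h * Z) / Z"
    by (subst LR, simp, subst f1) (simp add: iE Z_def)
  have L2: "(LINT x|R. x\<^sup>2) = (?E 2 - 2 * h * ?E 1 + h\<^sup>2 * Z) / Z"
    by (subst LR, simp, subst f2) (simp add: iE Z_def)
  \<comment> \<open>Normalisation costs at most a factor 2, as Z \<ge> 1/2.\<close>
  have div2: "\<bar>v / Z\<bar> \<le> 2 * w" if "\<bar>v\<bar> \<le> w" for v w
  proof -
    have "\<bar>v / Z\<bar> = \<bar>v\<bar> / Z" using Zh by simp
    also have "\<dots> \<le> w / (1 / 2)" using that Zh by (intro frac_le) auto
    finally show ?thesis by simp
  qed
  have h2: "h\<^sup>2 \<le> h" "h * h\<^sup>2 \<le> h\<^sup>2"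
    using h mult_right_mono[of h 1 h] mult_right_mono[of h 1 "h\<^sup>2"] by (simp_all add: power2_eq_square)
  \<comment> \<open>The first moment and h Z share their first-order term h; this is what makes
    centring at h accurate to order h^2.\<close>
  have "\<bar>?E 1 - h * Z\<bar> \<le> \<bar>?E 1 - h\<bar> + h * \<bar>Z - 1\<bar>"
  proof -
    have "?E 1 - h * Z = (?E 1 - h) - h * (Z - 1)" by (simp add: algebra_simps)
    also have "\<bar>\<dots>\<bar> \<le> \<bar>?E 1 - h\<bar> + \<bar>h * (Z - 1)\<bar>" by (rule abs_triangle_ineq4)
    finally show ?thesis using h by (simp add: abs_mult)
  qed
  also have "\<dots> \<le> 3 * h\<^sup>2 * G 3 + h * (3 * h\<^sup>2 * G 2)"
    using E1 Z1 h by (intro add_mono mult_left_mono) auto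
  also have "h * (3 * h\<^sup>2 * G 2) = (h * h\<^sup>2) * (3 * G 2)" by simp
  also have "\<dots> \<le> h\<^sup>2 * (3 * G 2)" using h2(2) G0[of 2] by (intro mult_right_mono) auto
  finally have "\<bar>?E 1 - h * Z\<bar> \<le> 3 * h\<^sup>2 * (G 2 + G 3)" by (simp add: algebra_simps)
  from div2[OF this] show "\<bar>LINT x|R. x\<bar> \<le> 6 * h\<^sup>2 * (G 2 + G 3)" unfolding L1 by simp
  have e1: "2 * h * \<bar>?E 1\<bar> \<le> 2 * h * (1 + 3 * G 3)"
  proof -
    have "h\<^sup>2 * (3 * G 3) \<le> 1 * (3 * G 3)"
      using h2(1) h G0[of 3] by (intro mult_right_mono) auto
    hence "\<bar>?E 1\<bar> \<le> 1 + 3 * G 3" using E1 h by linarith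
    thus ?thesis using h by (intro mult_left_mono) auto
  qed
  have "(LINT x|R. x\<^sup>2) - 1 = (?E 2 - Z - 2 * h * ?E 1 + h\<^sup>2 * Z) / Z"
    unfolding L2 using Zh by (simp add: field_simps)
  moreover have "\<bar>?E 2 - Z - 2 * h * ?E 1 + h\<^sup>2 * Z\<bar> \<le> h * (9 * G 3 + 3 * G 2 + 4)"
  proof -
    have "h\<^sup>2 * (3 * G 2) \<le> h * (3 * G 2)" using h2(1) G0[of 2] by (intro mult_right_mono) auto
    hence z: "\<bar>Z - 1\<bar> \<le> h * (3 * G 2)" using Z1 by simp
    have z2: "\<bar>h\<^sup>2 * Z\<bar> \<le> h * 2"
      unfolding abs_mult using h2(1) Zh Z32 h by (intro mult_mono) auto
    have "\<bar>2 * h * ?E 1\<bar> = 2 * h * \<bar>?E 1\<bar>" using h by (simp add: abs_mult)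
    hence "\<bar>?E 2 - Z - 2 * h * ?E 1 + h\<^sup>2 * Z\<bar> \<le> 3 * h * G 3 + h * (3 * G 2) + 2 * h * (1 + 3 * G 3) + h * 2"
      using E2 z z2 e1 by linarith
    thus ?thesis by (simp add: algebra_simps)
  qed
  ultimately show "\<bar>(LINT x|R. x\<^sup>2) - 1\<bar> \<le> 2 * h * (9 * G 3 + 3 * G 2 + 4)"
    using div2 by (simp add: mult.assoc)
  have cube: "\<bar>y - h\<bar> ^ 3 \<le> 4 * (\<bar>y\<bar> ^ 3 + 1)" for y
  proof -
    have "\<bar>y - h\<bar> ^ 3 \<le> (\<bar>y\<bar> + 1) ^ 3" using h by (intro power_mono) auto
    also have "\<dots> \<le> 4 * (\<bar>y\<bar> ^ 3 + 1)"
    proof -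
      \<comment> \<open>With a = |y| this product equals 4 (a^3 + 1) - (a + 1)^3.\<close>
      have "0 \<le> 3 * ((\<bar>y\<bar> + 1) * (\<bar>y\<bar> - 1)\<^sup>2)" by simp
      thus ?thesis by (simp add: power3_eq_cube power2_eq_square algebra_simps)
    qed
    finally show ?thesis .
  qed
  have ic: "integrable M (\<lambda>x. tilt_weight h L (Y x) * (4 * (\<bar>Y x\<bar> ^ 3 + 1)))"
  proof -
    have "integrable M (\<lambda>x. 4 * (tilt_weight h L (Y x) * \<bar>Y x\<bar> ^ 3 + tilt_weight h L (Y x)))"
      by (intro integrable_mult_right Bochner_Integration.integrable_add E(1) iE)
    thus ?thesis by (simp add: algebra_simps)
  qed
  have i3: "integrable M (\<lambda>x. tilt_weight h L (Y x) * \<bar>Y x - h\<bar> ^ 3)"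
    by (rule Bochner_Integration.integrable_bound[OF ic]) (auto simp: abs_mult intro!: mult_left_mono order_trans[OF cube])
  show "integrable R (\<lambda>x. \<bar>x\<bar> ^ 3)" by (subst iR) (simp_all add: i3)
  have "(LINT x|M. tilt_weight h L (Y x) * \<bar>Y x - h\<bar> ^ 3) \<le> (LINT x|M. tilt_weight h L (Y x) * (4 * (\<bar>Y x\<bar> ^ 3 + 1)))"
    by (intro integral_mono i3 ic mult_left_mono cube) auto
  also have "\<dots> = (LINT x|M. 4 * (tilt_weight h L (Y x) * \<bar>Y x\<bar> ^ 3 + tilt_weight h L (Y x) * \<bar>Y x\<bar> ^ 0))"
    by (simp add: algebra_simps)
  also have "\<dots> = 4 * ((LINT x|M. tilt_weight h L (Y x) * \<bar>Y x\<bar> ^ 3) + (LINT x|M. tilt_weight h L (Y x) * \<bar>Y x\<bar> ^ 0))"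
    by (simp only: integral_mult_right_zero Bochner_Integration.integral_add[OF E(1) E(1)])
  also have "\<dots> \<le> 4 * (3 * G 3 + 3 * G 0)"
    by (intro mult_left_mono add_mono E(4)) auto
  finally have "\<bar>LINT x|M. tilt_weight h L (Y x) * \<bar>Y x - h\<bar> ^ 3\<bar> \<le> 4 * (3 * G 3 + 3 * G 0)"
    by (subst abs_of_nonneg) (auto intro!: Bochner_Integration.integral_nonneg)
  from div2[OF this] Zh show "(LINT x|R. \<bar>x\<bar> ^ 3) \<le> 24 * (G 3 + G 0)"
    by (subst LR) auto
qed

subsection \<open>Moderate deviations\<close>

text \<open>The bound \<gamma> \<le> 1/4 enters as (n powr \<gamma>)^2 \<le> sqrt n.\<close>

lemma square_over_sqrt_tendsto_0:
  fixes s :: "nat \<Rightarrow> real"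
  assumes s: "(\<lambda>n. s n / real n powr \<gamma>) \<longlonglongrightarrow> 0" and \<gamma>: "\<gamma> \<le> 1 / 4"
  shows "(\<lambda>n. (s n)\<^sup>2 / sqrt (real n)) \<longlonglongrightarrow> 0"
proof (rule Lim_null_comparison)
  show "(\<lambda>n. (s n / real n powr \<gamma>)\<^sup>2) \<longlonglongrightarrow> 0"
    using tendsto_power[OF s, of 2] by simp
  show "\<forall>\<^sub>F n in sequentially. norm ((s n)\<^sup>2 / sqrt (real n)) \<le> (s n / real n powr \<gamma>)\<^sup>2"
    using eventually_gt_at_top[of 0]
  proof eventually_elim
    case (elim n)
    have "(real n powr \<gamma>)\<^sup>2 = real n powr (2 * \<gamma>)" using elim by (simp add: powr_power)
    also have "\<dots> \<le> real n powr (1 / 2)" using elim \<gamma> by (intro powr_mono) auto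
    also have "\<dots> = sqrt (real n)" using elim by (simp add: powr_half_sqrt)
    finally have "(s n)\<^sup>2 / sqrt (real n) \<le> (s n)\<^sup>2 / (real n powr \<gamma>)\<^sup>2"
      using elim by (intro divide_left_mono mult_pos_pos) auto
    thus ?case by (simp add: power_divide)
  qed
qed

text \<open>The constant c stays free because passing to unit variance turns the constant 1 of the
  Linnik condition into a power of the standard deviation. The level t is arbitrary within its
  growth bound; the corrected quantile is substituted for it afterwards.\<close>

locale moderate_deviation = prob_space M for M :: "'a measure" +
  fixes Y :: "'a \<Rightarrow> real" and \<gamma> c :: real and t :: "nat \<Rightarrow> real"
  assumes Y_measurable[measurable]: "Y \<in> borel_measurable M"
    and \<gamma>_pos: "0 < \<gamma>" and \<gamma>_le: "\<gamma> \<le> 1 / 4" and c_pos: "c > 0"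
    and exp_moment: "integrable M (\<lambda>x. exp (c * \<bar>Y x\<bar> powr (4 * \<gamma> / (2 * \<gamma> + 1))))"
    and mean_zero: "(LINT x|M. Y x) = 0" and variance_one: "(LINT x|M. (Y x)\<^sup>2) = 1"
    and t_at_top: "filterlim t at_top sequentially"
    and t_small: "(\<lambda>n. t n / real n powr \<gamma>) \<longlonglongrightarrow> 0"
begin

definition p :: real where "p = 4 * \<gamma> / (2 * \<gamma> + 1)"
definition h :: "nat \<Rightarrow> real" where "h n = t n / sqrt (real n)"
definition L :: "nat \<Rightarrow> real" where "L n = real n powr (1 / 2 + \<gamma>)"
definition G :: "nat \<Rightarrow> real" where "G k = (LINT x|M. \<bar>Y x\<bar> ^ k * exp (c / 2 * \<bar>Y x\<bar> powr p))"
definition Z :: "nat \<Rightarrow> real" where "Z n = (LINT x|M. tilt_weight (h n) (L n) (Y x))"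
definition \<kappa> :: real where "\<kappa> = (LINT x|M. Y x ^ 3)"

lemma p_bounds: "0 < p" "p < 1"
  using \<gamma>_pos \<gamma>_le by (auto simp: p_def field_simps)

lemma L_powr_p: "L n powr p = real n powr (2 * \<gamma>)"
proof -
  have "(1 / 2 + \<gamma>) * p = 2 * \<gamma>" using \<gamma>_pos by (simp add: p_def field_simps)
  thus ?thesis by (simp add: L_def powr_powr)
qed

lemma L_nonneg: "L n \<ge> 0"
  by (simp add: L_def)

lemma G_nonneg: "G k \<ge> 0"
  unfolding G_def by (intro Bochner_Integration.integral_nonneg) auto

lemma eventually_t_ge: "\<forall>\<^sub>F n in sequentially. t n \<ge> b"
  using t_at_top by (simp add: filterlim_at_top)

lemma h_tendsto_0: "h \<longlonglongrightarrow> 0"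
proof -
  have "(\<lambda>n. (t n / real n powr \<gamma>) * real n powr (\<gamma> - 1 / 2)) \<longlonglongrightarrow> 0 * 0"
    using \<gamma>_le by (intro tendsto_mult t_small tendsto_neg_powr filterlim_real_sequentially) auto
  moreover have "\<forall>\<^sub>F n in sequentially. (t n / real n powr \<gamma>) * real n powr (\<gamma> - 1 / 2) = h n"
    using eventually_gt_at_top[of 0] by eventually_elim (simp add: h_def powr_diff powr_half_sqrt)
  ultimately show ?thesis by (auto intro: Lim_transform_eventually)
qed

lemma t_square_over_sqrt_tendsto_0: "(\<lambda>n. (t n)\<^sup>2 / sqrt (real n)) \<longlonglongrightarrow> 0"
  by (rule square_over_sqrt_tendsto_0[OF t_small \<gamma>_le])

lemma n_h_fourth_tendsto_0: "(\<lambda>n. real n * h n ^ 4) \<longlonglongrightarrow> 0"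
proof -
  have "(\<lambda>n. ((t n)\<^sup>2 / sqrt (real n))\<^sup>2) \<longlonglongrightarrow> 0"
    using tendsto_power[OF t_square_over_sqrt_tendsto_0, of 2] by simp
  moreover have "((t n)\<^sup>2 / sqrt (real n))\<^sup>2 = real n * h n ^ 4" for n
  proof (cases "n = 0")
    case False
    have "sqrt (real n) ^ 4 = (real n)\<^sup>2" 
      using power_mult[of "sqrt (real n)" 2 2] by simp
    thus ?thesis using False by (simp add: h_def power_divide power2_eq_square power4_eq_xxxx)
  qed simp
  ultimately show ?thesis by simp
qed

lemma n_h_square: "n > 0 \<Longrightarrow> real n * (h n)\<^sup>2 = (t n)\<^sup>2"
  and n_h_cube: "n > 0 \<Longrightarrow> real n * h n ^ 3 = t n ^ 3 / sqrt (real n)"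
  and sqrt_n_h: "n > 0 \<Longrightarrow> h n * sqrt (real n) = t n"
proof -
  assume n: "n > 0"
  show 1: "real n * (h n)\<^sup>2 = (t n)\<^sup>2" using n by (simp add: h_def power_divide)
  have "real n * h n ^ 3 = (real n * (h n)\<^sup>2) * h n" by (simp add: power2_eq_square power3_eq_cube)
  also have "\<dots> = t n ^ 3 / sqrt (real n)" unfolding 1 by (simp add: h_def power2_eq_square power3_eq_cube)
  finally show "real n * h n ^ 3 = t n ^ 3 / sqrt (real n)" .
  show "h n * sqrt (real n) = t n" using n by (simp add: h_def)
qed

text \<open>The finite-n hypotheses of the tilting estimates, bundled so that the limit arguments
  depend on one eventual property only.\<close>

definition regular :: "nat \<Rightarrow> bool" where
  "regular n \<longleftrightarrow> n > 0 \<and> t n \<ge> 1 \<and> h n \<le> 1 \<and> 3 * (h n)\<^sup>2 * G 2 \<le> 1 / 2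
     \<and> (\<forall>y. \<bar>y\<bar> \<le> L n \<longrightarrow> h n * \<bar>y\<bar> \<le> c / 2 * \<bar>y\<bar> powr p) \<and> (\<forall>y. \<bar>y\<bar> > L n \<longrightarrow> 1 \<le> h n * \<bar>y\<bar>)"

lemma regularD:
  assumes "regular n"
  shows "n > 0" "t n \<ge> 1" "h n \<ge> 0" "h n \<le> 1" "3 * (h n)\<^sup>2 * G 2 \<le> 1 / 2"
    "\<And>y. \<bar>y\<bar> \<le> L n \<longrightarrow> h n * \<bar>y\<bar> \<le> c / 2 * \<bar>y\<bar> powr p" "\<And>y. \<bar>y\<bar> > L n \<longrightarrow> 1 \<le> h n * \<bar>y\<bar>"
  using assms by (auto simp: regular_def h_def)

text \<open>Two products decide. For |y| > L n it matters that h n * L n = t n * n powr \<gamma> is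
  at least 1; for |y| \<le> L n, after splitting off |y| powr p, that h n * L n powr (1 - p) = t n /
  n powr \<gamma> tends to 0.\<close>

lemma eventually_regular: "\<forall>\<^sub>F n in sequentially. regular n"
proof -
  have e1: "\<forall>\<^sub>F n in sequentially. h n < 1"
    by (rule order_tendstoD(2)[OF h_tendsto_0]) simp
  have "(\<lambda>n. 3 * (h n)\<^sup>2 * G 2) \<longlonglongrightarrow> 3 * 0\<^sup>2 * G 2"
    by (intro tendsto_intros h_tendsto_0)
  hence e2: "\<forall>\<^sub>F n in sequentially. 3 * (h n)\<^sup>2 * G 2 < 1 / 2"
    by (rule order_tendstoD) simp
  have e3: "\<forall>\<^sub>F n in sequentially. t n / real n powr \<gamma> < c / 2"
    by (rule order_tendstoD(2)[OF t_small]) (use c_pos in simp)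
  show ?thesis
    using e1 e2 e3 eventually_t_ge[of 1] eventually_gt_at_top[of 0]
  proof eventually_elim
    case (elim n)
    have h0: "h n \<ge> 0" using elim by (simp add: h_def)
    have hL: "h n * L n = t n * real n powr \<gamma>"
      using elim by (simp add: h_def L_def powr_add powr_half_sqrt)
    have hL': "h n * L n powr (1 - p) = t n / real n powr \<gamma>"
    proof -
      have "h n * L n powr (1 - p) = h n * L n / real n powr (2 * \<gamma>)"
        by (simp add: powr_diff L_powr_p powr_one[OF L_nonneg] L_nonneg)
      also have "real n powr (2 * \<gamma>) = real n powr \<gamma> * real n powr \<gamma>"
        by (simp add: powr_add[symmetric])
      finally show ?thesis unfolding hL using elim by simp
    qed
    have "h n * \<bar>y\<bar> \<le> c / 2 * \<bar>y\<bar> powr p" if y: "\<bar>y\<bar> \<le> L n" for y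
    proof (cases "y = 0")
      case False
      have "h n * \<bar>y\<bar> = h n * \<bar>y\<bar> powr (1 - p) * \<bar>y\<bar> powr p"
        using False by (simp add: powr_diff)
      also have "\<dots> \<le> h n * L n powr (1 - p) * \<bar>y\<bar> powr p"
        using y h0 p_bounds by (intro mult_right_mono mult_left_mono powr_mono2) auto
      also have "\<dots> \<le> c / 2 * \<bar>y\<bar> powr p"
        unfolding hL' using elim by (intro mult_right_mono) auto
      finally show ?thesis .
    qed simp
    moreover have "1 \<le> h n * \<bar>y\<bar>" if y: "\<bar>y\<bar> > L n" for y
    proof -
      have "1 * 1 \<le> t n * real n powr \<gamma>"
        using elim \<gamma>_pos by (intro mult_mono ge_one_powr_ge_zero) auto
      also have "\<dots> \<le> h n * \<bar>y\<bar>" unfolding hL[symmetric] using y h0 by (intro mult_left_mono) auto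
      finally show ?thesis by simp
    qed
    ultimately show ?case using elim unfolding regular_def by auto
  qed
qed

lemma integrable_G: "integrable M (\<lambda>x. \<bar>Y x\<bar> ^ k * exp (c / 2 * \<bar>Y x\<bar> powr p))"
  using integrable_power_times_exp_powr[OF c_pos p_bounds(1) Y_measurable] exp_moment by (simp add: p_def)

lemma tilted_bounds:
  assumes "regular n"
  defines "R \<equiv> distr (tilted M Y (h n) (L n)) borel (\<lambda>x. Y x - h n)"
  shows "\<bar>Z n - (1 + (h n)\<^sup>2 / 2 + h n ^ 3 / 6 * \<kappa>)\<bar> \<le> 3 * h n ^ 4 * G 4"
    and "Z n \<ge> 1 / 2" and "real_distribution R"
    and "integrable R (\<lambda>x. x)" "integrable R (\<lambda>x. x\<^sup>2)" "integrable R (\<lambda>x. \<bar>x\<bar> ^ 3)"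
    and "\<bar>LINT x|R. x\<bar> \<le> 6 * (h n)\<^sup>2 * (G 2 + G 3)"
    and "\<bar>(LINT x|R. x\<^sup>2) - 1\<bar> \<le> 2 * h n * (9 * G 3 + 3 * G 2 + 4)"
    and "(LINT x|R. \<bar>x\<bar> ^ 3) \<le> 24 * (G 3 + G 0)"
  using tilted_estimates[OF regularD(6,7)[OF assms(1)] regularD(3,4)[OF assms(1)] _ Y_measurable integrable_G mean_zero variance_one,
      folded G_def Z_def \<kappa>_def, OF _ regularD(5)[OF assms(1)]] c_pos
  unfolding R_def by auto

text \<open>Since Z n - 1 is of order h^2, replacing ln (Z n) by Z n - 1 costs order h^4, and n h^4
  tends to 0. The products n h^2 and n h^3 turn the explicit terms into t^2 and t^3 / sqrt
  n.\<close>

lemma log_normalization_tendsto: "(\<lambda>n. real n * ln (Z n) - ((t n)\<^sup>2 / 2 + \<kappa> * t n ^ 3 / (6 * sqrt (real n)))) \<longlonglongrightarrow> 0"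
proof -
  \<comment> \<open>As h \<le> 1, the powers h^3 and h^4 are at most h^2; summing the coefficients
    of all three gives |Z n - 1| \<le> K h^2.\<close>
  define K where "K = 1 / 2 + \<bar>\<kappa>\<bar> / 6 + 3 * G 4"
  have K0: "K \<ge> 0" unfolding K_def using G_nonneg[of 4] by simp
  have "(\<lambda>n. (h n)\<^sup>2 * K) \<longlonglongrightarrow> 0\<^sup>2 * K" by (intro tendsto_intros h_tendsto_0)
  hence e: "\<forall>\<^sub>F n in sequentially. (h n)\<^sup>2 * K < 1 / 2" by (rule order_tendstoD) simp
  have "\<forall>\<^sub>F n in sequentially. norm (real n * ln (Z n) - ((t n)\<^sup>2 / 2 + \<kappa> * t n ^ 3 / (6 * sqrt (real n))))
     \<le> (real n * h n ^ 4) * (2 * K\<^sup>2 + 3 * G 4)"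
    using e eventually_regular
  proof eventually_elim
    case (elim n)
    note r = regularD[OF elim(2)]
    define u where "u = Z n - 1"
    have u1: "\<bar>u - ((h n)\<^sup>2 / 2 + h n ^ 3 / 6 * \<kappa>)\<bar> \<le> 3 * h n ^ 4 * G 4"
      using tilted_bounds(1)[OF elim(2)] by (simp add: u_def algebra_simps)
    have "\<bar>u\<bar> \<le> (h n)\<^sup>2 * K"
    proof -
      have "h n ^ 3 \<le> (h n)\<^sup>2" "h n ^ 4 \<le> (h n)\<^sup>2" using r by (auto intro!: power_decreasing)
      hence "h n ^ 3 * (\<bar>\<kappa>\<bar> / 6) \<le> (h n)\<^sup>2 * (\<bar>\<kappa>\<bar> / 6)" "h n ^ 4 * (3 * G 4) \<le> (h n)\<^sup>2 * (3 * G 4)"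
        using G_nonneg[of 4] by (auto intro!: mult_right_mono)
      moreover have "\<bar>h n ^ 3 / 6 * \<kappa>\<bar> = h n ^ 3 * (\<bar>\<kappa>\<bar> / 6)" using r by (simp add: abs_mult)
      moreover have "(h n)\<^sup>2 \<ge> 0" by simp
      ultimately have "\<bar>u\<bar> \<le> (h n)\<^sup>2 / 2 + (h n)\<^sup>2 * (\<bar>\<kappa>\<bar> / 6) + (h n)\<^sup>2 * (3 * G 4)"
        using u1 by linarith
      thus ?thesis by (simp add: K_def algebra_simps)
    qed
    hence u2: "u\<^sup>2 \<le> h n ^ 4 * K\<^sup>2" and u3: "\<bar>u\<bar> \<le> 1 / 2"
      using power_mono[of "\<bar>u\<bar>" "(h n)\<^sup>2 * K" 2] elim by (auto simp: power_mult_distrib power_mult[symmetric])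
    have "\<bar>ln (1 + u) - u\<bar> \<le> 2 * u\<^sup>2"
      by (rule abs_ln_one_plus_x_minus_x_bound[OF u3])
    hence "\<bar>ln (Z n) - ((h n)\<^sup>2 / 2 + h n ^ 3 / 6 * \<kappa>)\<bar> \<le> 2 * (h n ^ 4 * K\<^sup>2) + 3 * h n ^ 4 * G 4"
      using u1 u2 unfolding u_def by simp
    hence "real n * \<bar>ln (Z n) - ((h n)\<^sup>2 / 2 + h n ^ 3 / 6 * \<kappa>)\<bar> \<le> real n * (2 * (h n ^ 4 * K\<^sup>2) + 3 * h n ^ 4 * G 4)"
      by (intro mult_left_mono) auto
    moreover have eq: "real n * ln (Z n) - ((t n)\<^sup>2 / 2 + \<kappa> * t n ^ 3 / (6 * sqrt (real n)))
       = real n * (ln (Z n) - ((h n)\<^sup>2 / 2 + h n ^ 3 / 6 * \<kappa>))"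
    proof -
      have "real n * (ln (Z n) - ((h n)\<^sup>2 / 2 + h n ^ 3 / 6 * \<kappa>))
          = real n * ln (Z n) - (real n * (h n)\<^sup>2 / 2 + \<kappa> * (real n * h n ^ 3) / 6)"
        by (simp add: algebra_simps)
      thus ?thesis unfolding n_h_square[OF r(1)] n_h_cube[OF r(1)] by simp
    qed
    moreover have "\<bar>real n\<bar> = real n" by simp
    ultimately have "norm (real n * ln (Z n) - ((t n)\<^sup>2 / 2 + \<kappa> * t n ^ 3 / (6 * sqrt (real n))))
        \<le> real n * (2 * (h n ^ 4 * K\<^sup>2) + 3 * h n ^ 4 * G 4)"
      by (simp only: real_norm_def abs_mult)
    thus ?case by (simp add: algebra_simps)
  qed
  moreover have "(\<lambda>n. (real n * h n ^ 4) * (2 * K\<^sup>2 + 3 * G 4)) \<longlonglongrightarrow> 0"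
    using tendsto_mult_right[OF n_h_fourth_tendsto_0, of "2 * K\<^sup>2 + 3 * G 4"] by simp
  ultimately show ?thesis by (rule Lim_null_comparison)
qed

lemma tilted_laplace_tendsto:
  "(\<lambda>n. t n * (LINT w|tilted_law M Y (h n) (L n) n. exp (- (t n * w)) * indicator {0<..} w)) \<longlonglongrightarrow> 1 / sqrt (2 * pi)"
proof -
  \<comment> \<open>The array lemma speaks of every n, so at the finitely many irregular n a point
    mass at 0 is inserted; its characteristic function 1 satisfies the power relation as
    well.\<close>
  define R where "R n = (if regular n then distr (tilted M Y (h n) (L n)) borel (\<lambda>x. Y x - h n) else return borel 0)" for n
  define D where "D n = (if regular n then tilted_law M Y (h n) (L n) n else return borel 0)" for n
  have ret: "real_distribution (return borel 0)"
    by (auto intro!: real_distribution.intro prob_space_return simp: real_distribution_axioms_def)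
  have ret_int: "integrable (return borel (0::real)) f" if "f \<in> borel_measurable borel" for f :: "real \<Rightarrow> real"
    using that finite_measure.integrable_const[OF prob_space.finite_measure[OF prob_space_return[of 0 borel]], of "f 0"]
    by (subst integrable_cong_AE[of _ _ "\<lambda>_. f 0"]) (auto simp: AE_return)
  have Zpos: "(LINT x|M. tilt_weight (h n) (L n) (Y x)) > 0" if "regular n" for n
    using tilted_bounds(2)[OF that] by (simp add: Z_def)
  have "(\<lambda>n. t n * (LINT w|D n. exp (- (t n * w)) * indicator {0<..} w)) \<longlonglongrightarrow> 1 / sqrt (2 * pi)"
  proof (rule triangular_array_one_sided_laplace_tendsto[of R "24 * (G 3 + G 0)" D])
    show "real_distribution (R n)" for n unfolding R_def using tilted_bounds(3) ret by auto
    show "integrable (R n) (\<lambda>x. x)" "integrable (R n) (\<lambda>x. x\<^sup>2)" "integrable (R n) (\<lambda>x. \<bar>x\<bar> ^ 3)" for n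
      unfolding R_def using tilted_bounds(4-6) by (auto intro!: ret_int)
    show "(LINT x|R n. \<bar>x\<bar> ^ 3) \<le> 24 * (G 3 + G 0)" for n
      unfolding R_def using tilted_bounds(9) G_nonneg[of 3] G_nonneg[of 0] by (auto simp: integral_return)
    show "real_distribution (D n)" for n
      unfolding D_def using real_distribution_tilted_law[OF Y_measurable Zpos] ret by auto
    show "char (D n) y = char (R n) (y / sqrt (real n)) ^ n" if "n > 0" for n y
      unfolding D_def R_def using char_tilted_law[OF Y_measurable Zpos]
      by (auto simp: char_def integral_return)
    show "filterlim t at_top sequentially" by (rule t_at_top)
    show "(\<lambda>n. (t n)\<^sup>2 / sqrt (real n)) \<longlonglongrightarrow> 0" by (rule t_square_over_sqrt_tendsto_0)
    \<comment> \<open>The tilted mean misses h by order h^2, and sqrt n * h^2 = t^2 / sqrt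
      n.\<close>
    show "(\<lambda>n. sqrt (real n) * (LINT x|R n. x)) \<longlonglongrightarrow> 0"
    proof (rule Lim_null_comparison)
      show "\<forall>\<^sub>F n in sequentially. norm (sqrt (real n) * (LINT x|R n. x)) \<le> (t n)\<^sup>2 / sqrt (real n) * (6 * (G 2 + G 3))"
        using eventually_regular
      proof eventually_elim
        case (elim n)
        have n: "n > 0" using regularD(1)[OF elim] .
        have "norm (sqrt (real n) * (LINT x|R n. x)) \<le> sqrt (real n) * (6 * (h n)\<^sup>2 * (G 2 + G 3))"
          unfolding real_norm_def abs_mult using tilted_bounds(7)[OF elim] elim
          by (auto simp: R_def intro!: mult_left_mono)
        also have "\<dots> = (sqrt (real n) * (h n)\<^sup>2) * (6 * (G 2 + G 3))" by simp
        also have "sqrt (real n) * (h n)\<^sup>2 = (t n)\<^sup>2 / sqrt (real n)"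
          using n unfolding sqrt_n_h[OF n, symmetric] by (simp add: power2_eq_square)
        finally show ?case .
      qed
      show "(\<lambda>n. (t n)\<^sup>2 / sqrt (real n) * (6 * (G 2 + G 3))) \<longlonglongrightarrow> 0"
        using tendsto_mult_right[OF t_square_over_sqrt_tendsto_0] by simp
    qed
    have "(\<lambda>n. (LINT x|R n. x\<^sup>2) - 1) \<longlonglongrightarrow> 0"
    proof (rule Lim_null_comparison)
      show "\<forall>\<^sub>F n in sequentially. norm ((LINT x|R n. x\<^sup>2) - 1) \<le> h n * (2 * (9 * G 3 + 3 * G 2 + 4))"
        using eventually_regular
      proof eventually_elim
        case (elim n)
        thus ?case using tilted_bounds(8)[OF elim] by (simp add: R_def algebra_simps)
      qed
      show "(\<lambda>n. h n * (2 * (9 * G 3 + 3 * G 2 + 4))) \<longlonglongrightarrow> 0"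
        using tendsto_mult_right[OF h_tendsto_0] by simp
    qed
    from tendsto_add[OF this tendsto_const[of 1]]
    show "(\<lambda>n. LINT x|R n. x\<^sup>2) \<longlonglongrightarrow> 1" by simp
  qed
  thus ?thesis
    by (rule Lim_transform_eventually) (use eventually_regular in eventually_elim, simp add: D_def)
qed

section \<open>Removal of the truncation and the tail asymptotics\<close>

lemma tail_le: "measure M {x \<in> space M. \<bar>Y x\<bar> > l} \<le> (LINT x|M. exp (c * \<bar>Y x\<bar> powr p)) * exp (- (c * l powr p))"
  if "l \<ge> 0"
proof -
  have "measure M {x \<in> space M. \<bar>Y x\<bar> > l} = (LINT x|M. indicator {x \<in> space M. \<bar>Y x\<bar> > l} x)"
    by simp
  also have "\<dots> \<le> (LINT x|M. exp (c * \<bar>Y x\<bar> powr p) * exp (- (c * l powr p)))"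
  proof (rule integral_mono)
    show "integrable M (\<lambda>x. exp (c * \<bar>Y x\<bar> powr p) * exp (- (c * l powr p)))"
      using exp_moment by (intro integrable_mult_left) (simp add: p_def)
    fix x
    show "indicator {x \<in> space M. \<bar>Y x\<bar> > l} x \<le> exp (c * \<bar>Y x\<bar> powr p) * exp (- (c * l powr p))"
    proof (cases "\<bar>Y x\<bar> > l")
      case True
      hence "l powr p \<le> \<bar>Y x\<bar> powr p" using that p_bounds by (intro powr_mono2) auto
      hence "c * l powr p \<le> c * \<bar>Y x\<bar> powr p" using c_pos by simp
      hence "1 \<le> exp (c * \<bar>Y x\<bar> powr p + - (c * l powr p))" by simp
      thus ?thesis unfolding exp_add by (simp add: indicator_def)
    qed simp
  qed (auto simp: less_top[symmetric])
  finally show ?thesis by simp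
qed

definition event :: "nat \<Rightarrow> (nat \<Rightarrow> 'a) set" where
  "event n = {x \<in> space (PiM {..<n} (\<lambda>_. M)). (\<Sum>i<n. Y (x i)) > t n * sqrt (real n)}"

text \<open>Union bound over the coordinates, with Markov's inequality for exp (c |Y| powr p) at the
  level L n.\<close>

lemma truncation_error:
  "\<bar>measure (PiM {..<n} (\<lambda>_. M)) (event n)
    - measure (PiM {..<n} (\<lambda>_. M)) {x \<in> space (PiM {..<n} (\<lambda>_. M)). (\<Sum>i<n. Y (x i)) > t n * sqrt (real n) \<and> (\<forall>i<n. \<bar>Y (x i)\<bar> \<le> L n)}\<bar>
   \<le> real n * ((LINT x|M. exp (c * \<bar>Y x\<bar> powr p)) * exp (- (c * real n powr (2 * \<gamma>))))"
proof -
  let ?P = "PiM {..<n} (\<lambda>_. M)"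
  let ?A = "{x \<in> space ?P. (\<Sum>i<n. Y (x i)) > t n * sqrt (real n) \<and> (\<forall>i<n. \<bar>Y (x i)\<bar> \<le> L n)}"
  let ?B = "\<lambda>i. {x \<in> space ?P. x i \<in> {y \<in> space M. \<bar>Y y\<bar> > L n}}"
  interpret P: product_prob_space "\<lambda>_. M" "{..<n}" by standard
  have B: "?B i \<in> sets ?P" "measure ?P (?B i) \<le> (LINT x|M. exp (c * \<bar>Y x\<bar> powr p)) * exp (- (c * real n powr (2 * \<gamma>)))"
    if "i < n" for i
  proof -
    have "measure ?P (?B i) = measure M {y \<in> space M. \<bar>Y y\<bar> > L n}"
      unfolding measure_def using that by (subst P.emeasure_PiM_Collect_single) auto
    also have "\<dots> \<le> (LINT x|M. exp (c * \<bar>Y x\<bar> powr p)) * exp (- (c * L n powr p))"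
      by (rule tail_le) (simp add: L_def)
    finally show "measure ?P (?B i) \<le> (LINT x|M. exp (c * \<bar>Y x\<bar> powr p)) * exp (- (c * real n powr (2 * \<gamma>)))"
      by (simp add: L_powr_p)
    show "?B i \<in> sets ?P" using that by (intro sets_Collect_single') auto
  qed
  have ev: "event n \<in> sets ?P" unfolding event_def by measurable
  have A: "?A \<in> sets ?P" by measurable
  have sub: "?A \<subseteq> event n" by (auto simp: event_def)
  have "event n \<subseteq> ?A \<union> (\<Union>i<n. ?B i)"
    by (auto simp: event_def space_PiM PiE_iff not_le)
  hence "measure ?P (event n) \<le> measure ?P (?A \<union> (\<Union>i<n. ?B i))"
    using A B by (intro P.finite_measure_mono) auto
  also have "\<dots> \<le> measure ?P ?A + measure ?P (\<Union>i<n. ?B i)"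
    using A B by (intro measure_Un_le) auto
  also have "measure ?P (\<Union>i<n. ?B i) \<le> (\<Sum>i<n. measure ?P (?B i))"
    using B by (intro measure_UNION_le) auto
  also have "\<dots> \<le> (\<Sum>i<n. (LINT x|M. exp (c * \<bar>Y x\<bar> powr p)) * exp (- (c * real n powr (2 * \<gamma>))))"
    using B by (intro sum_mono) auto
  finally have "measure ?P (event n) \<le> measure ?P ?A + real n * ((LINT x|M. exp (c * \<bar>Y x\<bar> powr p)) * exp (- (c * real n powr (2 * \<gamma>))))"
    by simp
  moreover have "measure ?P ?A \<le> measure ?P (event n)"
    using sub ev by (rule P.finite_measure_mono)
  ultimately show ?thesis by linarith
qed

text \<open>The multiplier is the reciprocal of the claimed asymptotic tail. On the truncated event
  the tilting identity applies; the truncation error is so small that a crude bound on the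
  multiplier disposes of it.\<close>

theorem moderate_deviation_tendsto:
  "(\<lambda>n. measure (PiM {..<n} (\<lambda>_. M)) (event n)
      * (t n * sqrt (2 * pi) * exp ((t n)\<^sup>2 / 2 - \<kappa> * t n ^ 3 / (6 * sqrt (real n))))) \<longlonglongrightarrow> 1"
proof -
  define E where "E n = t n * sqrt (2 * pi) * exp ((t n)\<^sup>2 / 2 - \<kappa> * t n ^ 3 / (6 * sqrt (real n)))" for n
  define A where "A n = measure (PiM {..<n} (\<lambda>_. M)) {x \<in> space (PiM {..<n} (\<lambda>_. M)). (\<Sum>i<n. Y (x i)) > t n * sqrt (real n) \<and> (\<forall>i<n. \<bar>Y (x i)\<bar> \<le> L n)}" for n
  define I where "I n = t n * (LINT w|tilted_law M Y (h n) (L n) n. exp (- (t n * w)) * indicator {0<..} w)" for n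
  define Q where "Q = (LINT x|M. exp (c * \<bar>Y x\<bar> powr p))"
  have Q0: "Q \<ge> 0" unfolding Q_def by (intro Bochner_Integration.integral_nonneg) auto
  have main: "(\<lambda>n. A n * E n) \<longlonglongrightarrow> 1"
  proof -
    have "(\<lambda>n. I n * sqrt (2 * pi) * exp (real n * ln (Z n) - ((t n)\<^sup>2 / 2 + \<kappa> * t n ^ 3 / (6 * sqrt (real n)))))
       \<longlonglongrightarrow> 1 / sqrt (2 * pi) * sqrt (2 * pi) * exp 0"
      unfolding I_def by (intro tendsto_intros tilted_laplace_tendsto log_normalization_tendsto)
    moreover have "\<forall>\<^sub>F n in sequentially. I n * sqrt (2 * pi) * exp (real n * ln (Z n) - ((t n)\<^sup>2 / 2 + \<kappa> * t n ^ 3 / (6 * sqrt (real n)))) = A n * E n"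
      using eventually_regular
    proof eventually_elim
      case (elim n)
      have Z: "Z n > 0" using tilted_bounds(2)[OF elim] by simp
      have A_eq: "A n = Z n ^ n * exp (- (t n)\<^sup>2) * (LINT w|tilted_law M Y (h n) (L n) n. exp (- (t n * w)) * indicator {0<..} w)"
        unfolding A_def Z_def
        by (rule tilting_identity) (use Z regularD(1)[OF elim] sqrt_n_h[of n] in \<open>auto simp: Z_def\<close>)
      have Zn: "Z n ^ n = exp (real n * ln (Z n))" using Z by (simp add: exp_of_nat_mult)
      define X where "X = \<kappa> * t n ^ 3 / (6 * sqrt (real n))"
      \<comment> \<open>Half of the exponent in exp (-t^2) is cancelled by the multiplier; the rest
        matches the expansion of n ln (Z n).\<close>
      have key: "exp (real n * ln (Z n)) * (exp (- (t n)\<^sup>2) * exp ((t n)\<^sup>2 / 2 - X)) = exp (real n * ln (Z n) - ((t n)\<^sup>2 / 2 + X))"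
        unfolding exp_add[symmetric] by (rule arg_cong[where f=exp]) (simp add: field_simps)
      have "A n * E n = I n * sqrt (2 * pi) * (exp (real n * ln (Z n)) * (exp (- (t n)\<^sup>2) * exp ((t n)\<^sup>2 / 2 - X)))"
        unfolding I_def E_def X_def A_eq Zn by (simp only: mult_ac)
      thus ?case unfolding key unfolding X_def by simp
    qed
    ultimately show ?thesis by (auto intro: Lim_transform_eventually)
  qed
  have err: "(\<lambda>n. (measure (PiM {..<n} (\<lambda>_. M)) (event n) - A n) * E n) \<longlonglongrightarrow> 0"
  proof (rule Lim_null_comparison)
    \<comment> \<open>With the threshold c/2 the multiplier grows at most like n exp (c/2 * n powr
      (2 \<gamma>)), half of the exponent in the truncation error; the surviving half beats
      n^2.\<close>
    have "(\<lambda>n. (t n / real n powr \<gamma>)\<^sup>2 * (1 / 2 + \<bar>\<kappa>\<bar> / 6)) \<longlonglongrightarrow> 0\<^sup>2 * (1 / 2 + \<bar>\<kappa>\<bar> / 6)"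
      by (intro tendsto_intros t_small)
    hence e1: "\<forall>\<^sub>F n in sequentially. (t n / real n powr \<gamma>)\<^sup>2 * (1 / 2 + \<bar>\<kappa>\<bar> / 6) < c / 2"
      by (rule order_tendstoD) (use c_pos in simp)
    have e2: "\<forall>\<^sub>F n in sequentially. t n / real n powr \<gamma> < 1"
      by (rule order_tendstoD(2)[OF t_small]) simp
    show "\<forall>\<^sub>F n in sequentially. norm ((measure (PiM {..<n} (\<lambda>_. M)) (event n) - A n) * E n)
        \<le> Q * sqrt (2 * pi) * ((real n)\<^sup>2 * exp (- (c / 2 * real n powr (2 * \<gamma>))))"
      using e1 e2 eventually_regular
    proof eventually_elim
      case (elim n)
      note r = regularD[OF elim(3)]
      have np: "real n powr \<gamma> > 0" using r(1) by simp
      have tn: "t n \<le> real n"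
      proof -
        have "t n \<le> real n powr \<gamma>" using elim(2) np by (simp add: field_simps)
        also have "\<dots> \<le> real n powr 1" using r(1) \<gamma>_le by (intro powr_mono) auto
        finally show ?thesis using r(1) by simp
      qed
      have "(t n)\<^sup>2 / 2 - \<kappa> * t n ^ 3 / (6 * sqrt (real n)) \<le> c / 2 * real n powr (2 * \<gamma>)"
      proof -
        have "- (\<kappa> * t n ^ 3 / (6 * sqrt (real n))) = (t n)\<^sup>2 * (- \<kappa> * h n / 6)"
          by (simp add: h_def power2_eq_square power3_eq_cube mult_ac)
        also have "\<dots> \<le> (t n)\<^sup>2 * (\<bar>\<kappa>\<bar> * 1 / 6)"
          using r by (intro mult_left_mono divide_right_mono mult_mono) auto
        finally have "(t n)\<^sup>2 / 2 - \<kappa> * t n ^ 3 / (6 * sqrt (real n)) \<le> (t n)\<^sup>2 * (1 / 2 + \<bar>\<kappa>\<bar> / 6)"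
          by (simp add: algebra_simps)
        also have "\<dots> \<le> c / 2 * (real n powr \<gamma>)\<^sup>2"
          using elim(1) np by (simp add: power_divide field_simps)
        also have "(real n powr \<gamma>)\<^sup>2 = real n powr (2 * \<gamma>)" using r(1) by (simp add: powr_power)
        finally show ?thesis .
      qed
      hence "exp ((t n)\<^sup>2 / 2 - \<kappa> * t n ^ 3 / (6 * sqrt (real n))) \<le> exp (c / 2 * real n powr (2 * \<gamma>))" by simp
      hence "E n \<le> real n * sqrt (2 * pi) * exp (c / 2 * real n powr (2 * \<gamma>))"
        unfolding E_def using tn r by (intro mult_mono) auto
      moreover have "E n \<ge> 0" unfolding E_def using r by simp
      moreover have "\<bar>measure (PiM {..<n} (\<lambda>_. M)) (event n) - A n\<bar> \<le> real n * (Q * exp (- (c * real n powr (2 * \<gamma>))))"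
        unfolding A_def Q_def by (rule truncation_error)
      ultimately have "norm ((measure (PiM {..<n} (\<lambda>_. M)) (event n) - A n) * E n)
          \<le> (real n * (Q * exp (- (c * real n powr (2 * \<gamma>))))) * (real n * sqrt (2 * pi) * exp (c / 2 * real n powr (2 * \<gamma>)))"
        unfolding real_norm_def abs_mult using Q0 by (intro mult_mono) auto
      also have "\<dots> = Q * sqrt (2 * pi) * ((real n)\<^sup>2 * (exp (- (c * real n powr (2 * \<gamma>))) * exp (c / 2 * real n powr (2 * \<gamma>))))"
        by (simp add: power2_eq_square)
      also have "exp (- (c * real n powr (2 * \<gamma>))) * exp (c / 2 * real n powr (2 * \<gamma>)) = exp (- (c / 2 * real n powr (2 * \<gamma>)))"
        by (simp add: exp_add[symmetric])
      finally show ?case .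
    qed
    have "(\<lambda>n. (real n)\<^sup>2 * exp (- (c / 2 * real n powr (2 * \<gamma>)))) \<longlonglongrightarrow> 0"
      using c_pos \<gamma>_pos by real_asymp
    from tendsto_mult[OF tendsto_const this, of "Q * sqrt (2 * pi)"]
    show "(\<lambda>n. Q * sqrt (2 * pi) * ((real n)\<^sup>2 * exp (- (c / 2 * real n powr (2 * \<gamma>))))) \<longlonglongrightarrow> 0" by simp
  qed
  from tendsto_add[OF main err] show ?thesis unfolding E_def[symmetric] by (simp add: algebra_simps)
qed

end

subsection \<open>Gaussian quantiles\<close>

interpretation std_normal: real_distribution std_normal_distribution
  by (rule real_dist_normal_dist)

lemma std_normal_tail_eq: "1 - cdf std_normal_distribution z = measure std_normal_distribution {z..}"
  and std_normal_isCont_cdf: "isCont (cdf std_normal_distribution) z"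
proof -
  have 0: "emeasure std_normal_distribution {z} = 0"
    by (subst emeasure_density) (auto intro!: nn_integral_null_set finite_imp_null_set_lborel simp flip: null_setsD1)
  thus "isCont (cdf std_normal_distribution) z"
    by (simp add: std_normal.isCont_cdf measure_def)
  have "measure std_normal_distribution {z..} = measure std_normal_distribution ({z} \<union> {z<..})"
    by (rule arg_cong[where f="measure _"]) auto
  also have "\<dots> = measure std_normal_distribution {z} + measure std_normal_distribution {z<..}"
    by (rule std_normal.finite_measure_Union) auto
  also have "measure std_normal_distribution {z} = 0" using 0 by (simp add: measure_def)
  also have "{z<..} = space std_normal_distribution - {..z}" by auto
  also have "measure std_normal_distribution \<dots> = 1 - cdf std_normal_distribution z"
    unfolding cdf_def2 by (rule std_normal.prob_compl) simp
  finally show "1 - cdf std_normal_distribution z = measure std_normal_distribution {z..}" by simp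
qed

text \<open>With \<phi> the Gaussian density, -\<phi>(x)/x is an antiderivative of \<phi>(x) (1 +
  1/x^2). So \<phi>(z)/z is the integral of the latter over x \<ge> z, where the extra factor lies
  between 1 and 1 + 1/z^2.\<close>

lemma std_normal_mills_ratio:
  assumes z: "z > 0"
  shows "measure std_normal_distribution {z..} \<le> std_normal_density z / z"
    and "std_normal_density z / z \<le> (1 + 1 / z\<^sup>2) * measure std_normal_distribution {z..}"
proof -
  have dens: "((\<lambda>x. - (std_normal_density x / x)) has_real_derivative std_normal_density x * (1 + 1 / x\<^sup>2)) (at x)"
    if "x > 0" for x
  proof -
    have "((\<lambda>x. C * exp (- x\<^sup>2 / 2)) has_real_derivative - x * (C * exp (- x\<^sup>2 / 2))) (at x)" for C
      by (auto intro!: derivative_eq_intros)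
    from this[of "1 / sqrt (2 * pi)", folded std_normal_density_def]
    have "(std_normal_density has_real_derivative - x * std_normal_density x) (at x)" .
    show ?thesis
      by (rule DERIV_cong[OF DERIV_minus[OF DERIV_divide[OF \<open>(std_normal_density has_real_derivative _) _\<close> DERIV_ident]]])
         (use that in \<open>simp_all add: field_simps power2_eq_square\<close>)
  qed
  have lim: "((\<lambda>x. - (std_normal_density x / x)) \<longlongrightarrow> 0) at_top"
    unfolding std_normal_density_def by real_asymp
  have I: "(\<integral>\<^sup>+x. ennreal (std_normal_density x * (1 + 1 / x\<^sup>2)) * indicator {z..} x \<partial>lborel)
      = ennreal (std_normal_density z / z)"
    using nn_integral_FTC_atLeast[of "\<lambda>x. std_normal_density x * (1 + 1 / x\<^sup>2)" z "\<lambda>x. - (std_normal_density x / x)" 0]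
      dens z lim by (auto simp: normal_density_nonneg)
  have T: "emeasure std_normal_distribution {z..} = (\<integral>\<^sup>+x. ennreal (std_normal_density x) * indicator {z..} x \<partial>lborel)"
    by (subst emeasure_density) auto
  have d0: "0 \<le> std_normal_density z / z" using z by (simp add: normal_density_nonneg)
  have "emeasure std_normal_distribution {z..} \<le> ennreal (std_normal_density z / z)"
    unfolding T I[symmetric]
  proof (intro nn_integral_mono mult_right_mono ennreal_leI)
    fix x
    show "std_normal_density x \<le> std_normal_density x * (1 + 1 / x\<^sup>2)"
      using mult_left_mono[of 1 "1 + 1 / x\<^sup>2" "std_normal_density x"] by (simp add: normal_density_nonneg)
  qed simp
  thus "measure std_normal_distribution {z..} \<le> std_normal_density z / z"
    using d0 by (simp add: std_normal.emeasure_eq_measure)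
  have "ennreal (std_normal_density z / z)
     \<le> (\<integral>\<^sup>+x. ennreal (1 + 1 / z\<^sup>2) * (ennreal (std_normal_density x) * indicator {z..} x) \<partial>lborel)"
    unfolding I[symmetric]
  proof (rule nn_integral_mono)
    fix x
    show "ennreal (std_normal_density x * (1 + 1 / x\<^sup>2)) * indicator {z..} x
       \<le> ennreal (1 + 1 / z\<^sup>2) * (ennreal (std_normal_density x) * indicator {z..} x)"
    proof (cases "z \<le> x")
      case True
      have "1 / x\<^sup>2 \<le> 1 / z\<^sup>2" using z True by (intro divide_left_mono power_mono) auto
      hence "std_normal_density x * (1 + 1 / x\<^sup>2) \<le> (1 + 1 / z\<^sup>2) * std_normal_density x"
        using mult_right_mono[of "1 + 1 / x\<^sup>2" "1 + 1 / z\<^sup>2" "std_normal_density x"]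
        by (simp add: normal_density_nonneg mult.commute)
      hence "ennreal (std_normal_density x * (1 + 1 / x\<^sup>2)) \<le> ennreal ((1 + 1 / z\<^sup>2) * std_normal_density x)"
        by (rule ennreal_leI)
      also have "\<dots> = ennreal (1 + 1 / z\<^sup>2) * ennreal (std_normal_density x)"
        by (rule ennreal_mult') simp
      finally show ?thesis using True by (simp del: ennreal_plus)
    qed simp
  qed
  also have "\<dots> = ennreal (1 + 1 / z\<^sup>2) * emeasure std_normal_distribution {z..}"
    unfolding T by (rule nn_integral_cmult) auto
  also have "\<dots> = ennreal ((1 + 1 / z\<^sup>2) * measure std_normal_distribution {z..})"
    by (simp add: std_normal.emeasure_eq_measure ennreal_mult')
  finally show "std_normal_density z / z \<le> (1 + 1 / z\<^sup>2) * measure std_normal_distribution {z..}"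
    by (subst (asm) ennreal_le_iff) (auto intro!: mult_nonneg_nonneg add_nonneg_nonneg)
qed

text \<open>By continuity the set defining the quantile is closed and contains its infimum, which
  gives one inequality; a solution from the intermediate value theorem bounds the infimum from above
  and gives the other.\<close>

lemma cdf_z_quantile:
  assumes q: "0 < q" "q < 1"
  shows "cdf std_normal_distribution (z_quantile q) = q"
proof -
  let ?F = "cdf std_normal_distribution"
  let ?S = "{x. q \<le> ?F x}"
  have cont: "continuous_on A ?F" for A
    by (rule continuous_at_imp_continuous_on) (simp add: std_normal_isCont_cdf)
  obtain a where a: "?F a < q"
    using order_tendstoD(2)[OF std_normal.cdf_lim_at_bot q(1)] by (auto simp: eventually_at_bot_linorder)
  obtain b where b: "?F b > q"
    using order_tendstoD(1)[OF std_normal.cdf_lim_at_top_prob q(2)] by (auto simp: eventually_at_top_linorder)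
  have "a \<le> b" using a b std_normal.cdf_nondecreasing[of b a] by linarith
  then obtain x where x: "?F x = q"
    using IVT'[of ?F a q b] a b cont by (metis less_imp_le)
  have bdd: "bdd_below ?S"
  proof (rule bdd_belowI)
    fix y assume "y \<in> ?S"
    thus "a \<le> y" using a std_normal.cdf_nondecreasing[of y a] by (cases "y \<le> a") auto
  qed
  have "closed ?S" by (intro closed_Collect_le continuous_on_const cont)
  hence "Inf ?S \<in> ?S" using x bdd by (intro closed_contains_Inf) auto
  moreover have "?F (Inf ?S) \<le> ?F x"
    using x bdd by (intro std_normal.cdf_nondecreasing cInf_lower) auto
  ultimately show ?thesis using x by (simp add: quantile_def)
qed

lemma z_quantile_at_top:
  fixes \<alpha> :: "nat \<Rightarrow> real"
  assumes \<alpha>: "\<And>n. \<alpha> n \<in> {0<..<1}" and lim: "\<alpha> \<longlonglongrightarrow> 0"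
  shows "filterlim (\<lambda>n. z_quantile (1 - \<alpha> n)) at_top sequentially"
  unfolding filterlim_at_top_ge[of _ _ 1]
proof (intro allI impI)
  fix K :: real assume K: "1 \<le> K"
  \<comment> \<open>The lower Mills bound shows that the Gaussian tail at K is strictly
    positive.\<close>
  have "0 < std_normal_density K / K" using K by (simp add: std_normal_density_def)
  also have "\<dots> \<le> (1 + 1 / K\<^sup>2) * measure std_normal_distribution {K..}"
    using K by (intro std_normal_mills_ratio(2)) simp
  finally have "0 < 1 - cdf std_normal_distribution K"
    unfolding std_normal_tail_eq by (simp add: zero_less_mult_iff add_nonneg_nonneg not_less)
  with lim have "\<forall>\<^sub>F n in sequentially. \<alpha> n < 1 - cdf std_normal_distribution K"
    by (rule order_tendstoD)
  thus "\<forall>\<^sub>F n in sequentially. K \<le> z_quantile (1 - \<alpha> n)"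
  proof eventually_elim
    case (elim n)
    have "cdf std_normal_distribution (z_quantile (1 - \<alpha> n)) = 1 - \<alpha> n"
      using \<alpha>[of n] by (intro cdf_z_quantile) auto
    thus ?case
      using elim std_normal.cdf_nondecreasing[of "z_quantile (1 - \<alpha> n)" K] by (cases "z_quantile (1 - \<alpha> n) \<le> K") auto
  qed
qed

text \<open>As \<alpha> n is exactly the Gaussian tail at z n, the Mills bounds squeeze the product
  between 1 / (1 + 1/z^2) and 1.\<close>

lemma z_quantile_tail_tendsto:
  fixes \<alpha> :: "nat \<Rightarrow> real"
  assumes \<alpha>: "\<And>n. \<alpha> n \<in> {0<..<1}" and lim: "\<alpha> \<longlonglongrightarrow> 0"
  defines "z \<equiv> \<lambda>n. z_quantile (1 - \<alpha> n)"
  shows "(\<lambda>n. \<alpha> n * (z n * sqrt (2 * pi) * exp ((z n)\<^sup>2 / 2))) \<longlonglongrightarrow> 1"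
proof -
  have z: "filterlim z at_top sequentially" unfolding z_def by (rule z_quantile_at_top[OF \<alpha> lim])
  have \<alpha>_eq: "\<alpha> n = measure std_normal_distribution {z n..}" for n
    using cdf_z_quantile[of "1 - \<alpha> n"] \<alpha>[of n] unfolding std_normal_tail_eq[symmetric] z_def by simp
  have b: "\<alpha> n * (z n * sqrt (2 * pi) * exp ((z n)\<^sup>2 / 2)) \<le> 1"
      "1 / (1 + 1 / (z n)\<^sup>2) \<le> \<alpha> n * (z n * sqrt (2 * pi) * exp ((z n)\<^sup>2 / 2))" if "z n > 0" for n
  proof -
    let ?c = "z n * sqrt (2 * pi) * exp ((z n)\<^sup>2 / 2)"
    have c: "?c > 0" using that by simp
    have d: "std_normal_density (z n) / z n = 1 / ?c"
      by (simp add: std_normal_density_def exp_minus field_simps)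
    show "\<alpha> n * ?c \<le> 1"
      using std_normal_mills_ratio(1)[OF that] c unfolding d \<alpha>_eq[symmetric] by (simp add: pos_le_divide_eq)
    have p: "1 + 1 / (z n)\<^sup>2 > 0" by (intro add_pos_nonneg) auto
    have "1 / ?c \<le> (1 + 1 / (z n)\<^sup>2) * \<alpha> n"
      using std_normal_mills_ratio(2)[OF that] unfolding d \<alpha>_eq[symmetric] .
    hence "1 \<le> (1 + 1 / (z n)\<^sup>2) * \<alpha> n * ?c" using c by (simp add: pos_divide_le_eq)
    thus "1 / (1 + 1 / (z n)\<^sup>2) \<le> \<alpha> n * ?c" using p by (simp add: pos_divide_le_eq mult_ac)
  qed
  have ev: "\<forall>\<^sub>F n in sequentially. z n > 0" using z by (simp add: filterlim_at_top_dense)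
  have "(\<lambda>n. 1 / (z n)\<^sup>2) \<longlonglongrightarrow> 0"
    by (intro real_tendsto_divide_at_top[OF tendsto_const] filterlim_pow_at_top z) auto
  hence "(\<lambda>n. 1 / (1 + 1 / (z n)\<^sup>2)) \<longlonglongrightarrow> 1 / (1 + 0)"
    by (intro tendsto_divide tendsto_add tendsto_const) auto
  hence lo: "(\<lambda>n. 1 / (1 + 1 / (z n)\<^sup>2)) \<longlonglongrightarrow> 1" by simp
  show ?thesis
    by (rule tendsto_sandwich[OF _ _ lo tendsto_const[of 1]]) (use ev b in \<open>auto elim!: eventually_mono\<close>)
qed

text \<open>The correction d tends to 0 because z^2 = o(sqrt n), so t / z tends to 1. But z d, of
  order z^3 / sqrt n, need not vanish in the limit: it is the term that has to cancel exactly
  between t^2/2 and the cubic term.\<close>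

lemma (in prob_space) corrected_quantile_tail:
  fixes Y :: "'a \<Rightarrow> real" and \<alpha> :: "nat \<Rightarrow> real"
  assumes Y: "Y \<in> borel_measurable M" and \<gamma>: "0 < \<gamma>" "\<gamma> \<le> 1 / 4" and c: "c > 0"
    and i: "integrable M (\<lambda>x. exp (c * \<bar>Y x\<bar> powr (4 * \<gamma> / (2 * \<gamma> + 1))))"
    and m1: "(LINT x|M. Y x) = 0" and m2: "(LINT x|M. (Y x)\<^sup>2) = 1"
    and \<alpha>: "\<And>n. \<alpha> n \<in> {0<..<1}" and lim: "\<alpha> \<longlonglongrightarrow> 0"
  defines "z \<equiv> \<lambda>n. z_quantile (1 - \<alpha> n)" and "k \<equiv> (LINT x|M. Y x ^ 3)"
  assumes small: "(\<lambda>n. z n / real n powr \<gamma>) \<longlonglongrightarrow> 0"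
  shows "(\<lambda>n. measure (PiM {..<n} (\<lambda>_. M)) {x \<in> space (PiM {..<n} (\<lambda>_. M)).
            (\<Sum>i<n. Y (x i)) > (z n + k / (6 * sqrt (real n)) * (z n)\<^sup>2) * sqrt (real n)}) \<sim>[sequentially] \<alpha>"
proof -
  define d where "d n = k / (6 * sqrt (real n)) * (z n)\<^sup>2" for n
  define t where "t n = z n + d n" for n
  have z: "filterlim z at_top sequentially" unfolding z_def by (rule z_quantile_at_top[OF \<alpha> lim])
  have zpos: "\<forall>\<^sub>F n in sequentially. z n > 0" using z by (simp add: filterlim_at_top_dense)
  have d0: "d \<longlonglongrightarrow> 0"
  proof -
    have "(\<lambda>n. k / 6 * ((z n)\<^sup>2 / sqrt (real n))) \<longlonglongrightarrow> k / 6 * 0"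
      by (intro tendsto_intros square_over_sqrt_tendsto_0[OF small \<gamma>(2)])
    thus ?thesis by (simp add: d_def[abs_def])
  qed
  have t: "filterlim t at_top sequentially"
    using filterlim_tendsto_add_at_top[OF d0 z] by (simp add: t_def[abs_def] add.commute)
  have tpos: "\<forall>\<^sub>F n in sequentially. t n > 0" using t by (simp add: filterlim_at_top_dense)
  have dz: "(\<lambda>n. d n / z n) \<longlonglongrightarrow> 0"
    by (rule real_tendsto_divide_at_top[OF d0 z])
  have ts: "(\<lambda>n. t n / real n powr \<gamma>) \<longlonglongrightarrow> 0"
  proof -
    have "(\<lambda>n. z n / real n powr \<gamma> + d n * real n powr (- \<gamma>)) \<longlonglongrightarrow> 0 + 0 * 0"
      by (intro tendsto_add tendsto_mult small d0 tendsto_neg_powr filterlim_real_sequentially) (use \<gamma> in auto)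
    thus ?thesis by (simp add: t_def add_divide_distrib powr_minus_divide)
  qed
  interpret moderate_deviation M Y \<gamma> c t
    using Y \<gamma> c i m1 m2 t ts by unfold_locales
  define P where "P n = measure (PiM {..<n} (\<lambda>_. M)) (event n)" for n
  have k: "\<kappa> = k" by (simp add: \<kappa>_def k_def)
  define E where "E n = t n * sqrt (2 * pi) * exp ((t n)\<^sup>2 / 2 - \<kappa> * t n ^ 3 / (6 * sqrt (real n)))" for n
  define E' where "E' n = z n * sqrt (2 * pi) * exp ((z n)\<^sup>2 / 2)" for n
  have P: "(\<lambda>n. P n * E n) \<longlonglongrightarrow> 1"
    unfolding P_def E_def by (rule moderate_deviation_tendsto)
  have A: "(\<lambda>n. \<alpha> n * E' n) \<longlonglongrightarrow> 1"
    unfolding E'_def z_def by (rule z_quantile_tail_tendsto[OF \<alpha> lim])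
  \<comment> \<open>This is E' n / E n in terms of d and d / z. The products z d have cancelled; 5/2
    is 3 - 1/2, from 3 d^2 in the cubic term and d^2/2 in t^2/2.\<close>
  have "(\<lambda>n. 1 / (1 + d n / z n) * exp (5 / 2 * (d n)\<^sup>2 + 3 * (d n)\<^sup>2 * (d n / z n) + (d n)\<^sup>2 * (d n / z n)\<^sup>2))
      \<longlonglongrightarrow> 1 / (1 + 0) * exp (5 / 2 * 0\<^sup>2 + 3 * 0\<^sup>2 * 0 + 0\<^sup>2 * 0\<^sup>2)"
    by (intro tendsto_intros dz d0) auto
  moreover have "\<forall>\<^sub>F n in sequentially. 1 / (1 + d n / z n) * exp (5 / 2 * (d n)\<^sup>2 + 3 * (d n)\<^sup>2 * (d n / z n) + (d n)\<^sup>2 * (d n / z n)\<^sup>2) = E' n / E n"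
    using zpos tpos eventually_gt_at_top[of 0]
  proof eventually_elim
    case (elim n)
    have kd: "\<kappa> / (6 * sqrt (real n)) = d n / (z n)\<^sup>2" unfolding k d_def using elim by simp
    have "\<kappa> * t n ^ 3 / (6 * sqrt (real n)) = d n / (z n)\<^sup>2 * t n ^ 3"
      unfolding kd[symmetric] by simp
    also have "\<dots> = z n * d n + 3 * (d n)\<^sup>2 + 3 * (d n)\<^sup>2 * (d n / z n) + (d n)\<^sup>2 * (d n / z n)\<^sup>2"
      using elim by (simp add: t_def field_simps power2_eq_square power3_eq_cube)
    finally have X: "\<kappa> * t n ^ 3 / (6 * sqrt (real n)) = \<dots>" .
    have Y: "(t n)\<^sup>2 / 2 = (z n)\<^sup>2 / 2 + z n * d n + (d n)\<^sup>2 / 2"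
      by (simp add: t_def power2_eq_square field_simps)
    have "5 / 2 * (d n)\<^sup>2 + 3 * (d n)\<^sup>2 * (d n / z n) + (d n)\<^sup>2 * (d n / z n)\<^sup>2
       = (z n)\<^sup>2 / 2 - ((t n)\<^sup>2 / 2 - \<kappa> * t n ^ 3 / (6 * sqrt (real n)))"
      unfolding X Y by simp
    moreover have "1 / (1 + d n / z n) = z n / t n" using elim by (simp add: t_def field_simps)
    ultimately have "1 / (1 + d n / z n) * exp (5 / 2 * (d n)\<^sup>2 + 3 * (d n)\<^sup>2 * (d n / z n) + (d n)\<^sup>2 * (d n / z n)\<^sup>2)
       = z n / t n * (exp ((z n)\<^sup>2 / 2) / exp ((t n)\<^sup>2 / 2 - \<kappa> * t n ^ 3 / (6 * sqrt (real n))))"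
      by (simp only: exp_diff)
    thus ?case by (simp add: E_def E'_def)
  qed
  ultimately have "(\<lambda>n. E' n / E n) \<longlonglongrightarrow> 1"
    by (auto intro: Lim_transform_eventually)
  from tendsto_mult[OF tendsto_divide[OF P A] this]
  have "(\<lambda>n. P n * E n / (\<alpha> n * E' n) * (E' n / E n)) \<longlonglongrightarrow> 1" by simp
  moreover have "\<forall>\<^sub>F n in sequentially. P n * E n / (\<alpha> n * E' n) * (E' n / E n) = P n / \<alpha> n"
    using zpos tpos
  proof eventually_elim
    case (elim n)
    have "E n \<noteq> 0" "E' n \<noteq> 0" using elim by (auto simp: E_def E'_def)
    thus ?case by simp
  qed
  ultimately have "(\<lambda>n. P n / \<alpha> n) \<longlonglongrightarrow> 1"
    by (auto intro: Lim_transform_eventually)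
  hence "P \<sim>[sequentially] \<alpha>"
    by (rule asymp_equivI') 
  thus ?thesis unfolding P_def event_def unfolding t_def d_def .
qed

subsection \<open>Derivatives of the log-partition function\<close>

text \<open>At an end point of the parameter set a finite partition integral does not imply finite
  moments, so they are required separately.\<close>

definition exp_moments :: "real measure \<Rightarrow> real \<Rightarrow> bool" where
  "exp_moments \<nu> \<theta> \<longleftrightarrow> (\<forall>k::nat. integrable \<nu> (\<lambda>x. \<bar>x\<bar> ^ k * exp (\<theta> * x)))"

definition exp_moment :: "real measure \<Rightarrow> nat \<Rightarrow> real \<Rightarrow> real" where
  "exp_moment \<nu> k \<theta> = (LINT x|\<nu>. x ^ k * exp (\<theta> * x))"

lemma nat_params_iff:
  assumes [measurable_cong]: "sets \<nu> = sets borel"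
  shows "\<theta> \<in> nat_params \<nu> \<longleftrightarrow> integrable \<nu> (\<lambda>x. exp (\<theta> * x))"
  by (auto simp: nat_params_def integrable_iff_bounded)

lemma exp_le_endpoints:
  fixes a b \<theta> x :: real
  assumes "a \<le> \<theta>" "\<theta> \<le> b"
  shows "exp (\<theta> * x) \<le> exp (a * x) + exp (b * x)"
proof (cases "x \<ge> 0")
  case True
  hence "exp (\<theta> * x) \<le> exp (b * x)" using assms by (simp add: mult_right_mono)
  thus ?thesis by (simp add: add_increasing)
next
  case False
  hence "exp (\<theta> * x) \<le> exp (a * x)" using assms by (simp add: mult_right_mono_neg)
  thus ?thesis by (simp add: add_increasing2)
qed

lemma exp_moments_between:
  assumes s[measurable_cong]: "sets \<nu> = sets borel"
    and ab: "exp_moments \<nu> a" "exp_moments \<nu> b" and \<theta>: "a \<le> \<theta>" "\<theta> \<le> b"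
  shows "exp_moments \<nu> \<theta>"
  unfolding exp_moments_def
proof
  fix k :: nat
  have "integrable \<nu> (\<lambda>x. \<bar>x\<bar> ^ k * exp (a * x) + \<bar>x\<bar> ^ k * exp (b * x))"
    using ab by (auto simp: exp_moments_def)
  thus "integrable \<nu> (\<lambda>x. \<bar>x\<bar> ^ k * exp (\<theta> * x))"
  proof (rule Bochner_Integration.integrable_bound)
    have "\<bar>x\<bar> ^ k * exp (\<theta> * x) \<le> \<bar>x\<bar> ^ k * exp (a * x) + \<bar>x\<bar> ^ k * exp (b * x)" for x :: real
      using mult_left_mono[OF exp_le_endpoints[OF \<theta>, of x], of "\<bar>x\<bar> ^ k"] by (simp add: distrib_left)
    thus "AE x in \<nu>. norm (\<bar>x\<bar> ^ k * exp (\<theta> * x)) \<le> norm (\<bar>x\<bar> ^ k * exp (a * x) + \<bar>x\<bar> ^ k * exp (b * x))"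
      by (auto simp: abs_mult intro: order_trans[OF _ abs_ge_self])
  qed measurable
qed

text \<open>There is room d on both sides: the power is at most a multiple of exp (d |x|), which
  moves \<theta> to \<theta> + d or \<theta> - d, still between a and b.\<close>

lemma exp_moments_interior:
  assumes s[measurable_cong]: "sets \<nu> = sets borel"
    and ab: "a \<in> nat_params \<nu>" "b \<in> nat_params \<nu>" and \<theta>: "a < \<theta>" "\<theta> < b"
  shows "exp_moments \<nu> \<theta>"
  unfolding exp_moments_def
proof
  fix k :: nat
  define d where "d = min (\<theta> - a) (b - \<theta>)"
  have d: "d > 0" "d \<le> \<theta> - a" "d \<le> b - \<theta>" using \<theta> by (auto simp: d_def)
  obtain C where C: "\<And>y. \<bar>y\<bar> ^ k \<le> C * exp (d * \<bar>y\<bar> powr 1)"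
    by (rule power_le_exp_powr[of d 1 k]) (use d in auto)
  have C0: "C \<ge> 0" using order_trans[OF _ C[of 0]] by (simp add: zero_le_mult_iff)
  have "integrable \<nu> (\<lambda>x. C * (exp (a * x) + exp (b * x)))"
    using ab by (auto simp: nat_params_iff[OF s])
  thus "integrable \<nu> (\<lambda>x. \<bar>x\<bar> ^ k * exp (\<theta> * x))"
  proof (rule Bochner_Integration.integrable_bound)
    have "\<bar>x\<bar> ^ k * exp (\<theta> * x) \<le> C * (exp (a * x) + exp (b * x))" for x :: real
    proof -
      have "\<bar>x\<bar> ^ k * exp (\<theta> * x) \<le> C * exp (d * \<bar>x\<bar>) * exp (\<theta> * x)"
        using C[of x] by (intro mult_right_mono) auto
      also have "\<dots> = C * exp ((\<theta> + (if x \<ge> 0 then d else - d)) * x)"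
        by (simp add: exp_add[symmetric] algebra_simps)
      also have "\<dots> \<le> C * (exp (a * x) + exp (b * x))"
        using d \<theta> by (intro mult_left_mono exp_le_endpoints C0) auto
      finally show ?thesis .
    qed
    thus "AE x in \<nu>. norm (\<bar>x\<bar> ^ k * exp (\<theta> * x)) \<le> norm (C * (exp (a * x) + exp (b * x)))"
      by (simp add: abs_mult C0)
  qed measurable
qed

text \<open>Differentiation under the integral, with a majorant of the difference quotients from the
  mean value inequality. It holds up to the end points of the interval, so one-sided derivatives are
  covered.\<close>

lemma exp_moment_has_derivative:
  assumes s[measurable_cong]: "sets \<nu> = sets borel"
    and ab: "exp_moments \<nu> a" "exp_moments \<nu> b" and \<theta>: "a \<le> \<theta>" "\<theta> \<le> b"
  shows "(exp_moment \<nu> k has_real_derivative exp_moment \<nu> (Suc k) \<theta>) (at \<theta> within {a..b})"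
  unfolding has_field_derivative_iff tendsto_at_iff_sequentially comp_def
proof (intro allI impI)
  fix X :: "nat \<Rightarrow> real" assume X: "\<forall>i. X i \<in> {a..b} - {\<theta>}" "X \<longlonglongrightarrow> \<theta>"
  have int: "integrable \<nu> (\<lambda>x. x ^ j * exp (\<eta> * x))" if "\<eta> \<in> {a..b}" for \<eta> j
  proof (rule Bochner_Integration.integrable_bound)
    show "integrable \<nu> (\<lambda>x. \<bar>x\<bar> ^ j * exp (\<eta> * x))"
      using exp_moments_between[OF s ab, of \<eta>] that by (auto simp: exp_moments_def)
  qed (auto simp: abs_mult power_abs)
  have eq: "(exp_moment \<nu> k (X i) - exp_moment \<nu> k \<theta>) / (X i - \<theta>)
     = (LINT x|\<nu>. x ^ k * ((exp (X i * x) - exp (\<theta> * x)) / (X i - \<theta>)))" for i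
  proof -
    have "exp_moment \<nu> k (X i) - exp_moment \<nu> k \<theta> = (LINT x|\<nu>. x ^ k * exp (X i * x) - x ^ k * exp (\<theta> * x))"
      unfolding exp_moment_def using X(1) \<theta> by (subst Bochner_Integration.integral_diff) (auto intro!: int)
    also have "\<dots> / (X i - \<theta>) = (LINT x|\<nu>. (x ^ k * exp (X i * x) - x ^ k * exp (\<theta> * x)) / (X i - \<theta>))"
      by simp
    finally show ?thesis by (simp add: right_diff_distrib)
  qed
  have "(\<lambda>i. LINT x|\<nu>. x ^ k * ((exp (X i * x) - exp (\<theta> * x)) / (X i - \<theta>))) \<longlonglongrightarrow> (LINT x|\<nu>. x ^ k * (x * exp (\<theta> * x)))"
  proof (rule integral_dominated_convergence)
    show "integrable \<nu> (\<lambda>x. \<bar>x\<bar> ^ Suc k * exp (a * x) + \<bar>x\<bar> ^ Suc k * exp (b * x))"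
      using ab[unfolded exp_moments_def, rule_format, of "Suc k"] by (intro Bochner_Integration.integrable_add)
    show "AE x in \<nu>. (\<lambda>i. x ^ k * ((exp (X i * x) - exp (\<theta> * x)) / (X i - \<theta>))) \<longlonglongrightarrow> x ^ k * (x * exp (\<theta> * x))"
    proof (rule AE_I2)
      fix x
      have "((\<lambda>\<eta>. exp (\<eta> * x)) has_real_derivative x * exp (\<theta> * x)) (at \<theta> within {a..b})"
        by (auto intro!: derivative_eq_intros)
      hence "(\<lambda>i. (exp (X i * x) - exp (\<theta> * x)) / (X i - \<theta>)) \<longlonglongrightarrow> x * exp (\<theta> * x)"
        unfolding has_field_derivative_iff tendsto_at_iff_sequentially comp_def using X by blast
      thus "(\<lambda>i. x ^ k * ((exp (X i * x) - exp (\<theta> * x)) / (X i - \<theta>))) \<longlonglongrightarrow> x ^ k * (x * exp (\<theta> * x))"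
        by (intro tendsto_mult tendsto_const)
    qed
    show "AE x in \<nu>. norm (x ^ k * ((exp (X i * x) - exp (\<theta> * x)) / (X i - \<theta>)))
       \<le> \<bar>x\<bar> ^ Suc k * exp (a * x) + \<bar>x\<bar> ^ Suc k * exp (b * x)" for i
    proof (rule AE_I2)
      fix x
      have Xi: "X i \<in> {a..b}" "X i \<noteq> \<theta>" using X(1) by auto
      have "\<bar>exp (X i * x) - exp (\<theta> * x)\<bar> \<le> \<bar>x\<bar> * (exp (a * x) + exp (b * x)) * \<bar>X i - \<theta>\<bar>"
      proof -
        have "norm (exp (X i * x) - exp (\<theta> * x)) \<le> \<bar>x\<bar> * (exp (a * x) + exp (b * x)) * norm (X i - \<theta>)"
        proof (rule field_differentiable_bound[of "{a..b}" _ "\<lambda>\<eta>. x * exp (\<eta> * x)"])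
          show "((\<lambda>\<eta>. exp (\<eta> * x)) has_field_derivative x * exp (\<eta> * x)) (at \<eta> within {a..b})" for \<eta>
            by (auto intro!: derivative_eq_intros)
          show "norm (x * exp (\<eta> * x)) \<le> \<bar>x\<bar> * (exp (a * x) + exp (b * x))" if "\<eta> \<in> {a..b}" for \<eta>
            using that mult_left_mono[OF exp_le_endpoints[of a \<eta> b x], of "\<bar>x\<bar>"] by (simp add: abs_mult)
        qed (use Xi \<theta> in auto)
        thus ?thesis by simp
      qed
      hence "\<bar>exp (X i * x) - exp (\<theta> * x)\<bar> / \<bar>X i - \<theta>\<bar> \<le> \<bar>x\<bar> * (exp (a * x) + exp (b * x))"
        using Xi by (simp add: pos_divide_le_eq)
      hence "\<bar>x\<bar> ^ k * (\<bar>exp (X i * x) - exp (\<theta> * x)\<bar> / \<bar>X i - \<theta>\<bar>) \<le> \<bar>x\<bar> ^ k * (\<bar>x\<bar> * (exp (a * x) + exp (b * x)))"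
        by (intro mult_left_mono) auto
      moreover have e: "norm (x ^ k * ((exp (X i * x) - exp (\<theta> * x)) / (X i - \<theta>)))
         = \<bar>x\<bar> ^ k * (\<bar>exp (X i * x) - exp (\<theta> * x)\<bar> / \<bar>X i - \<theta>\<bar>)"
        by (simp only: real_norm_def abs_mult power_abs abs_divide)
      ultimately show "norm (x ^ k * ((exp (X i * x) - exp (\<theta> * x)) / (X i - \<theta>)))
         \<le> \<bar>x\<bar> ^ Suc k * exp (a * x) + \<bar>x\<bar> ^ Suc k * exp (b * x)"
        unfolding e by (simp add: distrib_left mult_ac)
    qed
  qed measurable
  thus "(\<lambda>i. (exp_moment \<nu> k (X i) - exp_moment \<nu> k \<theta>) / (X i - \<theta>)) \<longlonglongrightarrow> exp_moment \<nu> (Suc k) \<theta>"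
    unfolding eq by (simp add: exp_moment_def mult_ac)
qed

text \<open>At an end point of the parameter set only one-sided neighbourhoods are available; the interval
  \<open>{a..b}\<close> then has \<open>\<theta>\<close> itself as an end point.\<close>

lemma nat_params_local_interval:
  assumes s: "sets \<nu> = sets borel" and \<theta>: "\<theta> \<in> nat_params \<nu>" "\<theta> islimpt nat_params \<nu>" "exp_moments \<nu> \<theta>"
  obtains a b U where "a < b" "a \<le> \<theta>" "\<theta> \<le> b" "exp_moments \<nu> a" "exp_moments \<nu> b"
    "open U" "\<theta> \<in> U" "nat_params \<nu> \<inter> U = {a..b} \<inter> U"
proof -
  let ?S = "nat_params \<nu>"
  have conv: "\<eta> \<in> ?S" if "a \<in> ?S" "b \<in> ?S" "a \<le> \<eta>" "\<eta> \<le> b" for a b \<eta>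
  proof -
    have "integrable \<nu> (\<lambda>x. exp (a * x) + exp (b * x))"
      using that by (auto simp: nat_params_iff[OF s])
    hence "integrable \<nu> (\<lambda>x. exp (\<eta> * x))"
    proof (rule Bochner_Integration.integrable_bound)
      show "(\<lambda>x. exp (\<eta> * x)) \<in> borel_measurable \<nu>"
        by (simp add: measurable_cong_sets[OF s refl])
      have "norm (exp (\<eta> * x)) \<le> norm (exp (a * x) + exp (b * x))" for x
        using exp_le_endpoints[OF that(3,4), of x] by simp
      thus "AE x in \<nu>. norm (exp (\<eta> * x)) \<le> norm (exp (a * x) + exp (b * x))" by simp
    qed
    thus ?thesis by (simp add: nat_params_iff[OF s])
  qed
  have int_sub: "{a..b} \<subseteq> ?S" if "a \<in> ?S" "b \<in> ?S" for a b
    by (rule subsetI, rule conv[OF that]) auto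
  consider (both) a b where "a \<in> ?S" "b \<in> ?S" "a < \<theta>" "\<theta> < b"
    | (right) b where "b \<in> ?S" "\<theta> < b" "\<forall>s\<in>?S. \<theta> \<le> s"
    | (left) a where "a \<in> ?S" "a < \<theta>" "\<forall>s\<in>?S. s \<le> \<theta>"
  proof -
    obtain y where "y \<in> ?S" "y \<noteq> \<theta>" using \<theta>(2) by (auto simp: islimpt_def)
    thus ?thesis using that by (metis not_le_imp_less less_linear)
  qed
  thus ?thesis
  proof cases
    case both
    \<comment> \<open>Midpoints lie strictly between known parameters, so all their moments are
      finite.\<close>
    define a' b' where "a' = (a + \<theta>) / 2" and "b' = (\<theta> + b) / 2"
    have o: "a < a'" "a' < \<theta>" "\<theta> < b'" "b' < b" using both by (auto simp: a'_def b'_def)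
    have m: "exp_moments \<nu> a'" "exp_moments \<nu> b'"
      using o by (auto intro: exp_moments_interior[OF s both(1,2)])
    have "?S \<inter> {a'<..<b'} = {a'..b'} \<inter> {a'<..<b'}"
      using o int_sub[OF both(1,2)] by auto
    thus ?thesis using o m by (intro that[of a' b' "{a'<..<b'}"]) auto
  next
    case right
    define b' where "b' = (\<theta> + b) / 2"
    have o: "\<theta> < b'" "b' < b" using right by (auto simp: b'_def)
    have m: "exp_moments \<nu> b'"
      using o by (auto intro: exp_moments_interior[OF s \<theta>(1) right(1)])
    have "?S \<inter> {..<b'} = {\<theta>..b'} \<inter> {..<b'}"
      using o right(3) int_sub[OF \<theta>(1) right(1)] by auto
    thus ?thesis using o m \<theta>(3) by (intro that[of \<theta> b' "{..<b'}"]) auto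
  next
    case left
    define a' where "a' = (a + \<theta>) / 2"
    have o: "a < a'" "a' < \<theta>" using left by (auto simp: a'_def)
    have m: "exp_moments \<nu> a'"
      using o by (auto intro: exp_moments_interior[OF s left(1) \<theta>(1)])
    have "?S \<inter> {a'<..} = {a'..\<theta>} \<inter> {a'<..}"
      using o left(3) int_sub[OF left(1) \<theta>(1)] by auto
    thus ?thesis using o m \<theta>(3) by (intro that[of a' \<theta> "{a'<..}"]) auto
  qed
qed

text \<open>\<open>vector_derivative\<close> picks some derivative and is determined only where
  derivatives are unique. Within a nondegenerate compact interval they are, and near y the set S
  looks like one. As g and f need to agree only near y, the argument can be iterated.\<close>

lemma vector_derivative_within_locally:
  fixes f g :: "real \<Rightarrow> real"
  assumes ab: "a < b" and U: "open U" "S \<inter> U = {a..b} \<inter> U" and y: "y \<in> S \<inter> U"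
    and d: "(f has_real_derivative D) (at y within {a..b})" and eq: "\<And>x. x \<in> S \<inter> U \<Longrightarrow> g x = f x"
  shows "vector_derivative g (at y within S) = D"
proof -
  have w: "at y within S = at y within {a..b}"
    by (rule at_within_nhd[of y U]) (use U y in auto)
  have w2: "at y within {a..b} = at y within (S \<inter> U)"
    by (rule at_within_nhd[of y U]) (use U y in auto)
  have "(f has_vector_derivative D) (at y within (S \<inter> U))"
    using d unfolding w2 has_real_derivative_iff_has_vector_derivative .
  hence "(g has_vector_derivative D) (at y within (S \<inter> U))"
    by (rule has_vector_derivative_transform[rotated 2]) (use y eq in auto)
  hence "(g has_vector_derivative D) (at y within cbox a b)"
    unfolding w2[symmetric] by simp
  moreover have "y \<in> cbox a b" using y U by auto
  ultimately show ?thesis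
    unfolding w using vector_derivative_within_cbox[OF ab] by simp
qed

text \<open>The first three cumulants in terms of moments. Orders one and two are computed on a
  whole relative neighbourhood, because they are differentiated again; order three only at
  \<theta>.\<close>

lemma log_partition_derivs:
  assumes s: "sets \<nu> = sets borel" and \<theta>: "\<theta> \<in> nat_params \<nu>" "\<theta> islimpt nat_params \<nu>" "exp_moments \<nu> \<theta>"
    and pos: "\<forall>\<eta>\<in>nat_params \<nu>. exp_moment \<nu> 0 \<eta> > 0"
  defines "m \<equiv> \<lambda>k. exp_moment \<nu> k \<theta> / exp_moment \<nu> 0 \<theta>"
  shows "log_partition_deriv \<nu> 1 \<theta> = m 1"
    and "log_partition_deriv \<nu> 2 \<theta> = m 2 - (m 1)\<^sup>2"
    and "log_partition_deriv \<nu> 3 \<theta> = m 3 - 3 * m 1 * m 2 + 2 * m 1 ^ 3"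
proof -
  let ?S = "nat_params \<nu>"
  obtain a b U where ab: "a < b" "a \<le> \<theta>" "\<theta> \<le> b" "exp_moments \<nu> a" "exp_moments \<nu> b"
    and U: "open U" "\<theta> \<in> U" "?S \<inter> U = {a..b} \<inter> U"
    by (rule nat_params_local_interval[OF s \<theta>])
  note vd = vector_derivative_within_locally[OF ab(1) U(1,3)]
  let ?M = "exp_moment \<nu>"
  have M: "(?M k has_real_derivative ?M (Suc k) y) (at y within {a..b})" if "y \<in> ?S \<inter> U" for y k
    using exp_moment_has_derivative[OF s ab(4,5)] that U by auto
  have M0: "?M 0 y > 0" if "y \<in> ?S \<inter> U" for y using pos that by auto
  have th: "\<theta> \<in> ?S \<inter> U" using \<theta> U by auto
  have D1: "log_partition_deriv \<nu> 1 y = ?M 1 y / ?M 0 y" if y: "y \<in> ?S \<inter> U" for y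
  proof -
    have "((\<lambda>\<eta>. ln (?M 0 \<eta>)) has_real_derivative ?M 1 y / ?M 0 y) (at y within {a..b})"
      using M[OF y, of 0] M0[OF y] by (auto intro!: derivative_eq_intros simp: field_simps)
    from vd[OF y this, of "log_partition \<nu>"] show ?thesis
      by (simp add: log_partition_def exp_moment_def)
  qed
  have D2: "log_partition_deriv \<nu> 2 y = ?M 2 y / ?M 0 y - (?M 1 y / ?M 0 y)\<^sup>2" if y: "y \<in> ?S \<inter> U" for y
  proof -
    have "((\<lambda>\<eta>. ?M 1 \<eta> / ?M 0 \<eta>) has_real_derivative ?M 2 y / ?M 0 y - (?M 1 y / ?M 0 y)\<^sup>2) (at y within {a..b})"
      using M[OF y, of 0] M[OF y, of 1] M0[OF y]
      by (auto intro!: derivative_eq_intros simp: field_simps power2_eq_square numeral_2_eq_2)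
    from vd[OF y this, of "log_partition_deriv \<nu> 1"] D1 show ?thesis
      by (simp add: numeral_2_eq_2)
  qed
  have D3: "log_partition_deriv \<nu> 3 \<theta> = ?M 3 \<theta> / ?M 0 \<theta> - 3 * (?M 1 \<theta> / ?M 0 \<theta>) * (?M 2 \<theta> / ?M 0 \<theta>) + 2 * (?M 1 \<theta> / ?M 0 \<theta>) ^ 3"
  proof -
    have "((\<lambda>\<eta>. ?M 2 \<eta> / ?M 0 \<eta> - (?M 1 \<eta> / ?M 0 \<eta>)\<^sup>2) has_real_derivative
       ?M 3 \<theta> / ?M 0 \<theta> - 3 * (?M 1 \<theta> / ?M 0 \<theta>) * (?M 2 \<theta> / ?M 0 \<theta>) + 2 * (?M 1 \<theta> / ?M 0 \<theta>) ^ 3) (at \<theta> within {a..b})"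
      using M[OF th, of 0] M[OF th, of 1] M[OF th, of 2] M0[OF th]
      by (auto intro!: derivative_eq_intros simp: field_simps power2_eq_square power3_eq_cube numeral_2_eq_2 numeral_3_eq_3)
    from vd[OF th this, of "log_partition_deriv \<nu> 2"] D2 show ?thesis
      by (simp add: numeral_3_eq_3 numeral_2_eq_2)
  qed
  show "log_partition_deriv \<nu> 1 \<theta> = m 1" "log_partition_deriv \<nu> 2 \<theta> = m 2 - (m 1)\<^sup>2"
    "log_partition_deriv \<nu> 3 \<theta> = m 3 - 3 * m 1 * m 2 + 2 * m 1 ^ 3"
    unfolding m_def using D1[OF th] D2[OF th] D3 by auto
qed

text \<open>Serves to exclude a null base measure: a vanishing partition integral forces \<nu> to be
  null, and then \<open>log_partition\<close> is the constant ln 0 = 0.\<close>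

lemma log_partition_second_deriv_null:
  assumes s: "sets \<nu> = sets borel" and \<theta>: "\<theta> \<in> nat_params \<nu>" "\<theta> islimpt nat_params \<nu>" "exp_moments \<nu> \<theta>"
    and \<eta>: "\<eta> \<in> nat_params \<nu>" "exp_moment \<nu> 0 \<eta> \<le> 0"
  shows "log_partition_deriv \<nu> 2 \<theta> = 0"
proof -
  let ?S = "nat_params \<nu>"
  obtain a b U where ab: "a < b" "a \<le> \<theta>" "\<theta> \<le> b" "exp_moments \<nu> a" "exp_moments \<nu> b"
    and U: "open U" "\<theta> \<in> U" "?S \<inter> U = {a..b} \<inter> U"
    by (rule nat_params_local_interval[OF s \<theta>])
  have "exp_moment \<nu> 0 \<eta> = 0"
    using \<eta>(2) by (intro antisym) (auto simp: exp_moment_def intro!: Bochner_Integration.integral_nonneg)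
  hence "AE x in \<nu>. exp (\<eta> * x) = 0"
    using \<eta>(1) by (subst (asm) exp_moment_def, subst (asm) integral_nonneg_eq_0_iff_AE) (auto simp: nat_params_iff[OF s])
  hence "AE x in \<nu>. False" by simp
  hence "log_partition \<nu> = (\<lambda>_. 0)"
    unfolding log_partition_def by (intro ext) (subst integral_cong_AE[of _ _ "\<lambda>_. 0"], auto simp: measurable_cong_sets[OF s refl])
  moreover have "vector_derivative (\<lambda>_. 0::real) (at y within ?S) = 0" if "y \<in> ?S \<inter> U" for y
    by (rule vector_derivative_within_locally[OF ab(1) U(1,3) that, of "\<lambda>_. 0"]) auto
  ultimately have "nth_deriv_within ?S 1 (log_partition \<nu>) y = 0" if "y \<in> ?S \<inter> U" for y
    using that by simp
  hence "vector_derivative (nth_deriv_within ?S 1 (log_partition \<nu>)) (at \<theta> within ?S) = 0"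
    using \<theta> U by (intro vector_derivative_within_locally[OF ab(1) U(1,3), of _ "\<lambda>_. 0"]) auto
  thus ?thesis by (simp add: numeral_2_eq_2)
qed

section \<open>Moments under the exponential family\<close>

lemma
  assumes s: "sets \<nu> = sets borel" and [measurable]: "g \<in> borel_measurable borel" and pos: "exp_moment \<nu> 0 \<theta> > 0"
  shows integrable_exp_family_iff: "integrable (exp_family \<nu> \<theta>) g \<longleftrightarrow> integrable \<nu> (\<lambda>x. g x * exp (\<theta> * x))"
    and integral_exp_family: "(LINT x|exp_family \<nu> \<theta>. g x) = (LINT x|\<nu>. g x * exp (\<theta> * x)) / exp_moment \<nu> 0 \<theta>"
proof -
  note [measurable_cong] = s
  have e: "exp (\<theta> * x - log_partition \<nu> \<theta>) = exp (\<theta> * x) / exp_moment \<nu> 0 \<theta>" for x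
    using pos by (simp add: exp_diff log_partition_def exp_moment_def)
  have c: "(\<lambda>x. exp (\<theta> * x - log_partition \<nu> \<theta>) *\<^sub>R g x) = (\<lambda>x. (1 / exp_moment \<nu> 0 \<theta>) * (g x * exp (\<theta> * x)))"
    unfolding e by (auto simp: mult_ac)
  show "integrable (exp_family \<nu> \<theta>) g \<longleftrightarrow> integrable \<nu> (\<lambda>x. g x * exp (\<theta> * x))"
    unfolding exp_family_def using pos
    by (subst integrable_density) (auto simp only: c integrable_mult_left_iff, simp_all)
  show "(LINT x|exp_family \<nu> \<theta>. g x) = (LINT x|\<nu>. g x * exp (\<theta> * x)) / exp_moment \<nu> 0 \<theta>"
    unfolding exp_family_def
    by (subst integral_density, simp, simp, simp) (simp only: c integral_mult_right_zero, simp)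
qed

lemma prob_space_exp_family:
  assumes s: "sets \<nu> = sets borel" and \<theta>: "\<theta> \<in> nat_params \<nu>" and pos: "exp_moment \<nu> 0 \<theta> > 0"
  shows "prob_space (exp_family \<nu> \<theta>)"
proof (rule prob_spaceI)
  note [measurable_cong] = s
  have e: "exp (\<theta> * x - log_partition \<nu> \<theta>) = exp (\<theta> * x) / exp_moment \<nu> 0 \<theta>" for x
    using pos by (simp add: exp_diff log_partition_def exp_moment_def)
  have "emeasure (exp_family \<nu> \<theta>) (space (exp_family \<nu> \<theta>)) = (\<integral>\<^sup>+x. ennreal (exp (\<theta> * x) / exp_moment \<nu> 0 \<theta>) \<partial>\<nu>)"
    unfolding exp_family_def e by (subst emeasure_density) (auto cong: nn_integral_cong)
  also have "\<dots> = ennreal (LINT x|\<nu>. exp (\<theta> * x) / exp_moment \<nu> 0 \<theta>)"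
    using \<theta> pos by (intro nn_integral_eq_integral) (auto simp: nat_params_iff[OF s])
  also have "(LINT x|\<nu>. exp (\<theta> * x) / exp_moment \<nu> 0 \<theta>) = 1"
    using pos by (simp add: exp_moment_def)
  finally show "emeasure (exp_family \<nu> \<theta>) (space (exp_family \<nu> \<theta>)) = 1" by simp
qed

lemma linnik_condition_integrable:
  assumes "sets M = sets borel" and "linnik_condition \<gamma> M m"
  shows "integrable M (\<lambda>x. exp (\<bar>x - m\<bar> powr (4 * \<gamma> / (2 * \<gamma> + 1))))"
proof -
  note [measurable_cong] = assms(1)
  show ?thesis
    using assms(2) unfolding linnik_condition_def integrable_iff_bounded by auto
qed

text \<open>The stretched exponential dominates every power, so all moments exist at \<theta> even
  when it is an end point of the parameter set.\<close>

lemma linnik_condition_exp_moments: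
  assumes s: "sets \<nu> = sets borel" and \<gamma>: "\<gamma> > 0" and lin: "linnik_condition \<gamma> (exp_family \<nu> \<theta>) m"
  shows "exp_moments \<nu> \<theta>"
  unfolding exp_moments_def
proof
  fix k :: nat
  note [measurable_cong] = s
  let ?p = "4 * \<gamma> / (2 * \<gamma> + 1)"
  let ?e = "\<lambda>x. exp (\<bar>x - m\<bar> powr ?p)"
  obtain C where C: "\<And>y. \<bar>y\<bar> ^ k \<le> C * exp (1 * \<bar>y\<bar> powr ?p)"
    by (rule power_le_exp_powr[of 1 ?p k]) (use \<gamma> in auto)
  have le: "\<bar>x\<bar> ^ k \<le> 2 ^ k * (C + \<bar>m\<bar> ^ k) * ?e x" for x
  proof -
    have "\<bar>x\<bar> \<le> 2 * max \<bar>x - m\<bar> \<bar>m\<bar>"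
      using abs_triangle_ineq[of "x - m" m] by (simp add: max_def)
    hence "\<bar>x\<bar> ^ k \<le> (2 * max \<bar>x - m\<bar> \<bar>m\<bar>) ^ k" by (intro power_mono) auto
    also have "\<dots> = 2 ^ k * max \<bar>x - m\<bar> \<bar>m\<bar> ^ k" by (simp add: power_mult_distrib)
    also have "\<dots> \<le> 2 ^ k * (\<bar>x - m\<bar> ^ k + \<bar>m\<bar> ^ k)"
      by (intro mult_left_mono) (auto simp: max_def)
    also have "\<dots> \<le> 2 ^ k * (C * ?e x + \<bar>m\<bar> ^ k * ?e x)"
      using C[of "x - m"] by (intro mult_left_mono add_mono) (auto simp: mult_le_cancel_left1 not_less)
    finally show ?thesis by (simp add: algebra_simps)
  qed
  have "integrable (exp_family \<nu> \<theta>) ?e"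
    by (rule linnik_condition_integrable[OF _ lin]) (simp add: exp_family_def s)
  hence i: "integrable \<nu> (\<lambda>x. exp (\<theta> * x - log_partition \<nu> \<theta>) * ?e x)"
    unfolding exp_family_def by (subst (asm) integrable_density) auto
  have "integrable \<nu> (\<lambda>x. (2 ^ k * (C + \<bar>m\<bar> ^ k) * exp (log_partition \<nu> \<theta>)) * (exp (\<theta> * x - log_partition \<nu> \<theta>) * ?e x))"
    by (intro integrable_mult_right i)
  thus "integrable \<nu> (\<lambda>x. \<bar>x\<bar> ^ k * exp (\<theta> * x))"
  proof (rule Bochner_Integration.integrable_bound)
    have le2: "\<bar>x\<bar> ^ k * exp (\<theta> * x) \<le> (2 ^ k * (C + \<bar>m\<bar> ^ k) * exp (log_partition \<nu> \<theta>)) * (exp (\<theta> * x - log_partition \<nu> \<theta>) * ?e x)" for x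
    proof -
      have "\<bar>x\<bar> ^ k * exp (\<theta> * x) \<le> (2 ^ k * (C + \<bar>m\<bar> ^ k) * ?e x) * exp (\<theta> * x)"
        by (intro mult_right_mono le) simp
      also have "\<dots> = (2 ^ k * (C + \<bar>m\<bar> ^ k) * exp (log_partition \<nu> \<theta>)) * (exp (\<theta> * x - log_partition \<nu> \<theta>) * ?e x)"
      proof -
        have "exp (\<theta> * x) = exp (log_partition \<nu> \<theta>) * exp (\<theta> * x - log_partition \<nu> \<theta>)"
          by (simp add: exp_add[symmetric])
        thus ?thesis by (simp only: mult_ac)
      qed
      finally show ?thesis .
    qed
    show "AE x in \<nu>. norm (\<bar>x\<bar> ^ k * exp (\<theta> * x))
       \<le> norm ((2 ^ k * (C + \<bar>m\<bar> ^ k) * exp (log_partition \<nu> \<theta>)) * (exp (\<theta> * x - log_partition \<nu> \<theta>) * ?e x))"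
    proof (rule AE_I2)
      fix x
      have "norm (\<bar>x\<bar> ^ k * exp (\<theta> * x)) = \<bar>x\<bar> ^ k * exp (\<theta> * x)" by simp
      also note le2[of x]
      also note abs_ge_self
      finally show "norm (\<bar>x\<bar> ^ k * exp (\<theta> * x))
         \<le> norm ((2 ^ k * (C + \<bar>m\<bar> ^ k) * exp (log_partition \<nu> \<theta>)) * (exp (\<theta> * x - log_partition \<nu> \<theta>) * ?e x))"
        unfolding real_norm_def .
    qed
  qed measurable
qed

text \<open>Cumulants of order two and three are central moments, which makes the second derivative
  the variance and the third the numerator of the skewness.\<close>

lemma exp_family_central_moments:
  assumes s: "sets \<nu> = sets borel" and \<theta>: "\<theta> \<in> nat_params \<nu>" "\<theta> islimpt nat_params \<nu>" "exp_moments \<nu> \<theta>"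
    and pos: "\<forall>\<eta>\<in>nat_params \<nu>. exp_moment \<nu> 0 \<eta> > 0"
  shows "integrable (exp_family \<nu> \<theta>) (\<lambda>x. x)"
    and "(LINT x|exp_family \<nu> \<theta>. x) = log_partition_deriv \<nu> 1 \<theta>"
    and "(LINT x|exp_family \<nu> \<theta>. (x - log_partition_deriv \<nu> 1 \<theta>)\<^sup>2) = log_partition_deriv \<nu> 2 \<theta>"
    and "(LINT x|exp_family \<nu> \<theta>. (x - log_partition_deriv \<nu> 1 \<theta>) ^ 3) = log_partition_deriv \<nu> 3 \<theta>"
proof -
  note [measurable_cong] = s
  define P where "P = exp_family \<nu> \<theta>"
  define m where "m k = exp_moment \<nu> k \<theta> / exp_moment \<nu> 0 \<theta>" for k
  interpret P: prob_space P unfolding P_def by (rule prob_space_exp_family[OF s \<theta>(1) bspec[OF pos \<theta>(1)]])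
  have i: "integrable P (\<lambda>x. x ^ k)" for k
    unfolding P_def
  proof (subst integrable_exp_family_iff[OF s _ bspec[OF pos \<theta>(1)]])
    show "integrable \<nu> (\<lambda>x. x ^ k * exp (\<theta> * x))"
      by (rule Bochner_Integration.integrable_bound[OF \<theta>(3)[unfolded exp_moments_def, rule_format, of k]])
         (auto simp: abs_mult power_abs)
  qed simp
  have m: "(LINT x|P. x ^ k) = m k" for k
    unfolding P_def m_def by (subst integral_exp_family[OF s _ bspec[OF pos \<theta>(1)]]) (auto simp: exp_moment_def)
  note d = log_partition_derivs[OF s \<theta> pos, folded m_def]
  show "integrable (exp_family \<nu> \<theta>) (\<lambda>x. x)" using i[of 1] by (simp add: P_def)
  show "(LINT x|exp_family \<nu> \<theta>. x) = log_partition_deriv \<nu> 1 \<theta>"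
    using m[of 1] d(1) by (simp add: P_def)
  have c2: "(x - m 1)\<^sup>2 = x ^ 2 - 2 * m 1 * x ^ 1 + (m 1)\<^sup>2 * x ^ 0" for x
    by (simp add: power2_eq_square algebra_simps)
  have c3: "(x - m 1) ^ 3 = x ^ 3 - 3 * m 1 * x ^ 2 + 3 * (m 1)\<^sup>2 * x ^ 1 - m 1 ^ 3 * x ^ 0" for x
    by (simp add: power2_eq_square power3_eq_cube algebra_simps)
  have "(LINT x|P. (x - m 1)\<^sup>2) = m 2 - 2 * m 1 * m 1 + (m 1)\<^sup>2 * m 0"
    unfolding c2
    by (simp only: Bochner_Integration.integral_add Bochner_Integration.integral_diff Bochner_Integration.integrable_diff
        integrable_mult_right integral_mult_right_zero i m)
  moreover have "m 0 = 1" using bspec[OF pos \<theta>(1)] by (simp add: m_def)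
  ultimately show "(LINT x|exp_family \<nu> \<theta>. (x - log_partition_deriv \<nu> 1 \<theta>)\<^sup>2) = log_partition_deriv \<nu> 2 \<theta>"
    unfolding d P_def[symmetric] by (simp add: power2_eq_square)
  have "(LINT x|P. (x - m 1) ^ 3) = m 3 - 3 * m 1 * m 2 + 3 * (m 1)\<^sup>2 * m 1 - m 1 ^ 3 * m 0"
    unfolding c3
    by (simp only: Bochner_Integration.integral_add Bochner_Integration.integral_diff Bochner_Integration.integrable_diff
        Bochner_Integration.integrable_add integrable_mult_right integral_mult_right_zero i m)
  with \<open>m 0 = 1\<close> show "(LINT x|exp_family \<nu> \<theta>. (x - log_partition_deriv \<nu> 1 \<theta>) ^ 3) = log_partition_deriv \<nu> 3 \<theta>"
    unfolding d P_def[symmetric] by (simp add: power2_eq_square power3_eq_cube)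
qed

section \<open>Standardisation and conclusion\<close>

theorem proposition1:
  fixes \<nu> :: "real measure" and \<theta>\<^sub>0 \<gamma> :: real and \<alpha> \<beta> :: "nat \<Rightarrow> real"
  assumes "sigma_finite_measure \<nu>" and "sets \<nu> = sets borel"
    and "strict_mono_on {\<theta> \<in> nat_params \<nu>. integrable (exp_family \<nu> \<theta>) (\<lambda>x. x)}
           (\<lambda>\<theta>. \<integral>x. x \<partial>exp_family \<nu> \<theta>)"
    and "times_differentiable_within 3 (log_partition \<nu>) \<theta>\<^sub>0 (nat_params \<nu>)"
    and "log_partition_deriv \<nu> 2 \<theta>\<^sub>0 > 0"
    and "1 / 6 < \<gamma>" and "\<gamma> \<le> 1 / 4"
    and "linnik_condition \<gamma> (exp_family \<nu> \<theta>\<^sub>0) (log_partition_deriv \<nu> 1 \<theta>\<^sub>0)"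
    and "\<And>n. \<alpha> n \<in> {0<..<1}" and "\<And>n. \<beta> n \<in> {0<..<1}"
    and "\<alpha> \<longlonglongrightarrow> 0" and "\<beta> \<longlonglongrightarrow> 0"
    and "osipov_condition \<gamma> \<alpha> \<beta>"
  shows "(\<lambda>n. measure (\<Pi>\<^sub>M i\<in>{..<n}. exp_family \<nu> \<theta>\<^sub>0)
            {x \<in> space (\<Pi>\<^sub>M i\<in>{..<n}. exp_family \<nu> \<theta>\<^sub>0).
               sqrt (real n) * (((\<Sum>i<n. x i) / real n - log_partition_deriv \<nu> 1 \<theta>\<^sub>0)
                  / sqrt (log_partition_deriv \<nu> 2 \<theta>\<^sub>0))
               > z_quantile (1 - \<alpha> n)
                 + log_partition_deriv \<nu> 3 \<theta>\<^sub>0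
                     / (6 * sqrt (real n) * log_partition_deriv \<nu> 2 \<theta>\<^sub>0 powr (3 / 2))
                   * (z_quantile (1 - \<alpha> n))\<^sup>2})
         \<sim>[sequentially] \<alpha>"
proof -
  define P where "P = exp_family \<nu> \<theta>\<^sub>0"
  define \<mu> where "\<mu> = log_partition_deriv \<nu> 1 \<theta>\<^sub>0"
  define v where "v = log_partition_deriv \<nu> 2 \<theta>\<^sub>0"
  define \<tau> where "\<tau> = log_partition_deriv \<nu> 3 \<theta>\<^sub>0"
  define z where "z n = z_quantile (1 - \<alpha> n)" for n
  define p where "p = 4 * \<gamma> / (2 * \<gamma> + 1)"
  define Y where "Y x = (x - \<mu>) / sqrt v" for x :: real
  note s = assms(2)
  have \<gamma>: "0 < \<gamma>" "\<gamma> \<le> 1 / 4" using assms(6,7) by auto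
  have \<theta>: "\<theta>\<^sub>0 \<in> nat_params \<nu>" "\<theta>\<^sub>0 islimpt nat_params \<nu>"
    using assms(4) by (auto simp: times_differentiable_within_def)
  have em: "exp_moments \<nu> \<theta>\<^sub>0" by (rule linnik_condition_exp_moments[OF s \<gamma>(1) assms(8)])
  \<comment> \<open>Were some partition integral not positive, the second derivative at
    \<open>\<theta>\<^sub>0\<close> would be 0.\<close>
  have pos: "\<forall>\<eta>\<in>nat_params \<nu>. exp_moment \<nu> 0 \<eta> > 0"
  proof
    fix \<eta> assume "\<eta> \<in> nat_params \<nu>"
    thus "exp_moment \<nu> 0 \<eta> > 0"
      using log_partition_second_deriv_null[OF s \<theta> em] assms(5) by (metis less_irrefl not_le)
  qed
  note cm = exp_family_central_moments[OF s \<theta> em pos, folded \<mu>_def P_def v_def \<tau>_def]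
  interpret P: prob_space P unfolding P_def by (rule prob_space_exp_family[OF s \<theta>(1) bspec[OF pos \<theta>(1)]])
  have sP: "sets P = sets borel" by (simp add: P_def exp_family_def s)
  have v: "v > 0" using assms(5) by (simp add: v_def)
  have Ym: "Y \<in> borel_measurable P" unfolding measurable_cong_sets[OF sP refl] Y_def by measurable
  have m1: "(LINT x|P. Y x) = 0"
    using cm(1,2) P.prob_space by (simp add: Y_def)
  have m2: "(LINT x|P. (Y x)\<^sup>2) = 1"
    using cm(3) v by (simp add: Y_def power_divide)
  have v3: "v powr (3 / 2) = sqrt v ^ 3"
    using v by (simp add: powr_half_sqrt[symmetric] powr_power)
  have m3: "(LINT x|P. Y x ^ 3) = \<tau> / v powr (3 / 2)"
    using cm(4) by (simp add: Y_def power_divide v3)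
  \<comment> \<open>The standardised variable satisfies the moment condition with c = sqrt v powr p,
    the factor that scaling by the standard deviation produces.\<close>
  have ie: "integrable P (\<lambda>x. exp (sqrt v powr p * \<bar>Y x\<bar> powr p))"
  proof -
    have "sqrt v powr p * \<bar>Y x\<bar> powr p = \<bar>x - \<mu>\<bar> powr p" for x
      using v by (simp add: Y_def powr_mult[symmetric])
    thus ?thesis
      using linnik_condition_integrable[OF sP] assms(8) by (simp add: P_def \<mu>_def p_def)
  qed
  \<comment> \<open>Since z is eventually positive, its absolute value is below the maximum of the
    two quantiles, and the growth bound passes over to it.\<close>
  have zs: "(\<lambda>n. z n / real n powr \<gamma>) \<longlonglongrightarrow> 0"
  proof -
    let ?w = "\<lambda>n. max (z_quantile (1 - \<alpha> n)) (z_quantile (1 - \<beta> n))"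
    have w: "(\<lambda>n. ?w n / real n powr \<gamma>) \<longlonglongrightarrow> 0"
      using assms(13) by (intro smalloD_tendsto) (simp add: osipov_condition_def)
    have "\<forall>\<^sub>F n in sequentially. z n > 0"
      using z_quantile_at_top[OF assms(9,11)] by (simp add: filterlim_at_top_dense z_def)
    hence "\<forall>\<^sub>F n in sequentially. norm (z n / real n powr \<gamma>) \<le> ?w n / real n powr \<gamma>"
      by eventually_elim (auto simp: z_def intro!: divide_right_mono)
    thus ?thesis using w by (rule Lim_null_comparison)
  qed
  have "(\<lambda>n. measure (\<Pi>\<^sub>M i\<in>{..<n}. P) {x \<in> space (\<Pi>\<^sub>M i\<in>{..<n}. P).
        (\<Sum>i<n. Y (x i)) > (z n + \<tau> / v powr (3 / 2) / (6 * sqrt (real n)) * (z n)\<^sup>2) * sqrt (real n)}) \<sim>[sequentially] \<alpha>"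
    using P.corrected_quantile_tail[OF Ym \<gamma> _ ie[unfolded p_def] m1 m2 assms(9,11)] v zs
    by (simp add: m3 z_def)
  \<comment> \<open>The two inequalities differ by the factor sqrt n, which has to be positive; at n
    = 0 the events need not agree.\<close>
  moreover have "\<forall>\<^sub>F n in sequentially.
      measure (\<Pi>\<^sub>M i\<in>{..<n}. P) {x \<in> space (\<Pi>\<^sub>M i\<in>{..<n}. P).
        (\<Sum>i<n. Y (x i)) > (z n + \<tau> / v powr (3 / 2) / (6 * sqrt (real n)) * (z n)\<^sup>2) * sqrt (real n)}
    = measure (\<Pi>\<^sub>M i\<in>{..<n}. P) {x \<in> space (\<Pi>\<^sub>M i\<in>{..<n}. P).
        sqrt (real n) * (((\<Sum>i<n. x i) / real n - \<mu>) / sqrt v)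
          > z n + \<tau> / (6 * sqrt (real n) * v powr (3 / 2)) * (z n)\<^sup>2}"
    using eventually_gt_at_top[of 0]
  proof eventually_elim
    case (elim n)
    have "(\<Sum>i<n. Y (x i)) > (z n + \<tau> / v powr (3 / 2) / (6 * sqrt (real n)) * (z n)\<^sup>2) * sqrt (real n)
      \<longleftrightarrow> sqrt (real n) * (((\<Sum>i<n. x i) / real n - \<mu>) / sqrt v)
          > z n + \<tau> / (6 * sqrt (real n) * v powr (3 / 2)) * (z n)\<^sup>2" for x
    proof -
      have "(\<Sum>i<n. Y (x i)) = (\<Sum>i<n. x i - \<mu>) / sqrt v"
        by (simp only: Y_def sum_divide_distrib)
      also have "\<dots> = ((\<Sum>i<n. x i) - real n * \<mu>) / sqrt v" by (simp add: sum_subtractf)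
      also have "(\<Sum>i<n. x i) - real n * \<mu> = sqrt (real n) * sqrt (real n) * ((\<Sum>i<n. x i) / real n - \<mu>)"
        using elim by (simp add: right_diff_distrib)
      finally have Ys: "(\<Sum>i<n. Y (x i)) = sqrt (real n) * (((\<Sum>i<n. x i) / real n - \<mu>) / sqrt v) * sqrt (real n)"
        by (simp add: mult_ac)
      have k: "\<tau> / v powr (3 / 2) / (6 * sqrt (real n)) = \<tau> / (6 * sqrt (real n) * v powr (3 / 2))"
        by (simp add: mult_ac)
      show ?thesis unfolding Ys k using elim by (intro mult_less_cancel_right_pos) simp
    qed
    thus ?case by (simp only:)
  qed
  ultimately have "(\<lambda>n. measure (\<Pi>\<^sub>M i\<in>{..<n}. P) {x \<in> space (\<Pi>\<^sub>M i\<in>{..<n}. P).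
        sqrt (real n) * (((\<Sum>i<n. x i) / real n - \<mu>) / sqrt v)
          > z n + \<tau> / (6 * sqrt (real n) * v powr (3 / 2)) * (z n)\<^sup>2}) \<sim>[sequentially] \<alpha>"
    by (rule asymp_equiv_transfer[OF _ _ eventually_True[THEN eventually_mono]]) simp
  thus ?thesis unfolding P_def \<mu>_def v_def \<tau>_def z_def .
qed

end
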